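(* Let $D_\lambda\subset\mathbb{P}^{n-1}$ be the diagonal hypersurface $X_1^d+\cdots+X_n^d=d\lambda X_1^{h_1}\cdots X_n^{h_n}$ over $\mathbb{F}_q$, where $d,n\ge2$, $h_i\ge1$, $\sum_i h_i=d$, $\gcd(d,h_1,\dots,h_n)=1$, and $dh_i\mid q-1$ for all $i$. Suppose $\lambda\in\mathbb{F}_q^\times$ and let $w\in W$. Put $$C(t)=\prod_{\substack{w'\in W,\ w'\sim w\\ w'_i=0\text{ for some but not all }i}}\big(1-j(\varphi_d^{w'})t\big)^{(-1)^n}.$$ (i) If $w=mh$ for some $m\in\{0,\dots,d-1\}$, then $$L(D_\lambda,\chi^w;t)=\exp\Big(\sum_{r=1}^\infty(-1)^n j(\varphi_d^w)^{r(1-\delta(m))}F^w_r(\mathrm{red.}\ \widetilde{\varphi}_d^{\,m};\lambda)\frac{t^r}{r}\Big)\prod_{k=0}^{n-2}\frac{1}{1-q^kt}\cdot C(t),$$ where $\delta(m)=1$ if $m=0$ and $\delta(m)=0$ otherwise. (ii) If $w\not\sim0$, then $$L(D_\lambda,\chi^w;t)=\exp\Big(\sum_{r=1}^\infty(-1)^n j(\varphi_d^w)^{r}F^w_r(\lambda)\frac{t^r}{r}\Big)\,C(t).$$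
   Context: **Characters and hypergeometric functions.** For a finite field $k$ with $Q$ elements let $\widehat{k^\times}=\mathrm{Hom}(k^\times,\overline{\mathbb{Q}}^\times)$, with trivial character $\varepsilon$; put $\eta(0)=0$ for every $\eta$ (including $\varepsilon$), and $\delta(\eta)=1$ if $\eta=\varepsilon$, $0$ otherwise. Fix a nontrivial additive character $\psi$ of $k$ and put $g(\eta)=-\sum_{x\in k^\times}\eta(x)\psi(x)$, $g^\circ(\eta)=Q^{\delta(\eta)}g(\eta)$, $(\alpha)_\nu=g(\alpha\nu)/g(\alpha)$, $(\alpha)_\nu^\circ=g^\circ(\alpha\nu)/g^\circ(\alpha)$, and $$F(\alpha_1,\dots,\alpha_m;\beta_1,\dots,\beta_m;z)_Q=\frac{1}{1-Q}\sum_{\nu\in\widehat{k^\times}}\frac{(\alpha_1)_\nu\cdots(\alpha_m)_\nu}{(\beta_1)^\circ_\nu\cdots(\beta_m)^\circ_\nu}\,\nu(z)$$ (independent of $\psi$). Jacobi sum over $\mathbb{F}_q$: $j(\eta_1,\dots,\eta_n)=(-1)^{n-1}\sum_{x_i\in\mathbb{F}_q^\times,\ x_1+\cdots+x_n=1}\eta_1(x_1)\cdots\eta_n(x_n)$. Fix a generator $\varphi$ of $\widehat{\mathbb{F}_q^\times}$; for $m\mid q-1$ put $\varphi_m=\varphi^{(q-1)/m}$. Write $j(\varphi_d^w)=j(\varphi_d^{w_1},\dots,\varphi_d^{w_n})$. For $\eta\in\widehat{\mathbb{F}_q^\times}$ and $r\geq 1$, $\widetilde\eta=\eta\circ\mathrm{N}_{\mathbb{F}_{q^r}/\mathbb{F}_q}\in\widehat{\mathbb{F}_{q^r}^\times}$,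 and $\widetilde\varphi_m=\widetilde{\varphi_m}$. **Group action and $L$-functions.** Let $h=(h_1,\dots,h_n)$, $\mu_d\subset\mathbb{F}_q^\times$ the $d$th roots of unity, $\widetilde G=\{\xi\in\mu_d^n\mid \xi_1^{h_1}\cdots\xi_n^{h_n}=1\}$, $\Delta\subset\widetilde G$ the diagonal subgroup, $G=\widetilde G/\Delta$, acting on $D_\lambda$ by coordinatewise multiplication. Let $W=\{w\in(\mathbb{Z}/d\mathbb{Z})^n\mid w_1+\cdots+w_n=0\}$. For $w\in W$, $\chi^w(\xi)=\varphi(\xi_1^{w_1}\cdots\xi_n^{w_n})$ defines a character of $G$. Write $w\sim w'$ if $\chi^w=\chi^{w'}$, equivalently $w-w'=mh$ in $(\mathbb{Z}/d\mathbb{Z})^n$ for some $m\in\{0,\dots,d-1\}$. With $\Phi$ the $q$-Frobenius, $$N_r(D_\lambda;\chi)=\frac{1}{\#G}\sum_{\xi\in G}\chi(\xi)\,\#\{X\in D_\lambda(\overline{\mathbb{F}_q})\mid \xi^{-1}\Phi^r(X)=X\},\qquad L(D_\lambda,\chi;t)=\exp\Big(\sum_{r\ge1}\frac{N_r(D_\lambda;\chi)}{r}t^r\Big)\in\overline{\mathbb{Q}}[[t]].$$ **The functions $F^w_r$.** $F^w_r(\lambda)$ is the value $F(\cdots;\widetilde\varepsilon,\widetilde\varphi_d,\dots,\widetilde\varphi_d^{\,d-1};(\prod_{j=1}^n h_j^{h_j})\lambda^d)_{q^r}$ whose $d$ upper parameters are $\widetilde\varphi_{dh_i}^{\,w_i},\widetilde\varphi_{dh_i}^{\,w_i+d},\dots,\widetilde\varphi_{dh_i}^{\,w_i+d(h_i-1)}$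 for $i=1,\dots,n$, where in the exponents $w_i$ means its representative in $\{0,\dots,d-1\}$. When $w=mh$, $F^w_r(\mathrm{red.}\ \widetilde\varphi_d^{\,m};\lambda)$ is obtained from $F^w_r(\lambda)$ by removing one $\widetilde\varphi_d^{\,m}$ from both the upper and the lower parameters. *)

theory Defs
  imports "HOL-Algebra.Algebra" "HOL-Algebra.Algebraic_Closure_Type" "HOL-Library.Multiset" "HOL-Library.Cardinality"
begin

text \<open>
  The base field \<open>\<bbbF>\<^sub>q\<close> is a type \<open>'a :: finite_field\<close> with \<open>q = CARD('a)\<close>, and \<open>'a alg_closure\<close> is
  its algebraic closure. Finite fields \<open>k\<close> are treated as subsets of a field type, so that
  \<open>\<bbbF>\<^sub>q\<close> (as \<open>UNIV\<close>) and its extensions inside \<open>'a alg_closure\<close> are handled uniformly.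
\<close>

type_synonym qbar = "rat alg_closure"


section \<open>Characters and hypergeometric functions\<close>

text \<open>
  A multiplicative character of \<open>k\<close> is extended by \<open>0\<close> to all elements of the type outside
  \<open>k\<^sup>\<times>\<close>. The trivial character is thus the indicator function of \<open>k\<^sup>\<times>\<close>, and it is
  in particular \<open>0\<close> at \<open>0\<close>.
\<close>

definition trivial_char :: "'b::field set \<Rightarrow> 'b \<Rightarrow> qbar" where
  "trivial_char k = (\<lambda>x. if x \<in> k - {0} then 1 else 0)"

definition mult_chars :: "'b::field set \<Rightarrow> ('b \<Rightarrow> qbar) set" where
  "mult_chars k = {\<eta>. (\<forall>x\<in>k - {0}. \<forall>y\<in>k - {0}. \<eta> (x * y) = \<eta> x * \<eta> y) \<and>
                      (\<forall>x\<in>k - {0}. \<eta> x \<noteq> 0) \<and> (\<forall>x. x \<notin> k - {0} \<longrightarrow> \<eta> x = 0)}"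

definition char_group :: "'b::field set \<Rightarrow> ('b \<Rightarrow> qbar) monoid" where
  "char_group k = \<lparr>carrier = mult_chars k, monoid.mult = (\<lambda>\<alpha> \<beta> x. \<alpha> x * \<beta> x), one = trivial_char k\<rparr>"

definition nontrivial_add_chars :: "'b::field set \<Rightarrow> ('b \<Rightarrow> qbar) set" where
  "nontrivial_add_chars k = {\<psi>. (\<forall>x\<in>k. \<forall>y\<in>k. \<psi> (x + y) = \<psi> x * \<psi> y) \<and>
                                (\<forall>x\<in>k. \<psi> x \<noteq> 0) \<and> (\<exists>x\<in>k. \<psi> x \<noteq> 1)}"

definition gauss_sum :: "'b::field set \<Rightarrow> ('b \<Rightarrow> qbar) \<Rightarrow> ('b \<Rightarrow> qbar) \<Rightarrow> qbar" where
  "gauss_sum k \<psi> \<eta> = - (\<Sum>x\<in>k - {0}. \<eta> x * \<psi> x)"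

definition gauss_sum_circ :: "'b::field set \<Rightarrow> ('b \<Rightarrow> qbar) \<Rightarrow> ('b \<Rightarrow> qbar) \<Rightarrow> qbar" where
  "gauss_sum_circ k \<psi> \<eta> =
     of_nat (card k) ^ (if \<eta> = trivial_char k then 1 else 0) * gauss_sum k \<psi> \<eta>"

definition poch :: "'b::field set \<Rightarrow> ('b \<Rightarrow> qbar) \<Rightarrow> ('b \<Rightarrow> qbar) \<Rightarrow> ('b \<Rightarrow> qbar) \<Rightarrow> qbar" where
  "poch k \<psi> \<alpha> \<nu> = gauss_sum k \<psi> (\<alpha> \<otimes>\<^bsub>char_group k\<^esub> \<nu>) / gauss_sum k \<psi> \<alpha>"

definition poch_circ :: "'b::field set \<Rightarrow> ('b \<Rightarrow> qbar) \<Rightarrow> ('b \<Rightarrow> qbar) \<Rightarrow> ('b \<Rightarrow> qbar) \<Rightarrow> qbar" where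
  "poch_circ k \<psi> \<alpha> \<nu> = gauss_sum_circ k \<psi> (\<alpha> \<otimes>\<^bsub>char_group k\<^esub> \<nu>) / gauss_sum_circ k \<psi> \<alpha>"

definition hypergeom ::
  "'b::field set \<Rightarrow> ('b \<Rightarrow> qbar) \<Rightarrow> ('b \<Rightarrow> qbar) multiset \<Rightarrow> ('b \<Rightarrow> qbar) multiset \<Rightarrow> 'b \<Rightarrow> qbar" where
  "hypergeom k \<psi> A B z =
     1 / (1 - of_nat (card k)) *
     (\<Sum>\<nu>\<in>mult_chars k. (\<Prod>\<alpha>\<in>#A. poch k \<psi> \<alpha> \<nu>) / (\<Prod>\<beta>\<in>#B. poch_circ k \<psi> \<beta> \<nu>) * \<nu> z)"

text \<open>The index set \<open>{1, \<dots>, n}\<close> is a finite type \<open>'n\<close> with \<open>n = CARD('n)\<close>.\<close>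

definition jacobi_sum :: "('n::finite \<Rightarrow> 'a::finite_field \<Rightarrow> qbar) \<Rightarrow> qbar" where
  "jacobi_sum \<eta> = (-1) ^ (CARD('n) - 1) *
     (\<Sum>x | (\<forall>i. x i \<noteq> 0) \<and> (\<Sum>i\<in>UNIV. x i) = 1. \<Prod>i\<in>UNIV. \<eta> i (x i))"

text \<open>\<open>\<phi>\<^sub>m = \<phi>\<^bsup>(q-1)/m\<^esup>\<close>, used only for \<open>m dvd q - 1\<close>.\<close>

definition root_char :: "('a::finite_field \<Rightarrow> qbar) \<Rightarrow> nat \<Rightarrow> 'a \<Rightarrow> qbar" where
  "root_char \<phi> m = \<phi> [^]\<^bsub>char_group UNIV\<^esub> ((CARD('a) - 1) div m)"

definition jacobi_w :: "('a::finite_field \<Rightarrow> qbar) \<Rightarrow> nat \<Rightarrow> ('n::finite \<Rightarrow> nat) \<Rightarrow> qbar" where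
  "jacobi_w \<phi> d w = jacobi_sum (\<lambda>i. root_char \<phi> d [^]\<^bsub>char_group UNIV\<^esub> w i)"


section \<open>Extensions of the base field\<close>

definition ext_field :: "nat \<Rightarrow> 'a::finite_field alg_closure set" where
  "ext_field r = {x. x ^ (CARD('a) ^ r) = x}"

text \<open>The norm from \<open>ext_field r\<close> to \<open>'a\<close> as the product of the conjugates.\<close>

definition ext_norm :: "nat \<Rightarrow> 'a::finite_field alg_closure \<Rightarrow> 'a" where
  "ext_norm r x = of_ac (\<Prod>i<r. x ^ (CARD('a) ^ i))"

definition lift_char :: "nat \<Rightarrow> ('a::finite_field \<Rightarrow> qbar) \<Rightarrow> 'a alg_closure \<Rightarrow> qbar" where
  "lift_char r \<eta> = (\<lambda>x. if x \<in> ext_field r then \<eta> (ext_norm r x) else 0)"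


section \<open>The functions \<open>F\<^sup>w\<^sub>r\<close>\<close>

definition upper_params ::
  "('a::finite_field \<Rightarrow> qbar) \<Rightarrow> nat \<Rightarrow> ('n::finite \<Rightarrow> nat) \<Rightarrow> ('n \<Rightarrow> nat) \<Rightarrow> nat \<Rightarrow>
   ('a alg_closure \<Rightarrow> qbar) multiset" where
  "upper_params \<phi> d h w r =
     (\<Sum>i\<in>UNIV. {# lift_char r (root_char \<phi> (d * h i)) [^]\<^bsub>char_group (ext_field r)\<^esub> (w i + d * j).
                   j \<in># mset_set {..<h i} #})"

definition lower_params ::
  "('a::finite_field \<Rightarrow> qbar) \<Rightarrow> nat \<Rightarrow> nat \<Rightarrow> ('a alg_closure \<Rightarrow> qbar) multiset" where
  "lower_params \<phi> d r =
     {# lift_char r (root_char \<phi> d) [^]\<^bsub>char_group (ext_field r)\<^esub> j. j \<in># mset_set {..<d} #}"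

definition F_arg :: "nat \<Rightarrow> ('n::finite \<Rightarrow> nat) \<Rightarrow> 'a::finite_field \<Rightarrow> 'a alg_closure" where
  "F_arg d h lam = to_ac ((\<Prod>i\<in>UNIV. of_nat (h i) ^ h i) * lam ^ d)"

definition F_w ::
  "(nat \<Rightarrow> 'a::finite_field alg_closure \<Rightarrow> qbar) \<Rightarrow> ('a \<Rightarrow> qbar) \<Rightarrow> nat \<Rightarrow> ('n::finite \<Rightarrow> nat) \<Rightarrow>
   ('n \<Rightarrow> nat) \<Rightarrow> nat \<Rightarrow> 'a \<Rightarrow> qbar" where
  "F_w \<psi> \<phi> d h w r lam =
     hypergeom (ext_field r) (\<psi> r) (upper_params \<phi> d h w r) (lower_params \<phi> d r) (F_arg d h lam)"

text \<open>
  The reduced function with \<open>\<phi>\<^sub>d\<^sup>m\<close> (lifted) removed once from both rows. It is meant for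
  \<open>w = m h\<close> and \<open>m < d\<close>, where this character occurs in both multisets.
\<close>

definition F_w_red ::
  "(nat \<Rightarrow> 'a::finite_field alg_closure \<Rightarrow> qbar) \<Rightarrow> ('a \<Rightarrow> qbar) \<Rightarrow> nat \<Rightarrow> ('n::finite \<Rightarrow> nat) \<Rightarrow>
   ('n \<Rightarrow> nat) \<Rightarrow> nat \<Rightarrow> nat \<Rightarrow> 'a \<Rightarrow> qbar" where
  "F_w_red \<psi> \<phi> d h w m r lam =
     (let \<rho> = lift_char r (root_char \<phi> d) [^]\<^bsub>char_group (ext_field r)\<^esub> m in
      hypergeom (ext_field r) (\<psi> r) (upper_params \<phi> d h w r - {#\<rho>#}) (lower_params \<phi> d r - {#\<rho>#})
        (F_arg d h lam))"


section \<open>The group action\<close>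

definition G_tilde :: "nat \<Rightarrow> ('n::finite \<Rightarrow> nat) \<Rightarrow> ('n \<Rightarrow> 'a::finite_field) monoid" where
  "G_tilde d h = \<lparr>carrier = {\<xi>. (\<forall>i. \<xi> i ^ d = 1) \<and> (\<Prod>i\<in>UNIV. \<xi> i ^ h i) = 1},
                  monoid.mult = (\<lambda>\<xi> \<zeta> i. \<xi> i * \<zeta> i), one = (\<lambda>i. 1)\<rparr>"

definition diag :: "nat \<Rightarrow> ('n::finite \<Rightarrow> 'a::finite_field) set" where
  "diag d = {(\<lambda>i. c) | c. c ^ d = 1}"

definition G_quot :: "nat \<Rightarrow> ('n::finite \<Rightarrow> nat) \<Rightarrow> ('n \<Rightarrow> 'a::finite_field) set monoid" where
  "G_quot d h = G_tilde d h Mod diag d"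

text \<open>Elements of \<open>(\<int>/d)\<^sup>n\<close> are given by their representatives in \<open>{0, \<dots>, d-1}\<close>.\<close>

definition W_set :: "nat \<Rightarrow> ('n::finite \<Rightarrow> nat) set" where
  "W_set d = {w. (\<forall>i. w i < d) \<and> d dvd (\<Sum>i\<in>UNIV. w i)}"

text \<open>
  For \<open>w \<in> W_set d\<close> the expression \<open>\<phi> (\<xi>\<^sub>1\<^bsup>w\<^sub>1\<^esup> \<cdots> \<xi>\<^sub>n\<^bsup>w\<^sub>n\<^esup>)\<close> is constant on each coset of
  \<open>diag d\<close>; \<open>chi\<close> takes that common value.
\<close>

definition chi ::
  "('a::finite_field \<Rightarrow> qbar) \<Rightarrow> ('n::finite \<Rightarrow> nat) \<Rightarrow> ('n \<Rightarrow> 'a) set \<Rightarrow> qbar" where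
  "chi \<phi> w g = the_elem ((\<lambda>\<xi>. \<phi> (\<Prod>i\<in>UNIV. \<xi> i ^ w i)) ` g)"

definition W_equiv ::
  "('a::finite_field \<Rightarrow> qbar) \<Rightarrow> nat \<Rightarrow> ('n::finite \<Rightarrow> nat) \<Rightarrow> ('n \<Rightarrow> nat) \<Rightarrow> ('n \<Rightarrow> nat) \<Rightarrow> bool" where
  "W_equiv \<phi> d h w w' \<longleftrightarrow> (\<forall>g\<in>carrier (G_quot d h). chi \<phi> w g = chi \<phi> w' g)"

text \<open>
  A point of projective space over the algebraic closure is a class of nonzero vectors modulo
  scaling. The Frobenius and the elements of \<open>G_quot\<close> (cosets) act on points elementwise; the
  results are again classes.
\<close>

definition proj_space :: "('n::finite \<Rightarrow> 'a::finite_field alg_closure) set set" where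
  "proj_space = (UNIV - {\<lambda>i. 0}) //
     {(x, y). x \<noteq> (\<lambda>i. 0) \<and> (\<exists>c. c \<noteq> 0 \<and> y = (\<lambda>i. c * x i))}"

definition D_hyp ::
  "nat \<Rightarrow> ('n::finite \<Rightarrow> nat) \<Rightarrow> 'a::finite_field \<Rightarrow> ('n \<Rightarrow> 'a alg_closure) set set" where
  "D_hyp d h lam = {P \<in> proj_space. \<forall>x\<in>P.
     (\<Sum>i\<in>UNIV. x i ^ d) = of_nat d * to_ac lam * (\<Prod>i\<in>UNIV. x i ^ h i)}"

definition frob ::
  "('n::finite \<Rightarrow> 'a::finite_field alg_closure) set \<Rightarrow> ('n \<Rightarrow> 'a alg_closure) set" where
  "frob P = (\<lambda>x i. x i ^ CARD('a)) ` P"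

definition G_act ::
  "('n::finite \<Rightarrow> 'a::finite_field) set \<Rightarrow> ('n \<Rightarrow> 'a alg_closure) set \<Rightarrow>
   ('n \<Rightarrow> 'a alg_closure) set" where
  "G_act g P = {(\<lambda>i. to_ac (\<xi> i) * x i) | \<xi> x. \<xi> \<in> g \<and> x \<in> P}"

definition N_D ::
  "nat \<Rightarrow> ('n::finite \<Rightarrow> nat) \<Rightarrow> 'a::finite_field \<Rightarrow> (('n \<Rightarrow> 'a) set \<Rightarrow> qbar) \<Rightarrow> nat \<Rightarrow> qbar" where
  "N_D d h lam \<chi> r =
     1 / of_nat (card (carrier (G_quot d h :: ('n \<Rightarrow> 'a) set monoid))) *
     (\<Sum>g\<in>carrier (G_quot d h).
        \<chi> g * of_nat (card {P \<in> D_hyp d h lam. G_act (inv\<^bsub>G_quot d h\<^esub> g) ((frob ^^ r) P) = P}))"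

text \<open>\<open>exp (\<Sum>r\<ge>1. a r * t^r / r)\<close> as a formal power series.\<close>

definition exp_series :: "(nat \<Rightarrow> qbar) \<Rightarrow> qbar fps" where
  "exp_series a = fps_exp 1 oo Abs_fps (\<lambda>r. if r = 0 then 0 else a r / of_nat r)"

definition L_D ::
  "nat \<Rightarrow> ('n::finite \<Rightarrow> nat) \<Rightarrow> 'a::finite_field \<Rightarrow> (('n \<Rightarrow> 'a) set \<Rightarrow> qbar) \<Rightarrow> qbar fps" where
  "L_D d h lam \<chi> = exp_series (N_D d h lam \<chi>)"

definition C_fac ::
  "('a::finite_field \<Rightarrow> qbar) \<Rightarrow> nat \<Rightarrow> ('n::finite \<Rightarrow> nat) \<Rightarrow> ('n \<Rightarrow> nat) \<Rightarrow> qbar fps" where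
  "C_fac \<phi> d h w =
     (\<Prod>w' \<in> {w' \<in> W_set d. W_equiv \<phi> d h w' w \<and> (\<exists>i. w' i = 0) \<and> (\<exists>i. w' i \<noteq> 0)}.
        (1 - fps_const (jacobi_w \<phi> d w') * fps_X) powi ((-1) ^ CARD('n)))"

end

theory Submission
  imports Defs
begin

text \<open>
Write \<open>Q = q ^ r\<close> and \<open>K\<close> for the field with \<open>Q\<close> elements. A point of projective space that is fixed by
the Frobenius twisted with \<open>\<xi>\<close> has a representative \<open>x\<close> with \<open>x i ^ Q = \<xi> i * x i\<close>, unique up to \<open>K\<^sup>\<times>\<close>
(\<open>card_twisted_points\<close>). Then \<open>u i = x i ^ d\<close> lies in \<open>K\<close>, and the twist \<open>\<xi> i\<close> can be read off from \<open>u i\<close>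
unless \<open>u i = 0\<close>. Hence the count twisted by \<open>\<chi>\<^sup>w\<close> becomes a sum of products of characters of \<open>K\<close> over
tuples \<open>u\<close>, and it splits according to whether some coordinate vanishes.

If a coordinate vanishes, the monomial \<open>X\<^sub>1\<^bsup>h\<^sub>1\<^esup> \<cdots> X\<^sub>n\<^bsup>h\<^sub>n\<^esup>\<close> is zero and only \<open>\<Sum>i. u i = 0\<close> remains.
Detecting the condition on \<open>\<xi>\<close> by characters turns the sum into one sum for each \<open>w'\<close> in the class of
\<open>w\<close>. These are Jacobi sums, which account for \<open>C_fac\<close>, and for \<open>w' = 0\<close> also the powers of \<open>q\<close>
(\<open>degenerate_points\<close>, \<open>degenerate_sum_Jacobi\<close>).

If no coordinate vanishes, the equation can be scaled to \<open>\<Sum>i. u i = 1\<close> and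
\<open>(d \<lambda>)\<^sup>d * (\<Prod>i. u i ^ h i) = 1\<close> (\<open>nondegenerate_points\<close>). Detecting the second equation by the
characters \<open>\<nu>\<close> of \<open>K\<close> gives a sum over \<open>\<nu>\<close> of Jacobi sums, that is, of quotients of the Gauss sums of
\<open>\<eta> i * \<nu> ^ h i\<close> and \<open>\<nu> ^ d\<close>. The multiplication relation of Davenport and Hasse splits each of
them into the Gauss sums of the parameters of \<open>F\<^sup>w\<^sub>r\<close> (\<open>hyper_term_eq\<close>). If \<open>w = m h\<close>, then for exactly one \<open>\<nu>\<close> all
characters in the Jacobi sum are trivial. The correction for this term and the one for the cancelled
parameter \<open>\<phi>\<^sub>d\<^sup>m\<close> offset the part of the term \<open>w' = 0\<close> that is not a sum of powers of \<open>q\<close>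
(\<open>affine_sum_special\<close>, \<open>L_D_special\<close>).
Finally the lifting relation of Davenport and Hasse shows that Jacobi sums over \<open>K\<close> are \<open>r\<close>-th powers
(\<open>J_val_lift\<close>), so that the counts for all \<open>r\<close> assemble to the \<open>L\<close>-function.

Both relations of Davenport and Hasse come from one source. Sum a weight
\<open>\<alpha> (\<Prod> roots) * \<psi> (\<Sum> roots ^ m)\<close> over all monic polynomials of degree \<open>n\<close> over a finite field. The
generating series in \<open>n\<close> has a logarithmic derivative whose coefficients are sums over the points of the
extensions (\<open>weight_series_deriv\<close>). For \<open>m = 1\<close> the series is \<open>1 - g t\<close> with a Gauss sum \<open>g\<close>, which is the lifting
relation. For general \<open>m\<close> the points of the extensions give the series \<open>\<Prod>j. 1 - g\<^sub>j t\<close>, where \<open>g\<^sub>j\<close> is the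
Gauss sum of \<open>\<alpha>\<close> times the \<open>j\<close>-th power of a character of order \<open>m\<close>. On the other hand, by Newton's
identities the constant term of a polynomial of degree \<open>m\<close> enters the \<open>m\<close>-th power sum of its roots
linearly, so the coefficient of \<open>t ^ m\<close> is a Gauss sum of \<open>\<alpha> ^ m\<close> times a factor that does not
depend on \<open>\<alpha>\<close>. Comparison with the trivial \<open>\<alpha>\<close> yields the multiplication relation.
\<close>

hide_const (open) Divisibility.prime Coset.order

section \<open>Finite subfields of an algebraically closed field\<close>

lemma size_proots_alg_closed:
  fixes p :: "'b::alg_closed_field poly"
  assumes "p \<noteq> 0"
  shows "size (proots p) = degree p" "p = smult (lead_coeff p) (\<Prod>x\<in>#proots p. [:-x, 1:])"
proof -
  obtain A where A: "size A = degree p" "p = smult (lead_coeff p) (\<Prod>x\<in>#A. [:-x, 1:])"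
    using alg_closed_imp_factorization[OF assms] by blast
  have "proots (\<Prod>x\<in>#A. [:-x, 1:]) = A"
  proof (induction A)
    case (add a A)
    have "(\<Prod>x\<in>#A. [:-x, 1:]) \<noteq> (0 :: 'b poly)" by (auto simp: prod_mset_zero_iff)
    thus ?case using add by (subst image_mset_add_mset, subst prod_mset.add_mset, subst proots_mult) auto
  qed simp
  hence "proots p = A"
    using A(2) assms by (metis leading_coeff_0_iff proots_smult)
  thus "size (proots p) = degree p" "p = smult (lead_coeff p) (\<Prod>x\<in>#proots p. [:-x, 1:])"
    using A by auto
qed

text \<open>
The polynomial \<open>X ^ n - c\<close> is separable, since its derivative \<open>n * X ^ (n - 1)\<close> vanishes only at \<open>0\<close>.
\<close>
lemma card_roots_of_power:
  fixes c :: "'b::alg_closed_field"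
  assumes n: "of_nat n \<noteq> (0::'b)" and c: "c \<noteq> 0"
  shows "card {x. x ^ n = c} = n" "finite {x. x ^ n = c}"
proof -
  have npos: "n > 0" using n by (cases n) auto
  define p where "p = monom 1 n - [:c:]"
  have deg: "degree p = n"
    using npos by (simp add: p_def degree_monom_eq degree_add_eq_left diff_conv_add_uminus del: add_uminus_conv_diff)
  have p0: "p \<noteq> 0" using deg npos by auto
  have pp: "poly p x = x ^ n - c" for x
    by (simp add: p_def poly_monom)
  have ord: "order x p = 1" if "poly p x = 0" for x
  proof (rule ccontr)
    assume "order x p \<noteq> 1"
    moreover have "order x p \<noteq> 0" using that p0 order_root by blast
    ultimately have "2 \<le> order x p" by linarith
    hence "[:-x,1:]^2 dvd p" using order_divides by blast
    then obtain q where q: "p = [:-x,1:]^2 * q" by (elim dvdE)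
    have "pderiv p = [:-x,1:] * pderiv ([:-x,1:] * q) + [:-x,1:] * q * pderiv [:-x,1:]"
      by (simp only: q power2_eq_square mult.assoc pderiv_mult)
    hence "poly (pderiv p) x = 0"
      by (simp del: mult_pCons_left)
    hence "of_nat n * x ^ (n - 1) = 0"
      by (simp add: p_def pderiv_diff pderiv_monom poly_monom pderiv_pCons)
    hence "x = 0" using n by simp
    thus False using that c npos by (simp add: pp power_0_left)
  qed
  have "size (proots p) = (\<Sum>x\<in>set_mset (proots p). 1)"
    unfolding size_multiset_overloaded_eq
    by (intro sum.cong) (use p0 ord in auto)
  hence "card (set_mset (proots p)) = n"
    using size_proots_alg_closed(1)[OF p0] deg by simp
  moreover have "set_mset (proots p) = {x. x ^ n = c}"
    using p0 by (auto simp: pp)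
  ultimately show "card {x. x ^ n = c} = n" "finite {x. x ^ n = c}"
    by (metis, metis finite_set_mset)
qed

text \<open>
  A finite field is viewed inside a fixed algebraically closed field as the set of fixed points of
  a power of the Frobenius map. In this form a field, its extensions and their norms and traces
  all live in one type.
\<close>

locale finite_subfield =
  fixes Q :: nat and K :: "'b::alg_closed_field set"
  assumes K_eq: "K = {x. x ^ Q = x}"
    and prime_CHAR: "prime CHAR('b)"
    and Q_power: "\<exists>e>0. Q = CHAR('b) ^ e"
begin

lemma Q_gt_1: "Q > 1"
proof -
  obtain e where "e > 0" "Q = CHAR('b) ^ e" using Q_power by blast
  thus ?thesis using prime_gt_1_nat[OF prime_CHAR] by (metis one_less_power)
qed

lemma of_nat_Q: "of_nat Q = (0::'b)"
proof -
  obtain e where "e > 0" "Q = CHAR('b) ^ e" using Q_power by blast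
  thus ?thesis by (simp add: power_0_left)
qed

lemma frob_add: "(x + y) ^ Q = x ^ Q + (y::'b) ^ Q"
  using Q_power freshmans_dream'[OF prime_CHAR] by blast

lemma frob_sum: "(sum f A) ^ Q = (\<Sum>i\<in>A. (f i :: 'b) ^ Q)"
  using Q_power freshmans_dream_sum'[OF prime_CHAR] by blast

lemma frob_minus: "(- x) ^ Q = - ((x::'b) ^ Q)"
  using frob_add[of x "- x"] Q_gt_1 by (simp add: eq_neg_iff_add_eq_0 add.commute power_0_left)

lemma frob_diff: "(x - y) ^ Q = x ^ Q - (y::'b) ^ Q"
  using frob_add[of x "- y"] by (simp add: frob_minus)

lemma frob_inj: "(x::'b) ^ Q = y ^ Q \<longleftrightarrow> x = y"
  using frob_diff[of x y] Q_gt_1 by auto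

lemma K_iff: "x \<in> K \<longleftrightarrow> x ^ Q = x"
  by (simp add: K_eq)

lemma K_0 [simp, intro]: "0 \<in> K" and K_1 [simp, intro]: "1 \<in> K"
  using Q_gt_1 by (auto simp: K_iff power_0_left)

lemma K_add [intro]: "x \<in> K \<Longrightarrow> y \<in> K \<Longrightarrow> x + y \<in> K"
  by (simp add: K_iff frob_add)
lemma K_diff [intro]: "x \<in> K \<Longrightarrow> y \<in> K \<Longrightarrow> x - y \<in> K"
  by (simp add: K_iff frob_diff)
lemma K_minus [intro]: "x \<in> K \<Longrightarrow> - x \<in> K"
  by (simp add: K_iff frob_minus)
lemma K_minus_iff [simp]: "- x \<in> K \<longleftrightarrow> x \<in> K"
  by (simp add: K_iff frob_minus)
lemma K_mult [intro]: "x \<in> K \<Longrightarrow> y \<in> K \<Longrightarrow> x * y \<in> K"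
  by (simp add: K_iff power_mult_distrib)
lemma K_inverse [intro]: "x \<in> K \<Longrightarrow> inverse x \<in> K"
  by (simp add: K_iff power_inverse)
lemma K_divide [intro]: "x \<in> K \<Longrightarrow> y \<in> K \<Longrightarrow> x / y \<in> K"
  by (simp add: K_iff power_divide)
lemma K_power [intro]: "x \<in> K \<Longrightarrow> x ^ n \<in> K"
  by (metis K_iff power_mult mult.commute)
lemma K_sum [intro]: "(\<And>i. i \<in> A \<Longrightarrow> f i \<in> K) \<Longrightarrow> sum f A \<in> K"
  by (simp add: K_iff frob_sum)
lemma K_prod [intro]: "(\<And>i. i \<in> A \<Longrightarrow> f i \<in> K) \<Longrightarrow> prod f A \<in> K"
  by (simp add: K_iff prod_power_distrib)
lemma K_of_nat [simp, intro]: "of_nat n \<in> K"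
  by (induction n) auto

lemma K_mult_iff: "x \<in> K \<Longrightarrow> x \<noteq> 0 \<Longrightarrow> x * y \<in> K \<longleftrightarrow> y \<in> K"
  using K_mult[of "inverse x" "x * y"] K_inverse[of x] by (auto simp: mult.assoc[symmetric])

lemma K_units_eq: "K - {0} = {x. x ^ (Q - 1) = 1}"
proof -
  have *: "x ^ Q = x * x ^ (Q - 1)" for x :: 'b
    using Q_gt_1 by (cases Q) auto
  show ?thesis using Q_gt_1 by (auto simp: K_iff * power_0_left)
qed

lemma of_nat_Q_minus_1: "of_nat (Q - 1) = (-1::'b)"
  using Q_gt_1 of_nat_Q by (simp add: of_nat_diff)

text \<open>
The number \<open>Q - 1\<close> is \<open>-1\<close> in the field, so its divisors are invertible.
\<close>
lemma of_nat_dvd_nonzero: "m dvd Q - 1 \<Longrightarrow> of_nat m \<noteq> (0::'b)"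
  by (metis dvd_def mult_zero_left of_nat_Q_minus_1 of_nat_mult one_neq_zero neg_equal_zero
      neg_eq_iff_add_eq_0 add_cancel_right_right)

lemma card_K_units: "card (K - {0}) = Q - 1" and finite_K_units: "finite (K - {0})"
  using card_roots_of_power[of "Q - 1" "1::'b"] of_nat_Q_minus_1 unfolding K_units_eq by auto

lemma finite_K [simp, intro]: "finite K"
  using finite_K_units by simp

lemma card_K: "card K = Q"
proof -
  have "card K = Suc (card (K - {0}))" by (subst card_Suc_Diff1) auto
  thus ?thesis using card_K_units Q_gt_1 by simp
qed

lemma frob_iterate: "(x::'b) ^ (Q ^ (i + j)) = (x ^ (Q ^ i)) ^ (Q ^ j)"
  by (simp add: power_add power_mult)

lemma extension: "s > 0 \<Longrightarrow> finite_subfield (Q ^ s) {x::'b. x ^ (Q ^ s) = x}"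
proof (unfold_locales, goal_cases)
  case 3
  obtain e where "e > 0" "Q = CHAR('b) ^ e" using Q_power by blast
  thus ?case using 3 by (intro exI[of _ "e * s"]) (simp add: power_mult)
qed (use prime_CHAR in auto)

lemma field_K: "field \<lparr>carrier = K, monoid.mult = (*), one = 1, ring.zero = 0, add = (+)\<rparr>"
  (is "field ?R")
proof -
  interpret cring ?R
  proof (rule cringI)
    show "abelian_group ?R"
    proof (rule abelian_groupI)
      show "\<exists>y\<in>carrier ?R. y \<oplus>\<^bsub>?R\<^esub> x = \<zero>\<^bsub>?R\<^esub>" if "x \<in> carrier ?R" for x
        using that by (intro bexI[of _ "-x"]) auto
    qed (auto simp: add_ac)
    show "comm_monoid ?R" by (rule comm_monoidI) (auto simp: mult_ac)
  qed (auto simp: algebra_simps)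
  show ?thesis
  proof (rule cring_fieldI2)
    show "\<exists>b\<in>carrier ?R. a \<otimes>\<^bsub>?R\<^esub> b = \<one>\<^bsub>?R\<^esub>" if "a \<in> carrier ?R" "a \<noteq> \<zero>\<^bsub>?R\<^esub>" for a
      using that by (intro bexI[of _ "inverse a"]) auto
  qed auto
qed

lemma ex_generator:
  obtains g where "g \<in> K - {0}" "K - {0} = (\<lambda>i. g ^ i) ` {..<Q - 1}" "inj_on (\<lambda>i. g ^ i) {..<Q - 1}"
proof -
  let ?R = "\<lparr>carrier = K, monoid.mult = (*), one = 1, ring.zero = 0, add = (+)\<rparr>"
  interpret R: field ?R by (rule field_K)
  have pow: "x [^]\<^bsub>?R\<^esub> i = x ^ i" for x i
    by (induction i) (auto simp: nat_pow_def)
  obtain g where g: "g \<in> K - {0}" "K - {0} = {g ^ i | i::nat. i \<in> UNIV}"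
    using R.finite_field_mult_group_has_gen by (auto simp: mult_of_simps pow)
  have gQ: "g ^ (Q - 1) = 1" using g K_units_eq by auto
  have "g ^ i = g ^ (i mod (Q - 1))" for i
  proof -
    have "g ^ i = g ^ ((Q - 1) * (i div (Q - 1)) + i mod (Q - 1))" by simp
    thus ?thesis unfolding power_add power_mult gQ by simp
  qed
  moreover have "i mod (Q - 1) < Q - 1" for i using Q_gt_1 by simp
  ultimately have *: "K - {0} = (\<lambda>i. g ^ i) ` {..<Q - 1}"
    unfolding g(2) by (auto simp: image_iff)
  have "inj_on (\<lambda>i. g ^ i) {..<Q - 1}"
    by (rule eq_card_imp_inj_on) (use card_K_units * in auto)
  with g * that show thesis by blast
qed

end

section \<open>Multiplicative characters\<close>

lemma char_group_simps [simp]: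
  "carrier (char_group k) = mult_chars k"
  "\<alpha> \<otimes>\<^bsub>char_group k\<^esub> \<beta> = (\<lambda>x. \<alpha> x * \<beta> x)"
  "\<one>\<^bsub>char_group k\<^esub> = trivial_char k"
  by (auto simp: char_group_def)

lemma mult_chars_mult: "\<alpha> \<in> mult_chars k \<Longrightarrow> \<beta> \<in> mult_chars k \<Longrightarrow> (\<lambda>x. \<alpha> x * \<beta> x) \<in> mult_chars k"
  by (auto simp: mult_chars_def algebra_simps)

lemma mult_chars_inverse: "\<alpha> \<in> mult_chars k \<Longrightarrow> (\<lambda>x. inverse (\<alpha> x)) \<in> mult_chars k"
  by (auto simp: mult_chars_def)

lemma mult_chars_power:
  "\<alpha> \<in> mult_chars k \<Longrightarrow> (\<lambda>x. if x \<in> k - {0} then \<alpha> x ^ n else 0) \<in> mult_chars k"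
  if "\<And>x y. x \<in> k - {0} \<Longrightarrow> y \<in> k - {0} \<Longrightarrow> x * y \<in> k"
  using that by (auto simp: mult_chars_def power_mult_distrib)

lemma trivial_char_in: "trivial_char k \<in> mult_chars k"
  if "\<And>x y. x \<in> k - {0} \<Longrightarrow> y \<in> k - {0} \<Longrightarrow> x * y \<in> k"
  using that by (auto simp: mult_chars_def trivial_char_def)

lemma comm_group_char_group: "comm_group (char_group k)"
  if closed: "\<And>x y. x \<in> k - {0} \<Longrightarrow> y \<in> k - {0} \<Longrightarrow> x * y \<in> k"
proof (rule comm_groupI)
  fix \<alpha> assume a: "\<alpha> \<in> carrier (char_group k)"
  show "\<exists>\<beta>\<in>carrier (char_group k). \<beta> \<otimes>\<^bsub>char_group k\<^esub> \<alpha> = \<one>\<^bsub>char_group k\<^esub>"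
    using a by (intro bexI[of _ "\<lambda>x. inverse (\<alpha> x)"])
      (auto simp: mult_chars_inverse fun_eq_iff trivial_char_def mult_chars_def)
  show "\<one>\<^bsub>char_group k\<^esub> \<otimes>\<^bsub>char_group k\<^esub> \<alpha> = \<alpha>"
    using a by (auto simp: fun_eq_iff trivial_char_def mult_chars_def)
next
  show "\<one>\<^bsub>char_group k\<^esub> \<in> carrier (char_group k)"
    using trivial_char_in[OF closed] by simp
qed (auto simp: mult_chars_mult mult_ac)

lemma char_group_nat_pow:
  "\<eta> \<in> mult_chars k \<Longrightarrow> \<eta> [^]\<^bsub>char_group k\<^esub> (n::nat) = (\<lambda>x. if x \<in> k - {0} then \<eta> x ^ n else 0)"
  by (induction n) (auto simp: nat_pow_def trivial_char_def fun_eq_iff)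

context finite_subfield
begin

lemma K_units_mult: "x \<in> K - {0} \<Longrightarrow> y \<in> K - {0} \<Longrightarrow> x * y \<in> K"
  by auto

lemma trivial_char_K: "trivial_char K \<in> mult_chars K"
  by (rule trivial_char_in) (rule K_units_mult)

lemma char_zero_iff: "\<eta> \<in> mult_chars K \<Longrightarrow> \<eta> x = 0 \<longleftrightarrow> x \<notin> K - {0}"
  by (auto simp: mult_chars_def)

lemma char_0 [simp]: "\<eta> \<in> mult_chars K \<Longrightarrow> \<eta> 0 = 0"
  by (auto simp: mult_chars_def)

lemma char_mult: "\<eta> \<in> mult_chars K \<Longrightarrow> x \<in> K \<Longrightarrow> y \<in> K \<Longrightarrow> \<eta> (x * y) = \<eta> x * \<eta> y"
  by (cases "x = 0"; cases "y = 0") (auto simp: mult_chars_def)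

lemma char_1 [simp]: "\<eta> \<in> mult_chars K \<Longrightarrow> \<eta> 1 = 1"
  using char_mult[of \<eta> 1 1] char_zero_iff[of \<eta> 1] by auto

lemma char_power: "\<eta> \<in> mult_chars K \<Longrightarrow> x \<in> K \<Longrightarrow> \<eta> (x ^ n) = \<eta> x ^ n"
  by (induction n) (auto simp: char_mult K_power)

lemma char_inverse: "\<eta> \<in> mult_chars K \<Longrightarrow> x \<in> K \<Longrightarrow> \<eta> (inverse x) = inverse (\<eta> x)"
proof (cases "x = 0")
  case False
  assume *: "\<eta> \<in> mult_chars K" "x \<in> K"
  hence "\<eta> (inverse x) * \<eta> x = 1"
    using char_mult[of \<eta> "inverse x" x] False by (simp add: K_inverse)
  thus ?thesis by (metis inverse_unique mult.commute)
qed simp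

lemma char_divide: "\<eta> \<in> mult_chars K \<Longrightarrow> x \<in> K \<Longrightarrow> y \<in> K \<Longrightarrow> \<eta> (x / y) = \<eta> x / \<eta> y"
  by (simp add: divide_inverse char_mult char_inverse K_inverse)

lemma char_prod:
  "\<eta> \<in> mult_chars K \<Longrightarrow> (\<And>i. i \<in> A \<Longrightarrow> f i \<in> K) \<Longrightarrow> \<eta> (prod f A) = (\<Prod>i\<in>A. \<eta> (f i))"
proof (induction A rule: infinite_finite_induct)
  case (insert x F)
  thus ?case by (simp add: char_mult K_prod)
qed auto

lemma char_root_of_unity: "\<eta> \<in> mult_chars K \<Longrightarrow> x \<in> K - {0} \<Longrightarrow> \<eta> x ^ (Q - 1) = 1"
  using char_power[of \<eta> x "Q - 1"] K_units_eq by auto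

lemma char_eqI:
  assumes "\<alpha> \<in> mult_chars K" "\<beta> \<in> mult_chars K" "\<And>x. x \<in> K - {0} \<Longrightarrow> \<alpha> x = \<beta> x"
  shows "\<alpha> = \<beta>"
  using assms by (intro ext) (metis char_zero_iff)

lemma char_trivialI: "\<alpha> \<in> mult_chars K \<Longrightarrow> (\<And>x. x \<in> K - {0} \<Longrightarrow> \<alpha> x = 1) \<Longrightarrow> \<alpha> = trivial_char K"
  by (rule char_eqI) (auto simp: trivial_char_K, auto simp: trivial_char_def)

lemma char_power_in:
  "\<alpha> \<in> mult_chars K \<Longrightarrow> (\<lambda>x. if x \<in> K - {0} then \<alpha> x ^ n else 0) \<in> mult_chars K"
  using mult_chars_power[OF K_units_mult] by blast

lemma char_power_in': "n > 0 \<Longrightarrow> \<alpha> \<in> mult_chars K \<Longrightarrow> (\<lambda>x. \<alpha> x ^ n) \<in> mult_chars K"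
proof -
  assume *: "n > 0" "\<alpha> \<in> mult_chars K"
  hence "(\<lambda>x. \<alpha> x ^ n) = (\<lambda>x. if x \<in> K - {0} then \<alpha> x ^ n else 0)"
    by (intro ext) (auto simp: char_zero_iff)
  thus ?thesis using char_power_in[OF *(2)] by simp
qed

lemma units_shift: "a \<in> K - {0} \<Longrightarrow> (\<Sum>x\<in>K - {0}. f (a * x)) = (\<Sum>x\<in>K - {0}. f x)"
  by (rule sum.reindex_bij_witness[of _ "\<lambda>x. inverse a * x" "\<lambda>x. a * x"])
     (auto simp: mult.assoc[symmetric])

lemma sum_mult_char:
  assumes "\<eta> \<in> mult_chars K"
  shows "(\<Sum>x\<in>K - {0}. \<eta> x) = (if \<eta> = trivial_char K then of_nat (Q - 1) else 0)"
proof (cases "\<eta> = trivial_char K")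
  case True
  hence "(\<Sum>x\<in>K - {0}. \<eta> x) = (\<Sum>x\<in>K - {0}. 1)"
    by (intro sum.cong) (auto simp: trivial_char_def)
  thus ?thesis using True card_K_units by simp
next
  case False
  then obtain a where a: "a \<in> K - {0}" "\<eta> a \<noteq> 1" using char_trivialI[OF assms] by blast
  have "(\<Sum>x\<in>K - {0}. \<eta> x) = (\<Sum>x\<in>K - {0}. \<eta> (a * x))"
    by (rule units_shift[OF a(1), symmetric])
  also have "\<dots> = \<eta> a * (\<Sum>x\<in>K - {0}. \<eta> x)"
    unfolding sum_distrib_left using a assms by (intro sum.cong) (auto simp: char_mult)
  finally show ?thesis using a False by simp
qed

text \<open>
The group of units is cyclic, so a character amounts to the choice of a root of unity as its value at a
generator.
\<close>
lemma bij_betw_chars_roots: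
  obtains g where "g \<in> K - {0}" "bij_betw (\<lambda>\<nu>. \<nu> g) (mult_chars K) {z. z ^ (Q - 1) = 1}"
    "K - {0} = (\<lambda>i. g ^ i) ` {..<Q - 1}" "inj_on (\<lambda>i. g ^ i) {..<Q - 1}"
proof -
  obtain g where g: "g \<in> K - {0}" "K - {0} = (\<lambda>i. g ^ i) ` {..<Q - 1}" "inj_on (\<lambda>i. g ^ i) {..<Q - 1}"
    using ex_generator by blast
  have gQ: "g ^ (Q - 1) = 1" using g(1) K_units_eq by auto
  have "bij_betw (\<lambda>\<nu>. \<nu> g) (mult_chars K) {z. z ^ (Q - 1) = 1}"
    unfolding bij_betw_def
  proof
    show "inj_on (\<lambda>\<nu>. \<nu> g) (mult_chars K)"
    proof (rule inj_onI, rule char_eqI)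
      fix \<alpha> \<beta> x assume *: "\<alpha> \<in> mult_chars K" "\<beta> \<in> mult_chars K" "\<alpha> g = \<beta> g" "x \<in> K - {0}"
      then obtain i where "x = g ^ i" using g(2) by auto
      thus "\<alpha> x = \<beta> x" using * g(1) by (simp add: char_power)
    qed
    show "(\<lambda>\<nu>. \<nu> g) ` mult_chars K = {z. z ^ (Q - 1) = 1}"
    proof (intro equalityI subsetI)
      fix z :: qbar assume z: "z \<in> {z. z ^ (Q - 1) = 1}"
      have Q: "Q - 1 > 0" using Q_gt_1 by simp
      have z0: "z \<noteq> 0" using z Q by (auto simp: power_0_left)
      define dl where "dl x = the_inv_into {..<Q - 1} (\<lambda>i. g ^ i) x" for x
      have dl: "g ^ dl x = x" "dl x < Q - 1" if "x \<in> K - {0}" for x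
        using the_inv_into_into[OF g(3), of x "{..<Q-1}"] f_the_inv_into_f[OF g(3), of x] that g(2)
        unfolding dl_def by auto
      have zmod: "z ^ i = z ^ (i mod (Q - 1))" for i
        by (metis (mono_tags) z mem_Collect_eq mult_div_mod_eq mult_1 power_add power_mult power_one)
      have gmod: "g ^ i = g ^ (i mod (Q - 1))" for i
        by (metis gQ mult_div_mod_eq mult_1 power_add power_mult power_one)
      have key: "z ^ i = z ^ j" if "g ^ i = g ^ j" for i j
      proof -
        have "i mod (Q - 1) = j mod (Q - 1)"
          by (rule inj_onD[OF g(3)]) (use that gmod Q in auto)
        thus ?thesis using zmod by metis
      qed
      define \<nu> where "\<nu> x = (if x \<in> K - {0} then z ^ dl x else 0)" for x
      have "\<nu> \<in> mult_chars K"
        unfolding mult_chars_def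
      proof (intro CollectI conjI ballI allI impI, goal_cases)
        case (1 x y)
        have "z ^ dl (x * y) = z ^ (dl x + dl y)"
          by (rule key) (use 1 dl[of x] dl[of y] dl[of "x*y"] in \<open>auto simp: power_add\<close>)
        thus ?case using 1 by (auto simp: \<nu>_def power_add)
      qed (auto simp: \<nu>_def z0)
      moreover have "\<nu> g = z"
        using key[of "dl g" 1] dl[OF g(1)] g(1) by (simp add: \<nu>_def)
      ultimately show "z \<in> (\<lambda>\<nu>. \<nu> g) ` mult_chars K" by blast
    qed (use g(1) char_root_of_unity in auto)
  qed
  with g that show thesis by blast
qed

lemma finite_mult_chars [simp, intro]: "finite (mult_chars K)"
  and card_mult_chars: "card (mult_chars K) = Q - 1"
proof -
  obtain g where g: "bij_betw (\<lambda>\<nu>. \<nu> g) (mult_chars K) {z. z ^ (Q - 1) = 1}"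
    using bij_betw_chars_roots by blast
  have "card {z::qbar. z ^ (Q - 1) = 1} = Q - 1" "finite {z::qbar. z ^ (Q - 1) = 1}"
    using card_roots_of_power[of "Q - 1" "1::qbar"] Q_gt_1 by auto
  thus "finite (mult_chars K)" "card (mult_chars K) = Q - 1"
    using bij_betw_finite[OF g] bij_betw_same_card[OF g] by auto
qed

text \<open>
If all characters were \<open>1\<close> at \<open>g ^ i\<close> with \<open>0 < i < Q - 1\<close>, then all \<open>Q - 1\<close> roots of unity
would be roots of \<open>X ^ i - 1\<close>.
\<close>
lemma ex_separating_char:
  assumes "z \<in> K - {0}" "z \<noteq> 1"
  shows "\<exists>\<nu>\<in>mult_chars K. \<nu> z \<noteq> 1"
proof (rule ccontr)
  assume no: "\<not> ?thesis"
  obtain g where g: "g \<in> K - {0}" "bij_betw (\<lambda>\<nu>. \<nu> g) (mult_chars K) {z. z ^ (Q - 1) = 1}"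
    "K - {0} = (\<lambda>i. g ^ i) ` {..<Q - 1}" "inj_on (\<lambda>i. g ^ i) {..<Q - 1}"
    using bij_betw_chars_roots by blast
  obtain i where i: "i < Q - 1" "z = g ^ i" using assms g(3) by auto
  have i0: "i > 0" using i assms by (cases i) auto
  have "{z. z ^ (Q - 1) = 1} \<subseteq> {z::qbar. z ^ i = 1}"
  proof
    fix y :: qbar assume y: "y \<in> {z. z ^ (Q - 1) = 1}"
    hence "y \<in> (\<lambda>\<nu>. \<nu> g) ` mult_chars K" using g(2) by (simp add: bij_betw_def)
    then obtain \<nu> where \<nu>: "\<nu> \<in> mult_chars K" "\<nu> g = y" by blast
    hence "\<nu> z = 1" using no by blast
    thus "y \<in> {z. z ^ i = 1}" using \<nu> i g(1) by (simp add: char_power)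
  qed
  hence "card {z::qbar. z ^ (Q - 1) = 1} \<le> card {z::qbar. z ^ i = 1}"
    using card_roots_of_power[of i "1::qbar"] i0 by (intro card_mono) auto
  moreover have "card {z::qbar. z ^ (Q - 1) = 1} = Q - 1"
    by (rule card_roots_of_power(1)) (use Q_gt_1 in auto)
  moreover have "card {z::qbar. z ^ i = 1} = i"
    by (rule card_roots_of_power(1)) (use i0 in auto)
  ultimately show False using i by linarith
qed

lemma chars_shift: "\<alpha> \<in> mult_chars K \<Longrightarrow> (\<Sum>\<nu>\<in>mult_chars K. f (\<lambda>x. \<alpha> x * \<nu> x)) = (\<Sum>\<nu>\<in>mult_chars K. f \<nu>)"
proof (rule sum.reindex_bij_witness[of _ "\<lambda>\<nu> x. inverse (\<alpha> x) * \<nu> x" "\<lambda>\<nu> x. \<alpha> x * \<nu> x"], goal_cases)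
  case (1 \<nu>)
  thus ?case by (intro char_eqI) (auto intro!: mult_chars_mult mult_chars_inverse simp: char_zero_iff)
next
  case (3 \<nu>)
  thus ?case by (intro char_eqI) (auto intro!: mult_chars_mult mult_chars_inverse simp: char_zero_iff)
qed (auto intro!: mult_chars_mult mult_chars_inverse)

lemma sum_over_chars:
  assumes "z \<in> K - {0}"
  shows "(\<Sum>\<nu>\<in>mult_chars K. \<nu> z) = (if z = 1 then of_nat (Q - 1) else 0)"
proof (cases "z = 1")
  case True
  hence "(\<Sum>\<nu>\<in>mult_chars K. \<nu> z) = (\<Sum>\<nu>\<in>mult_chars K. 1)"
    by (intro sum.cong) auto
  thus ?thesis using True card_mult_chars by simp
next
  case False
  then obtain \<alpha> where a: "\<alpha> \<in> mult_chars K" "\<alpha> z \<noteq> 1" using ex_separating_char assms by blast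
  have "(\<Sum>\<nu>\<in>mult_chars K. \<nu> z) = (\<Sum>\<nu>\<in>mult_chars K. \<alpha> z * \<nu> z)"
    using chars_shift[OF a(1), of "\<lambda>\<nu>. \<nu> z"] by simp
  also have "\<dots> = \<alpha> z * (\<Sum>\<nu>\<in>mult_chars K. \<nu> z)" by (simp add: sum_distrib_left)
  finally show ?thesis using a False by simp
qed

lemma card_char_torsion:
  assumes "d > 0"
  shows "card {\<nu> \<in> mult_chars K. (\<lambda>x. \<nu> x ^ d) = trivial_char K} \<le> d"
proof -
  obtain g where g: "g \<in> K - {0}" "bij_betw (\<lambda>\<nu>. \<nu> g) (mult_chars K) {z. z ^ (Q - 1) = 1}"
    using bij_betw_chars_roots by metis
  have "card {\<nu> \<in> mult_chars K. (\<lambda>x. \<nu> x ^ d) = trivial_char K} \<le> card {z::qbar. z ^ d = 1}"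
  proof (rule card_inj_on_le[of "\<lambda>\<nu>. \<nu> g"])
    show "inj_on (\<lambda>\<nu>. \<nu> g) {\<nu> \<in> mult_chars K. (\<lambda>x. \<nu> x ^ d) = trivial_char K}"
      using g(2) by (auto simp: bij_betw_def inj_on_def)
    show "(\<lambda>\<nu>. \<nu> g) ` {\<nu> \<in> mult_chars K. (\<lambda>x. \<nu> x ^ d) = trivial_char K} \<subseteq> {z. z ^ d = 1}"
      using g(1) by (auto simp: trivial_char_def dest: fun_cong[of _ _ g])
  qed (use card_roots_of_power[of d "1::qbar"] assms in auto)
  thus ?thesis using card_roots_of_power[of d "1::qbar"] assms by simp
qed

end

section \<open>Gauss sums\<close>

locale finite_subfield_add_char = finite_subfield Q K
  for Q :: nat and K :: "'b::alg_closed_field set" +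
  fixes \<psi> :: "'b \<Rightarrow> qbar"
  assumes \<psi>: "\<psi> \<in> nontrivial_add_chars K"
begin

lemma psi_add: "x \<in> K \<Longrightarrow> y \<in> K \<Longrightarrow> \<psi> (x + y) = \<psi> x * \<psi> y"
  and psi_nonzero: "x \<in> K \<Longrightarrow> \<psi> x \<noteq> 0"
  using \<psi> by (auto simp: nontrivial_add_chars_def)

lemma psi_0 [simp]: "\<psi> 0 = 1"
  using psi_add[of 0 0] psi_nonzero[of 0] by auto

lemma psi_minus: "x \<in> K \<Longrightarrow> \<psi> (- x) = inverse (\<psi> x)"
  using psi_add[of x "- x"] by (simp add: inverse_unique)

lemma psi_diff: "x \<in> K \<Longrightarrow> y \<in> K \<Longrightarrow> \<psi> (x - y) = \<psi> x / \<psi> y"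
  using psi_add[of x "- y"] by (simp add: psi_minus divide_inverse)

lemma psi_sum: "(\<And>i. i \<in> A \<Longrightarrow> f i \<in> K) \<Longrightarrow> \<psi> (sum f A) = (\<Prod>i\<in>A. \<psi> (f i))"
proof (induction A rule: infinite_finite_induct)
  case (insert x F)
  thus ?case by (simp add: psi_add K_sum)
qed auto

lemma sum_psi: "(\<Sum>x\<in>K. \<psi> x) = 0"
proof -
  obtain a where a: "a \<in> K" "\<psi> a \<noteq> 1" using \<psi> by (auto simp: nontrivial_add_chars_def)
  have "(\<Sum>x\<in>K. \<psi> x) = (\<Sum>x\<in>K. \<psi> (a + x))"
    by (rule sum.reindex_bij_witness[of _ "\<lambda>x. a + x" "\<lambda>x. x - a"]) (use a in auto)
  also have "\<dots> = \<psi> a * (\<Sum>x\<in>K. \<psi> x)"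
    unfolding sum_distrib_left using a by (intro sum.cong) (auto simp: psi_add)
  finally show ?thesis using a by simp
qed

lemma sum_psi_mult:
  assumes "a \<in> K"
  shows "(\<Sum>x\<in>K. \<psi> (a * x)) = (if a = 0 then of_nat Q else 0)"
proof (cases "a = 0")
  case True
  thus ?thesis using card_K by simp
next
  case False
  have "(\<Sum>x\<in>K. \<psi> (a * x)) = (\<Sum>x\<in>K. \<psi> x)"
    by (rule sum.reindex_bij_witness[of _ "\<lambda>x. inverse a * x" "\<lambda>x. a * x"])
       (use assms False in \<open>auto simp: mult.assoc[symmetric]\<close>)
  thus ?thesis using False sum_psi by simp
qed

lemma sum_psi_units: "a \<in> K - {0} \<Longrightarrow> (\<Sum>x\<in>K - {0}. \<psi> (a * x)) = -1"
  using sum_psi_mult[of a] by (simp add: sum_diff1)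

lemma gauss_trivial: "gauss_sum K \<psi> (trivial_char K) = 1"
proof -
  have "(\<Sum>x\<in>K - {0}. trivial_char K x * \<psi> x) = (\<Sum>x\<in>K - {0}. \<psi> (1 * x))"
    by (intro sum.cong) (auto simp: trivial_char_def)
  thus ?thesis using sum_psi_units[of 1] by (simp add: gauss_sum_def)
qed

lemma gauss_twist:
  assumes "\<eta> \<in> mult_chars K" "a \<in> K - {0}"
  shows "(\<Sum>x\<in>K - {0}. \<eta> x * \<psi> (a * x)) = - (gauss_sum K \<psi> \<eta> / \<eta> a)"
proof -
  have "(\<Sum>x\<in>K - {0}. \<eta> (a * x) * \<psi> (a * x)) = (\<Sum>x\<in>K - {0}. \<eta> x * \<psi> x)"
    by (rule units_shift[OF assms(2), of "\<lambda>x. \<eta> x * \<psi> x"])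
  moreover have "(\<Sum>x\<in>K - {0}. \<eta> (a * x) * \<psi> (a * x)) = \<eta> a * (\<Sum>x\<in>K - {0}. \<eta> x * \<psi> (a * x))"
    unfolding sum_distrib_left using assms by (intro sum.cong) (auto simp: char_mult)
  moreover have "\<eta> a \<noteq> 0" using assms by (simp add: char_zero_iff)
  ultimately show ?thesis by (simp add: gauss_sum_def field_simps)
qed

lemma gauss_mult_inverse:
  assumes "\<eta> \<in> mult_chars K" "\<eta> \<noteq> trivial_char K"
  shows "gauss_sum K \<psi> \<eta> * gauss_sum K \<psi> (\<lambda>x. inverse (\<eta> x)) = \<eta> (-1) * of_nat Q"
proof -
  have "gauss_sum K \<psi> \<eta> * gauss_sum K \<psi> (\<lambda>x. inverse (\<eta> x)) =
        (\<Sum>y\<in>K - {0}. (\<Sum>x\<in>K - {0}. \<eta> x * \<psi> x) * (inverse (\<eta> y) * \<psi> y))"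
    by (simp add: gauss_sum_def sum_distrib_left sum_negf)
  \<comment> \<open>substitute \<open>x = y t\<close>; then the inner sum over \<open>y\<close> is \<open>-1\<close> except at \<open>t = -1\<close>\<close>
  also have "\<dots> = (\<Sum>y\<in>K - {0}. \<Sum>t\<in>K - {0}. \<eta> t * \<psi> ((t + 1) * y))"
  proof (rule sum.cong[OF refl])
    fix y assume y: "y \<in> K - {0}"
    have "(\<Sum>x\<in>K - {0}. \<eta> x * \<psi> x) = (\<Sum>t\<in>K - {0}. \<eta> (y * t) * \<psi> (y * t))"
      by (rule units_shift[OF y, of "\<lambda>x. \<eta> x * \<psi> x", symmetric])
    also have "\<dots> * (inverse (\<eta> y) * \<psi> y) = (\<Sum>t\<in>K - {0}. \<eta> t * \<psi> ((t + 1) * y))"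
      unfolding sum_distrib_right using y assms(1)
      by (intro sum.cong) (auto simp: char_mult char_zero_iff psi_add K_mult algebra_simps)
    finally show "(\<Sum>x\<in>K - {0}. \<eta> x * \<psi> x) * (inverse (\<eta> y) * \<psi> y) = (\<Sum>t\<in>K - {0}. \<eta> t * \<psi> ((t + 1) * y))" .
  qed
  also have "\<dots> = (\<Sum>t\<in>K - {0}. \<eta> t * (\<Sum>y\<in>K - {0}. \<psi> ((t + 1) * y)))"
    by (subst sum.swap) (simp add: sum_distrib_left)
  also have "\<dots> = (\<Sum>t\<in>K - {0}. (if t = -1 then \<eta> t * of_nat Q else 0) - \<eta> t)"
  proof (rule sum.cong[OF refl])
    fix t assume t: "t \<in> K - {0}"
    show "\<eta> t * (\<Sum>y\<in>K - {0}. \<psi> ((t + 1) * y)) = (if t = -1 then \<eta> t * of_nat Q else 0) - \<eta> t"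
    proof (cases "t = -1")
      case True
      thus ?thesis using card_K_units Q_gt_1 by (simp add: of_nat_diff algebra_simps)
    next
      case False
      hence "t + 1 \<noteq> 0" by (simp add: add_eq_0_iff2)
      thus ?thesis using sum_psi_units[of "t + 1"] t False by (simp add: K_add)
    qed
  qed
  also have "\<dots> = \<eta> (-1) * of_nat Q"
    using sum_mult_char[OF assms(1)] assms(2) by (simp add: sum_subtractf sum.delta' sum.delta)
  finally show ?thesis .
qed

lemma gauss_nonzero: "\<eta> \<in> mult_chars K \<Longrightarrow> gauss_sum K \<psi> \<eta> \<noteq> 0"
proof (cases "\<eta> = trivial_char K")
  case False
  assume *: "\<eta> \<in> mult_chars K"
  hence "\<eta> (-1) * of_nat Q \<noteq> 0" using Q_gt_1 by (simp add: char_zero_iff)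
  thus ?thesis using gauss_mult_inverse[OF * False] by auto
qed (simp add: gauss_trivial)

lemma char_m1_square: "\<eta> \<in> mult_chars K \<Longrightarrow> \<eta> (-1) * \<eta> (-1) = 1"
  using char_mult[of \<eta> "-1" "-1"] by simp

lemma gauss_circ_nonzero: "\<eta> \<in> mult_chars K \<Longrightarrow> gauss_sum_circ K \<psi> \<eta> \<noteq> 0"
  using gauss_nonzero Q_gt_1 by (simp add: gauss_sum_circ_def card_K)

text \<open>
The factor \<open>Q\<close> that \<open>gauss_sum_circ\<close> has at the trivial character makes the reflection formula
uniform: it holds without a case distinction.
\<close>
lemma gauss_circ_inverse:
  assumes "\<eta> \<in> mult_chars K"
  shows "\<eta> (-1) * gauss_sum K \<psi> (\<lambda>x. inverse (\<eta> x)) = of_nat Q / gauss_sum_circ K \<psi> \<eta>"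
proof (cases "\<eta> = trivial_char K")
  case True
  have "(\<lambda>x. inverse (trivial_char K x)) = trivial_char K" by (auto simp: trivial_char_def)
  thus ?thesis using True Q_gt_1 gauss_trivial by (simp add: gauss_sum_circ_def card_K) (simp add: trivial_char_def)
next
  case False
  have "\<eta> (-1) * (gauss_sum K \<psi> \<eta> * gauss_sum K \<psi> (\<lambda>x. inverse (\<eta> x))) = (\<eta> (-1) * \<eta> (-1)) * of_nat Q"
    using gauss_mult_inverse[OF assms False] by simp
  thus ?thesis using False gauss_nonzero[OF assms] char_m1_square[OF assms]
    by (simp add: gauss_sum_circ_def field_simps)
qed

end

section \<open>Jacobi sums in terms of Gauss sums\<close>

text \<open>
At \<open>c = 1\<close> this is a Jacobi sum without its sign. The value at \<open>c = 0\<close> occurs for those points of the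
hypersurface at which the monomial vanishes.
\<close>
definition jacobi_at :: "'b::field set \<Rightarrow> ('n::finite \<Rightarrow> 'b \<Rightarrow> qbar) \<Rightarrow> 'b \<Rightarrow> qbar" where
  "jacobi_at K \<eta> c = (\<Sum>x | (\<forall>i. x i \<in> K - {0}) \<and> (\<Sum>i\<in>UNIV. x i) = c. \<Prod>i\<in>UNIV. \<eta> i (x i))"

lemma finite_funs: "finite A \<Longrightarrow> finite {x :: 'n::finite \<Rightarrow> 'b. \<forall>i. x i \<in> A}"
  using finite_PiE[of "UNIV::'n set" "\<lambda>_. A"] by (auto simp: PiE_UNIV_domain Pi_def)

lemma prod_sum_funs:
  fixes f :: "'n::finite \<Rightarrow> 'b \<Rightarrow> 'c::comm_semiring_1"
  assumes "finite A"
  shows "(\<Prod>i\<in>UNIV. \<Sum>y\<in>A. f i y) = (\<Sum>x | \<forall>i. x i \<in> A. \<Prod>i\<in>UNIV. f i (x i))"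
  using prod_sum_PiE[of "UNIV::'n set" "\<lambda>_. A" f] assms
  by (simp add: PiE_UNIV_domain Pi_def)

context finite_subfield
begin

lemma jacobi_total:
  "(\<Sum>c\<in>K. jacobi_at K \<eta> c) = (\<Prod>i\<in>(UNIV::'n::finite set). \<Sum>x\<in>K - {0}. \<eta> i x)"
proof -
  let ?X = "{x :: 'n \<Rightarrow> 'b. \<forall>i. x i \<in> K - {0}}"
  have "(\<Prod>i\<in>(UNIV::'n set). \<Sum>x\<in>K - {0}. \<eta> i x) = (\<Sum>x\<in>?X. \<Prod>i\<in>UNIV. \<eta> i (x i))"
    by (rule prod_sum_funs) simp
  also have "\<dots> = (\<Sum>c\<in>K. \<Sum>x | x \<in> ?X \<and> (\<Sum>i\<in>UNIV. x i) = c. \<Prod>i\<in>UNIV. \<eta> i (x i))"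
  proof (rule sum.group[symmetric])
    show "finite ?X" by (rule finite_funs) simp
  qed auto
  finally show ?thesis by (simp add: jacobi_at_def)
qed

lemma jacobi_scale:
  fixes \<eta> :: "'n::finite \<Rightarrow> 'b \<Rightarrow> qbar"
  assumes "\<And>i. \<eta> i \<in> mult_chars K" "c \<in> K - {0}"
  shows "jacobi_at K \<eta> c = (\<Prod>i\<in>UNIV. \<eta> i c) * jacobi_at K \<eta> 1"
  unfolding jacobi_at_def sum_distrib_left
proof (rule sum.reindex_bij_witness[of _ "\<lambda>x i. c * x i" "\<lambda>x i. x i / c"], goal_cases)
  case (2 x)
  thus ?case using assms(2) by (auto simp: sum_divide_distrib[symmetric])
next
  case (4 x)
  thus ?case using assms(2) by (auto simp: sum_distrib_left[symmetric])
next
  case (5 x)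
  have "\<eta> i c * \<eta> i (x i / c) = \<eta> i (x i)" for i
    using char_mult[OF assms(1)[of i], of c "x i / c"] 5 assms(2) by (auto simp: K_divide)
  thus ?case by (simp add: prod.distrib[symmetric])
qed (use assms in auto)

text \<open>
If the product of the characters is trivial, all \<open>c \<noteq> 0\<close> contribute equally, so the value at \<open>c = 0\<close>
follows from the sum over all \<open>c\<close>, which factorizes.
\<close>
lemma jacobi_at_0:
  fixes \<eta> :: "'n::finite \<Rightarrow> 'b \<Rightarrow> qbar"
  assumes "\<And>i. \<eta> i \<in> mult_chars K" "\<And>x. x \<in> K - {0} \<Longrightarrow> (\<Prod>i\<in>UNIV. \<eta> i x) = 1"
  shows "jacobi_at K \<eta> 0 = (if \<forall>i. \<eta> i = trivial_char K then of_nat (Q - 1) ^ CARD('n) else 0)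
           - of_nat (Q - 1) * jacobi_at K \<eta> 1"
proof -
  have "(\<Sum>c\<in>K. jacobi_at K \<eta> c) = jacobi_at K \<eta> 0 + (\<Sum>c\<in>K - {0}. jacobi_at K \<eta> c)"
    by (rule sum.remove) auto
  also have "(\<Sum>c\<in>K - {0}. jacobi_at K \<eta> c) = (\<Sum>c\<in>K - {0}. jacobi_at K \<eta> 1)"
  proof (rule sum.cong[OF refl])
    fix c assume "c \<in> K - {0}"
    thus "jacobi_at K \<eta> c = jacobi_at K \<eta> 1"
      by (subst jacobi_scale[of \<eta> c]) (use assms in auto)
  qed
  also have "\<dots> = of_nat (Q - 1) * jacobi_at K \<eta> 1" using card_K_units by simp
  finally have "jacobi_at K \<eta> 0 = (\<Sum>c\<in>K. jacobi_at K \<eta> c) - of_nat (Q - 1) * jacobi_at K \<eta> 1"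
    by simp
  also have "(\<Sum>c\<in>K. jacobi_at K \<eta> c) = (\<Prod>i\<in>(UNIV::'n set). if \<eta> i = trivial_char K then of_nat (Q - 1) else 0)"
    unfolding jacobi_total using sum_mult_char[OF assms(1)] by (intro prod.cong) auto
  also have "\<dots> = (if \<forall>i. \<eta> i = trivial_char K then of_nat (Q - 1) ^ CARD('n) else 0)"
    by (auto simp: prod_zero_iff)
  finally show ?thesis .
qed

end

context finite_subfield_add_char
begin

text \<open>
The condition \<open>\<Sum>i. x i = 1\<close> is detected by \<open>\<Sum>t. \<psi> (t * (\<Sum>i. x i - 1))\<close>, after which the sum over
\<open>x\<close> factorizes into Gauss sums. The term \<open>t = 0\<close> is responsible for the exceptional case.
\<close>
lemma jacobi_at_1:
  fixes \<eta> :: "'n::finite \<Rightarrow> 'b \<Rightarrow> qbar"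
  assumes \<eta>: "\<And>i. \<eta> i \<in> mult_chars K"
  defines "\<chi> \<equiv> \<lambda>x. \<Prod>i\<in>UNIV. \<eta> i x"
  shows "jacobi_at K \<eta> 1 =
    (if \<forall>i. \<eta> i = trivial_char K then of_nat (Q - 1) ^ CARD('n) / of_nat Q else 0)
    - (-1) ^ CARD('n) * (\<Prod>i\<in>UNIV. gauss_sum K \<psi> (\<eta> i)) / gauss_sum_circ K \<psi> \<chi>"
proof -
  let ?X = "{x :: 'n \<Rightarrow> 'b. \<forall>i. x i \<in> K - {0}}"
  have fX: "finite ?X" by (rule finite_funs) simp
  have \<chi>: "\<chi> \<in> mult_chars K"
    using \<eta> unfolding mult_chars_def \<chi>_def by (auto simp: prod.distrib)
  have "of_nat Q * jacobi_at K \<eta> 1 = (\<Sum>x\<in>?X. if (\<Sum>i\<in>UNIV. x i) = 1 then of_nat Q * (\<Prod>i\<in>UNIV. \<eta> i (x i)) else 0)"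
    unfolding jacobi_at_def sum_distrib_left using fX by (simp add: sum.inter_filter[symmetric])
  also have "\<dots> = (\<Sum>x\<in>?X. (\<Sum>t\<in>K. \<psi> (((\<Sum>i\<in>UNIV. x i) - 1) * t)) * (\<Prod>i\<in>UNIV. \<eta> i (x i)))"
  proof (rule sum.cong[OF refl])
    fix x :: "'n \<Rightarrow> 'b" assume "x \<in> ?X"
    hence "(\<Sum>i\<in>UNIV. x i) - 1 \<in> K" by auto
    from sum_psi_mult[OF this]
    show "(if (\<Sum>i\<in>UNIV. x i) = 1 then of_nat Q * (\<Prod>i\<in>UNIV. \<eta> i (x i)) else 0) =
      (\<Sum>t\<in>K. \<psi> (((\<Sum>i\<in>UNIV. x i) - 1) * t)) * (\<Prod>i\<in>UNIV. \<eta> i (x i))" by simp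
  qed
  also have "\<dots> = (\<Sum>t\<in>K. \<psi> (- t) * (\<Sum>x\<in>?X. \<Prod>i\<in>UNIV. \<eta> i (x i) * \<psi> (t * x i)))"
    unfolding sum_distrib_left sum_distrib_right
  proof (subst sum.swap, intro sum.cong refl)
    fix t and x :: "'n \<Rightarrow> 'b" assume t: "t \<in> K" and x: "x \<in> ?X"
    have "((\<Sum>i\<in>UNIV. x i) - 1) * t = (\<Sum>i\<in>UNIV. t * x i) + (- t)"
      by (simp add: algebra_simps sum_distrib_left)
    also have "\<psi> \<dots> = \<psi> (\<Sum>i\<in>UNIV. t * x i) * \<psi> (- t)"
      using t x by (intro psi_add) auto
    also have "\<psi> (\<Sum>i\<in>UNIV. t * x i) = (\<Prod>i\<in>UNIV. \<psi> (t * x i))"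
      using t x by (intro psi_sum) auto
    finally show "\<psi> (((\<Sum>i\<in>UNIV. x i) - 1) * t) * (\<Prod>i\<in>UNIV. \<eta> i (x i)) =
      \<psi> (- t) * (\<Prod>i\<in>UNIV. \<eta> i (x i) * \<psi> (t * x i))"
      by (simp add: prod.distrib)
  qed
  also have "\<dots> = (\<Sum>t\<in>K. \<psi> (- t) * (\<Prod>i\<in>(UNIV::'n set). \<Sum>x\<in>K - {0}. \<eta> i x * \<psi> (t * x)))"
    by (subst prod_sum_funs) auto
  also have "\<dots> = (\<Prod>i\<in>(UNIV::'n set). \<Sum>x\<in>K - {0}. \<eta> i x) +
      (\<Sum>t\<in>K - {0}. \<psi> (- t) * (\<Prod>i\<in>(UNIV::'n set). \<Sum>x\<in>K - {0}. \<eta> i x * \<psi> (t * x)))"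
    by (subst sum.remove[of K 0]) auto
  also have "(\<Prod>i\<in>(UNIV::'n set). \<Sum>x\<in>K - {0}. \<eta> i x) =
      (\<Prod>i\<in>(UNIV::'n set). if \<eta> i = trivial_char K then of_nat (Q - 1) else 0)"
    using sum_mult_char[OF \<eta>] by (intro prod.cong) auto
  also have "\<dots> = (if \<forall>i. \<eta> i = trivial_char K then of_nat (Q - 1) ^ CARD('n) else 0)"
    by (auto simp: prod_zero_iff)
  also have "(\<Sum>t\<in>K - {0}. \<psi> (- t) * (\<Prod>i\<in>(UNIV::'n set). \<Sum>x\<in>K - {0}. \<eta> i x * \<psi> (t * x))) =
     (\<Sum>t\<in>K - {0}. (-1) ^ CARD('n) * (\<Prod>i\<in>(UNIV::'n set). gauss_sum K \<psi> (\<eta> i)) * (inverse (\<chi> t) * \<psi> (-1 * t)))"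
  proof (rule sum.cong[OF refl])
    fix t assume t: "t \<in> K - {0}"
    have "(\<Prod>i\<in>(UNIV::'n set). \<Sum>x\<in>K - {0}. \<eta> i x * \<psi> (t * x)) = (\<Prod>i\<in>(UNIV::'n set). (-1) * (gauss_sum K \<psi> (\<eta> i) * inverse (\<eta> i t)))"
      using gauss_twist[OF \<eta> t] by (simp add: divide_inverse)
    also have "\<dots> = (-1) ^ CARD('n) * (\<Prod>i\<in>(UNIV::'n set). gauss_sum K \<psi> (\<eta> i)) * inverse (\<chi> t)"
      unfolding prod.distrib \<chi>_def by (simp add: prod_inversef[unfolded comp_def])
    finally show "\<psi> (- t) * (\<Prod>i\<in>(UNIV::'n set). \<Sum>x\<in>K - {0}. \<eta> i x * \<psi> (t * x)) =
      (-1) ^ CARD('n) * (\<Prod>i\<in>(UNIV::'n set). gauss_sum K \<psi> (\<eta> i)) * (inverse (\<chi> t) * \<psi> (-1 * t))"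
      by simp
  qed
  also have "\<dots> = (-1) ^ CARD('n) * (\<Prod>i\<in>(UNIV::'n set). gauss_sum K \<psi> (\<eta> i)) *
      (- (gauss_sum K \<psi> (\<lambda>x. inverse (\<chi> x)) / inverse (\<chi> (-1))))"
    unfolding sum_distrib_left[symmetric]
    by (subst gauss_twist) (use \<chi> in \<open>auto intro!: mult_chars_inverse\<close>)
  also have "gauss_sum K \<psi> (\<lambda>x. inverse (\<chi> x)) / inverse (\<chi> (-1)) = of_nat Q / gauss_sum_circ K \<psi> \<chi>"
    using gauss_circ_inverse[OF \<chi>] by (simp add: mult.commute divide_inverse)
  finally have *: "of_nat Q * jacobi_at K \<eta> 1 = (if \<forall>i. \<eta> i = trivial_char K then of_nat (Q - 1) ^ CARD('n) else 0)
    - of_nat Q * ((-1) ^ CARD('n) * (\<Prod>i\<in>UNIV. gauss_sum K \<psi> (\<eta> i)) / gauss_sum_circ K \<psi> \<chi>)" (is "_ = ?A - _ * ?B")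
    by simp
  have "jacobi_at K \<eta> 1 = (of_nat Q * jacobi_at K \<eta> 1) / of_nat Q" using Q_gt_1 by simp
  also have "\<dots> = ?A / of_nat Q - ?B"
    unfolding * using Q_gt_1 by (simp add: diff_divide_distrib)
  also have "?A / of_nat Q = (if \<forall>i. \<eta> i = trivial_char K then of_nat (Q - 1) ^ CARD('n) / of_nat Q else 0)"
    by simp
  finally show ?thesis .
qed

end

section \<open>Frobenius-stable multisets and their generating series\<close>

text \<open>
If \<open>x\<close> lies in the extension of degree \<open>s\<close>, then \<open>frob_orbit Q s x\<close> consists of its conjugates, with
multiplicities, so that its product and its sum are the norm and the trace of \<open>x\<close>.
\<close>
definition frob_orbit :: "nat \<Rightarrow> nat \<Rightarrow> 'b::field \<Rightarrow> 'b multiset" where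
  "frob_orbit Q s x = mset (map (\<lambda>i. x ^ (Q ^ i)) [0..<s])"

text \<open>
These are the multisets of roots of the monic polynomials over the field with \<open>Q\<close> elements.
\<close>
definition frob_stable :: "nat \<Rightarrow> 'b::field multiset \<Rightarrow> bool" where
  "frob_stable Q M \<longleftrightarrow> image_mset (\<lambda>x. x ^ Q) M = M"

definition stable_msets :: "nat \<Rightarrow> nat \<Rightarrow> 'b::field multiset set" where
  "stable_msets Q n = {M. size M = n \<and> frob_stable Q M}"

context finite_subfield
begin

abbreviation E where "E s \<equiv> {x::'b. x ^ (Q ^ s) = x}"

lemma finite_E: "s > 0 \<Longrightarrow> finite (E s)"
  using finite_subfield.finite_K[OF extension] by blast

lemma frob_iterate_inj: "(x::'b) ^ (Q ^ i) = y ^ (Q ^ i) \<longleftrightarrow> x = y"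
  by (induction i) (auto simp: power_mult mult.commute[of Q] frob_inj)

lemma size_frob_orbit [simp]: "size (frob_orbit Q s x) = s"
  by (simp add: frob_orbit_def)

lemma frob_orbit_add: "frob_orbit Q (a + b) (x::'b) = frob_orbit Q a x + frob_orbit Q b (x ^ (Q ^ a))"
proof -
  have "map (\<lambda>i. x ^ (Q ^ i)) [a..<a + b] = map (\<lambda>i. (x ^ (Q ^ a)) ^ (Q ^ i)) [0..<b]"
    by (rule nth_equalityI) (auto simp: frob_iterate)
  thus ?thesis unfolding frob_orbit_def by (simp only: upt_add_eq_append[OF le0] map_append mset_append)
qed

lemma frob_orbit_1 [simp]: "frob_orbit Q (Suc 0) x = {#x#}" and frob_orbit_0 [simp]: "frob_orbit Q 0 x = {#}"
  by (auto simp: frob_orbit_def)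

lemma image_frob_orbit: "image_mset (\<lambda>x. x ^ Q) (frob_orbit Q s x) = frob_orbit Q s ((x::'b) ^ Q)"
proof -
  have "(x ^ (Q ^ i)) ^ Q = (x ^ Q) ^ (Q ^ i)" for i
    by (metis power_mult mult.commute)
  thus ?thesis by (simp add: frob_orbit_def multiset.map_comp comp_def)
qed

lemma frob_stable_orbit: assumes "x \<in> E s" shows "frob_stable Q (frob_orbit Q s x)"
proof -
  have "frob_orbit Q s x + {#x#} = frob_orbit Q (s + Suc 0) x"
    using assms by (subst frob_orbit_add) simp
  also have "\<dots> = {#x#} + frob_orbit Q s (x ^ Q)"
    by (subst add.commute, subst frob_orbit_add) simp
  finally have "frob_orbit Q s x = frob_orbit Q s (x ^ Q)" by simp
  thus ?thesis unfolding frob_stable_def image_frob_orbit by (rule sym)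
qed

lemma frob_stable_add: "frob_stable Q M \<Longrightarrow> frob_stable Q N \<Longrightarrow> frob_stable Q (M + N)"
  by (simp add: frob_stable_def)

lemma frob_stable_diff: "frob_stable Q M \<Longrightarrow> frob_stable Q N \<Longrightarrow> N \<subseteq># M \<Longrightarrow> frob_stable Q (M - N)"
  by (simp add: frob_stable_def image_mset_Diff)

lemma count_frob_stable:
  assumes "frob_stable Q M"
  shows "count M ((x::'b) ^ (Q ^ i)) = count M x"
proof -
  have *: "count M (y ^ Q) = count M y" for y :: 'b
  proof -
    have "count (image_mset (\<lambda>x. x ^ Q) M) (y ^ Q) = (\<Sum>x | x \<in># M \<and> y ^ Q = x ^ Q. count M x)"
      by (rule count_image_mset')
    also have "{x. x \<in># M \<and> y ^ Q = x ^ Q} = (if y \<in># M then {y} else {})" by (auto simp: frob_inj)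
    finally show ?thesis using assms by (simp add: frob_stable_def not_in_iff split: if_splits)
  qed
  show ?thesis by (induction i) (auto simp: power_mult mult.commute[of Q] *)
qed

lemma ex_period:
  assumes "frob_stable Q M" "x \<in># M"
  shows "\<exists>e>0. e \<le> size M \<and> x \<in> E e"
proof -
  have "(\<lambda>i. x ^ (Q ^ i)) ` {..size M} \<subseteq> set_mset M"
    using assms count_frob_stable[OF assms(1)] by (auto simp: count_greater_zero_iff[symmetric] simp del: count_greater_zero_iff)
  hence "card ((\<lambda>i. x ^ (Q ^ i)) ` {..size M}) \<le> card (set_mset M)" by (intro card_mono) auto
  also have "card (set_mset M) \<le> size M"
    unfolding size_multiset_overloaded_eq card_eq_sum by (intro sum_mono) (simp add: Suc_le_eq)
  finally have "\<not> inj_on (\<lambda>i. x ^ (Q ^ i)) {..size M}"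
    by (metis card_atMost card_image not_less_eq_eq order_refl)
  then obtain i j where ij: "i < j" "j \<le> size M" "x ^ (Q ^ i) = x ^ (Q ^ j)"
    unfolding inj_on_def by (metis atMost_iff nat_neq_iff)
  have "x ^ (Q ^ ((j - i) + i)) = (x ^ (Q ^ (j - i))) ^ (Q ^ i)" by (rule frob_iterate)
  hence "x ^ (Q ^ i) = (x ^ (Q ^ (j - i))) ^ (Q ^ i)" using ij by simp
  hence "x ^ (Q ^ (j - i)) = x" using frob_iterate_inj[of "x ^ (Q ^ (j - i))" i x] by simp
  thus ?thesis using ij by (intro exI[of _ "j - i"]) auto
qed

lemma E_mult: "x \<in> E e \<Longrightarrow> x ^ (Q ^ (e * k)) = x"
  by (induction k) (auto simp: power_add power_mult)

text \<open>
  The multiplicity of a point in a stable multiset counts the closed orbits through the point that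
  the multiset contains. If the point has period \<open>e\<close>, these are the orbits of the lengths
  \<open>e\<close>, \<open>2 e\<close>, ..., which run around the same cycle once, twice, and so on. This replaces the unique
  factorization of polynomials over the small field.
\<close>
lemma card_orbits_in_stable:
  assumes st: "frob_stable Q M"
  shows "card {s. s > 0 \<and> x \<in> E s \<and> frob_orbit Q s x \<subseteq># M} = count M x"
proof (cases "x \<in># M")
  case False
  have "x \<in># frob_orbit Q s x" if "s > 0" for s
    using that by (force simp: frob_orbit_def image_iff)
  hence "{s. s > 0 \<and> x \<in> E s \<and> frob_orbit Q s x \<subseteq># M} = {}"
    using False by (auto dest: mset_subset_eqD)
  thus ?thesis using False by (simp only: card.empty not_in_iff)
next
  case True
  define e where "e = (LEAST e. e > 0 \<and> x \<in> E e)"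
  have e: "e > 0" "x \<in> E e" and least: "\<And>s. s > 0 \<Longrightarrow> x \<in> E s \<Longrightarrow> e \<le> s"
    using LeastI_ex[of "\<lambda>e. e > 0 \<and> x \<in> E e"] ex_period[OF st True] Least_le[of "\<lambda>e. e > 0 \<and> x \<in> E e"]
    unfolding e_def by blast+
  have Es: "x \<in> E s \<longleftrightarrow> e dvd s" for s
  proof
    assume s: "x \<in> E s"
    have "x ^ (Q ^ (e * (s div e) + s mod e)) = (x ^ (Q ^ (e * (s div e)))) ^ (Q ^ (s mod e))"
      by (rule frob_iterate)
    hence "x \<in> E (s mod e)" using s E_mult[OF e(2)] by simp
    hence "s mod e = 0" using least[of "s mod e"] e(1) by (metis mod_less_divisor not_gr_zero not_less)
    thus "e dvd s" by auto
  next
    assume "e dvd s"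
    thus "x \<in> E s" using E_mult[OF e(2)] by auto
  qed
  define Ob where "Ob = frob_orbit Q e x"
  have rep: "frob_orbit Q (e * k) x = repeat_mset k Ob" for k
  proof (induction k)
    case (Suc k)
    thus ?case using e(2) frob_orbit_add[of e "e * k" x] by (simp add: Ob_def)
  qed simp
  have "inj_on (\<lambda>i. x ^ (Q ^ i)) {..<e}"
  proof (rule inj_onI)
    have *: False if "i < j" "j < e" "x ^ (Q ^ i) = x ^ (Q ^ j)" for i j
    proof -
      have "x ^ (Q ^ ((j - i) + i)) = (x ^ (Q ^ (j - i))) ^ (Q ^ i)" by (rule frob_iterate)
      hence "x ^ (Q ^ i) = (x ^ (Q ^ (j - i))) ^ (Q ^ i)" using that by simp
      hence "x \<in> E (j - i)" using frob_iterate_inj[of "x ^ (Q ^ (j - i))" i x] by simp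
      thus False using least[of "j - i"] that by auto
    qed
    fix i j assume "i \<in> {..<e}" "j \<in> {..<e}" "x ^ (Q ^ i) = x ^ (Q ^ j)"
    thus "i = j" using *[of i j] *[of j i] by (metis lessThan_iff nat_neq_iff)
  qed
  hence dist: "distinct (map (\<lambda>i. x ^ (Q ^ i)) [0..<e])"
    by (simp add: distinct_map atLeast0LessThan)
  have cnt: "count Ob y = (if y \<in># Ob then 1 else 0)" for y
    using dist distinct_count_atmost_1[of "map (\<lambda>i. x ^ (Q ^ i)) [0..<e]"] by (simp add: Ob_def frob_orbit_def)
  have mem: "count M y = count M x" if "y \<in># Ob" for y
    using that count_frob_stable[OF st] by (auto simp: Ob_def frob_orbit_def)
  have xOb: "x \<in># Ob" using e(1) by (force simp: Ob_def frob_orbit_def image_iff)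
  have sub: "repeat_mset k Ob \<subseteq># M \<longleftrightarrow> k \<le> count M x" for k
  proof
    assume "repeat_mset k Ob \<subseteq># M"
    hence "count (repeat_mset k Ob) x \<le> count M x" by (rule mset_subset_eq_count)
    thus "k \<le> count M x" using xOb cnt[of x] by simp
  next
    assume k: "k \<le> count M x"
    show "repeat_mset k Ob \<subseteq># M"
    proof (rule mset_subset_eqI)
      fix y show "count (repeat_mset k Ob) y \<le> count M y"
        using k mem[of y] cnt[of y] by (cases "y \<in># Ob") (auto simp: not_in_iff)
    qed
  qed
  have "{s. s > 0 \<and> x \<in> E s \<and> frob_orbit Q s x \<subseteq># M} = (\<lambda>k. e * k) ` {1..count M x}"
    unfolding Es using e(1) rep sub by (auto simp: image_iff elim!: dvdE)
  moreover have "inj_on (\<lambda>k. e * k) {1..count M x}" using e(1) by (auto simp: inj_on_def)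
  ultimately show ?thesis by (simp only: card_image card_atLeastAtMost diff_Suc_Suc)
qed

lemma sum_orbits_in_stable:
  assumes M: "M \<in> stable_msets Q n"
  shows "(\<Sum>s=1..n. card {x \<in> E s. frob_orbit Q s x \<subseteq># M}) = n"
proof -
  have st: "frob_stable Q M" and sz: "size M = n" using M by (auto simp: stable_msets_def)
  have mem: "x \<in># M" if "s > 0" "frob_orbit Q s x \<subseteq># M" for s x
  proof -
    have "x \<in># frob_orbit Q s x" using that(1) by (force simp: frob_orbit_def image_iff)
    thus ?thesis using that(2) by (rule mset_subset_eqD[rotated])
  qed
  have "n = (\<Sum>x\<in>set_mset M. count M x)" using sz by (simp add: size_multiset_overloaded_eq)
  also have "\<dots> = (\<Sum>x\<in>set_mset M. card {s \<in> {1..n}. x \<in> E s \<and> frob_orbit Q s x \<subseteq># M})"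
  proof (rule sum.cong[OF refl])
    fix x
    have "s \<le> n" if "frob_orbit Q s x \<subseteq># M" for s
      using size_mset_mono[OF that] sz by simp
    hence "{s \<in> {1..n}. x \<in> E s \<and> frob_orbit Q s x \<subseteq># M} = {s. s > 0 \<and> x \<in> E s \<and> frob_orbit Q s x \<subseteq># M}"
      by auto
    thus "count M x = card {s \<in> {1..n}. x \<in> E s \<and> frob_orbit Q s x \<subseteq># M}"
      using card_orbits_in_stable[OF st] by simp
  qed
  also have "\<dots> = (\<Sum>x\<in>set_mset M. \<Sum>s=1..n. if x \<in> E s \<and> frob_orbit Q s x \<subseteq># M then 1 else 0)"
    unfolding card_eq_sum by (intro sum.cong refl sum.inter_filter) auto
  also have "\<dots> = (\<Sum>s=1..n. \<Sum>x\<in>set_mset M. if x \<in> E s \<and> frob_orbit Q s x \<subseteq># M then 1 else 0)"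
    by (rule sum.swap)
  also have "\<dots> = (\<Sum>s=1..n. card {x \<in> E s. frob_orbit Q s x \<subseteq># M})"
  proof (rule sum.cong[OF refl])
    fix s assume "s \<in> {1..n}"
    hence "{x \<in> E s. frob_orbit Q s x \<subseteq># M} = {x \<in> set_mset M. x \<in> E s \<and> frob_orbit Q s x \<subseteq># M}"
      using mem[of s] by auto
    thus "(\<Sum>x\<in>set_mset M. if x \<in> E s \<and> frob_orbit Q s x \<subseteq># M then 1 else 0) = card {x \<in> E s. frob_orbit Q s x \<subseteq># M}"
      unfolding card_eq_sum by (simp add: sum.inter_filter[symmetric])
  qed
  finally show ?thesis by simp
qed

lemma finite_stable_msets: "finite (stable_msets Q n :: 'b multiset set)"
proof (rule finite_subset)
  show "(stable_msets Q n :: 'b multiset set) \<subseteq> multisets_of_size (\<Union>e\<in>{1..n}. E e) n"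
    using ex_period by (fastforce simp: stable_msets_def multisets_of_size_def Suc_le_eq)
  show "finite (multisets_of_size (\<Union>e\<in>{1..n}. E e) n :: 'b multiset set)"
    by (intro finite_multisets_of_size finite_UN_I) (auto intro: finite_E)
qed

text \<open>
A stable multiset of size \<open>n\<close> contains exactly \<open>n\<close> orbits \<open>frob_orbit Q s x\<close>, counted with \<open>s\<close> and \<open>x\<close>
(\<open>sum_orbits_in_stable\<close>). Removing the orbit leaves an arbitrary stable multiset of size \<open>n - s\<close>.
\<close>
lemma stable_msets_recursion:
  fixes \<Lambda> :: "'b multiset \<Rightarrow> qbar"
  assumes mult: "\<And>M N. frob_stable Q M \<Longrightarrow> frob_stable Q N \<Longrightarrow> \<Lambda> (M + N) = \<Lambda> M * \<Lambda> N"
  shows "of_nat n * (\<Sum>M\<in>stable_msets Q n. \<Lambda> M) =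
    (\<Sum>s=1..n. (\<Sum>x\<in>E s. \<Lambda> (frob_orbit Q s x)) * (\<Sum>M\<in>stable_msets Q (n - s). \<Lambda> M))"
proof -
  have "of_nat n * (\<Sum>M\<in>stable_msets Q n. \<Lambda> M) =
      (\<Sum>M\<in>stable_msets Q n. \<Sum>s=1..n. \<Sum>x\<in>E s. if frob_orbit Q s x \<subseteq># M then \<Lambda> M else 0)"
    unfolding sum_distrib_left
  proof (rule sum.cong[OF refl])
    fix M :: "'b multiset" assume M: "M \<in> stable_msets Q n"
    have "of_nat n * \<Lambda> M = (\<Sum>s=1..n. of_nat (card {x \<in> E s. frob_orbit Q s x \<subseteq># M}) * \<Lambda> M)"
      by (subst sum_orbits_in_stable[OF M, symmetric]) (simp add: sum_distrib_right)
    also have "\<dots> = (\<Sum>s=1..n. \<Sum>x\<in>E s. if frob_orbit Q s x \<subseteq># M then \<Lambda> M else 0)"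
      by (intro sum.cong refl) (simp add: sum.inter_filter[symmetric] finite_E)
    finally show "of_nat n * \<Lambda> M = (\<Sum>s=1..n. \<Sum>x\<in>E s. if frob_orbit Q s x \<subseteq># M then \<Lambda> M else 0)" .
  qed
  also have "\<dots> = (\<Sum>s=1..n. \<Sum>x\<in>E s. \<Sum>M\<in>stable_msets Q n. if frob_orbit Q s x \<subseteq># M then \<Lambda> M else 0)"
    by (subst sum.swap, intro sum.cong refl, rule sum.swap)
  also have "\<dots> = (\<Sum>s=1..n. (\<Sum>x\<in>E s. \<Lambda> (frob_orbit Q s x)) * (\<Sum>M\<in>stable_msets Q (n - s). \<Lambda> M))"
    unfolding sum_distrib_right
  proof (intro sum.cong refl)
    fix s x assume s: "s \<in> {1..n}" and x: "x \<in> E s"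
    have stO: "frob_stable Q (frob_orbit Q s x)" using x by (rule frob_stable_orbit)
    have "(\<Sum>M\<in>stable_msets Q n. if frob_orbit Q s x \<subseteq># M then \<Lambda> M else 0) =
        (\<Sum>M | M \<in> stable_msets Q n \<and> frob_orbit Q s x \<subseteq># M. \<Lambda> M)"
      by (simp add: sum.inter_filter[symmetric] finite_stable_msets)
    also have "\<dots> = (\<Sum>M\<in>stable_msets Q (n - s). \<Lambda> (frob_orbit Q s x) * \<Lambda> M)"
      using s stO
      by (intro sum.reindex_bij_witness[of _ "\<lambda>M. frob_orbit Q s x + M" "\<lambda>M. M - frob_orbit Q s x"])
         (auto simp: stable_msets_def size_Diff_submset frob_stable_diff frob_stable_add mult[symmetric])
    finally show "(\<Sum>M\<in>stable_msets Q n. if frob_orbit Q s x \<subseteq># M then \<Lambda> M else 0) =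
      \<Lambda> (frob_orbit Q s x) * (\<Sum>M\<in>stable_msets Q (n - s). \<Lambda> M)"
      by (simp add: sum_distrib_left)
  qed
  finally show ?thesis .
qed

end

section \<open>Newton's identities\<close>

definition elem_sym_fps :: "'c::field multiset \<Rightarrow> 'c fps" where
  "elem_sym_fps M = (\<Prod>y\<in>#M. 1 - fps_const y * fps_X)"

definition power_sum :: "'c::field multiset \<Rightarrow> nat \<Rightarrow> 'c" where
  "power_sum M k = (\<Sum>y\<in>#M. y ^ k)"

definition power_sum_fps :: "'c::field multiset \<Rightarrow> 'c fps" where
  "power_sum_fps M = Abs_fps (\<lambda>k. if k = 0 then 0 else power_sum M k)"

lemma newton_fps: "fps_X * fps_deriv (elem_sym_fps M) = - (elem_sym_fps M * power_sum_fps M)"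
proof (induction M)
  case empty
  have "power_sum_fps {#} = (0 :: 'a fps)" by (intro fps_ext) (simp add: power_sum_fps_def power_sum_def)
  thus ?case by (simp add: elem_sym_fps_def)
next
  case (add y M)
  define G where "G = Abs_fps (\<lambda>k. if k = 0 then 0 else y ^ k)"
  have E: "elem_sym_fps (add_mset y M) = (1 - fps_const y * fps_X) * elem_sym_fps M"
    by (simp add: elem_sym_fps_def)
  have P: "power_sum_fps (add_mset y M) = power_sum_fps M + G"
    by (intro fps_ext) (simp add: power_sum_fps_def power_sum_def G_def)
  have G: "(1 - fps_const y * fps_X) * G = fps_const y * fps_X"
  proof (rule fps_ext)
    fix k show "fps_nth ((1 - fps_const y * fps_X) * G) k = fps_nth (fps_const y * fps_X) k"
      by (cases k; cases "k - 1") (auto simp: G_def left_diff_distrib mult.assoc)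
  qed
  have "fps_X * fps_deriv (elem_sym_fps (add_mset y M)) =
      (1 - fps_const y * fps_X) * (fps_X * fps_deriv (elem_sym_fps M)) - (fps_const y * fps_X) * elem_sym_fps M"
    unfolding E by (simp add: algebra_simps)
  also have "\<dots> = - ((1 - fps_const y * fps_X) * elem_sym_fps M * power_sum_fps M) - ((1 - fps_const y * fps_X) * G) * elem_sym_fps M"
    unfolding add.IH G by (simp add: algebra_simps)
  finally show ?case unfolding E P by (simp add: algebra_simps)
qed

lemma elem_sym_fps_0 [simp]: "fps_nth (elem_sym_fps M) 0 = 1"
  by (induction M) (auto simp: elem_sym_fps_def)

lemma newton_coeff:
  "of_nat k * fps_nth (elem_sym_fps M) k = - (\<Sum>i=1..k. power_sum M i * fps_nth (elem_sym_fps M) (k - i))"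
proof -
  have "fps_nth (fps_X * fps_deriv (elem_sym_fps M)) k = - fps_nth (power_sum_fps M * elem_sym_fps M) k"
    by (simp add: newton_fps mult.commute)
  also have "fps_nth (power_sum_fps M * elem_sym_fps M) k = (\<Sum>i=0..k. fps_nth (power_sum_fps M) i * fps_nth (elem_sym_fps M) (k - i))"
    by (simp add: fps_mult_nth)
  also have "\<dots> = (\<Sum>i=1..k. power_sum M i * fps_nth (elem_sym_fps M) (k - i))"
    by (subst sum.atLeast_Suc_atMost) (auto simp: power_sum_fps_def intro!: sum.cong)
  also have "fps_nth (fps_X * fps_deriv (elem_sym_fps M)) k = of_nat k * fps_nth (elem_sym_fps M) k"
    by (cases k) auto
  finally show ?thesis .
qed

lemma power_sum_eq:
  assumes "k > 0"
  shows "power_sum M k = - of_nat k * fps_nth (elem_sym_fps M) k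
           - (\<Sum>i=1..<k. power_sum M i * fps_nth (elem_sym_fps M) (k - i))"
proof -
  have "(\<Sum>i=1..k. power_sum M i * fps_nth (elem_sym_fps M) (k - i)) =
    (\<Sum>i=1..<k. power_sum M i * fps_nth (elem_sym_fps M) (k - i)) + power_sum M k"
    using assms by (subst sum.last_plus) (auto simp: atLeastLessThanSuc_atLeastAtMost[symmetric] add.commute Suc_le_eq
        simp flip: atLeastLessThanSuc_atLeastAtMost)
  hence "of_nat k * fps_nth (elem_sym_fps M) k =
      - ((\<Sum>i=1..<k. power_sum M i * fps_nth (elem_sym_fps M) (k - i)) + power_sum M k)"
    by (simp only: newton_coeff)
  thus ?thesis unfolding mult_minus_left by simp
qed

text \<open>
If the first elementary symmetric function in which two multisets differ is the \<open>j\<close>-th, then by Newton's identities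
the power sums agree below \<open>j\<close>, and at \<open>j\<close> they differ by a linear term.
\<close>
lemma power_sum_perturb:
  assumes "\<And>i. i \<le> j \<Longrightarrow> fps_nth (elem_sym_fps M') i = fps_nth (elem_sym_fps M) i + (if i = j then a else 0)"
    and "j > 0"
  shows "power_sum M' j = power_sum M j - of_nat j * a"
proof -
  have eq: "power_sum M' k = power_sum M k" if "0 < k" "k < j" for k
    using that
  proof (induction k rule: less_induct)
    case (less k)
    have "(\<Sum>i=1..<k. power_sum M' i * fps_nth (elem_sym_fps M') (k - i)) =
          (\<Sum>i=1..<k. power_sum M i * fps_nth (elem_sym_fps M) (k - i))"
      using less by (intro sum.cong refl) (auto simp: assms(1))
    thus ?case using less.prems by (simp add: power_sum_eq assms(1))
  qed
  have "(\<Sum>i=1..<j. power_sum M' i * fps_nth (elem_sym_fps M') (j - i)) =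
        (\<Sum>i=1..<j. power_sum M i * fps_nth (elem_sym_fps M) (j - i))"
    by (intro sum.cong refl) (auto simp: assms(1) eq)
  thus ?thesis using assms(2) by (simp add: power_sum_eq assms(1) algebra_simps)
qed

section \<open>Stable multisets as roots of polynomials\<close>

definition mset_poly :: "'b::field multiset \<Rightarrow> 'b poly" where
  "mset_poly M = (\<Prod>y\<in>#M. [:- y, 1:])"

lemma mset_poly_add [simp]: "mset_poly (add_mset y M) = [:- y, 1:] * mset_poly M"
  and mset_poly_empty [simp]: "mset_poly {#} = 1"
  by (auto simp: mset_poly_def)

lemma mset_poly_nonzero [simp]: "mset_poly M \<noteq> 0"
  by (auto simp: mset_poly_def prod_mset_zero_iff)

lemma proots_mset_poly [simp]: "proots (mset_poly M) = M"
proof (induction M)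
  case (add y M)
  show ?case unfolding mset_poly_add by (subst proots_mult) (auto simp: add simp del: mult_pCons_left)
qed simp

lemma degree_mset_poly [simp]: "Polynomial.degree (mset_poly M) = size M"
  by (induction M) (auto simp: degree_mult_eq simp del: mult_pCons_left)

lemma lead_coeff_mset_poly [simp]: "Polynomial.coeff (mset_poly M) (size M) = 1"
proof -
  have "lead_coeff (mset_poly M) = 1" by (induction M) (auto simp: lead_coeff_mult simp del: mult_pCons_left)
  thus ?thesis by simp
qed

lemma coeff_mset_poly:
  "j \<le> size M \<Longrightarrow> Polynomial.coeff (mset_poly M) (size M - j) = fps_nth (elem_sym_fps M) j"
proof -
  have "fps_of_poly (reflect_poly (mset_poly M)) = elem_sym_fps M"
  proof (induction M)
    case (add y M)
    have "reflect_poly [:- y, 1:] = [:1, - y:]" by (cases "y = 0") (auto simp: reflect_poly_def)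
    thus ?case using add
      by (simp add: reflect_poly_mult fps_of_poly_mult elem_sym_fps_def fps_of_poly_pCons del: mult_pCons_left)
  qed (simp add: elem_sym_fps_def)
  moreover assume "j \<le> size M"
  ultimately show ?thesis by (metis coeff_reflect_poly degree_mset_poly fps_of_poly_nth not_less)
qed

lemma coeff_0_mset_poly: "Polynomial.coeff (mset_poly M) 0 = (-1) ^ size M * \<Prod>\<^sub># M"
  by (induction M) (auto simp: coeff_mult)

context finite_subfield
begin

definition monic_polys :: "nat \<Rightarrow> 'b poly set" where
  "monic_polys n = {f. Polynomial.degree f = n \<and> lead_coeff f = 1 \<and> (\<forall>i. Polynomial.coeff f i \<in> K)}"

lemma map_poly_frob_mset_poly: "map_poly (\<lambda>x. x ^ Q) (mset_poly M) = mset_poly (image_mset (\<lambda>x::'b. x ^ Q) M)"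
proof (induction M)
  case (add y M)
  have Q0: "(0::'b) ^ Q = 0" using Q_gt_1 by (simp add: power_0_left)
  have "map_poly (\<lambda>x. x ^ Q) ([:- y, 1:] * p) = [:- (y ^ Q), 1:] * map_poly (\<lambda>x::'b. x ^ Q) p" for p
  proof (rule poly_eqI)
    fix n show "Polynomial.coeff (map_poly (\<lambda>x. x ^ Q) ([:- y, 1:] * p)) n =
      Polynomial.coeff ([:- (y ^ Q), 1:] * map_poly (\<lambda>x::'b. x ^ Q) p) n"
      by (cases n) (auto simp: coeff_map_poly Q0 frob_add frob_diff frob_minus power_mult_distrib)
  qed
  thus ?case using add by simp
qed simp

lemma bij_betw_stable_msets: "bij_betw mset_poly (stable_msets Q n) (monic_polys n)"
  unfolding bij_betw_def
proof
  show "inj_on mset_poly (stable_msets Q n :: 'b multiset set)"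
    by (rule inj_on_inverseI[of _ proots]) simp
  have Q0: "(0::'b) ^ Q = 0" using Q_gt_1 by (simp add: power_0_left)
  show "mset_poly ` stable_msets Q n = monic_polys n"
  proof (intro equalityI subsetI)
    fix f :: "'b poly" assume "f \<in> mset_poly ` stable_msets Q n"
    then obtain M where M: "f = mset_poly M" "size M = n" "frob_stable Q M"
      by (auto simp: stable_msets_def)
    have "map_poly (\<lambda>x. x ^ Q) f = f"
      using map_poly_frob_mset_poly[of M] M(1,3) by (simp only: frob_stable_def)
    hence "Polynomial.coeff f i \<in> K" for i
      by (metis (no_types, lifting) K_iff Q0 coeff_map_poly)
    thus "f \<in> monic_polys n" using M by (auto simp: monic_polys_def)
  next
    fix f assume f: "f \<in> monic_polys n"
    have f0: "f \<noteq> 0" using f by (auto simp: monic_polys_def)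
    have feq: "f = mset_poly (proots f)"
    proof -
      have "lead_coeff f = 1" using f by (auto simp: monic_polys_def)
      hence "Polynomial.smult (lead_coeff f) (mset_poly (proots f)) = mset_poly (proots f)" by simp
      thus ?thesis using size_proots_alg_closed(2)[OF f0] unfolding mset_poly_def by (rule trans[rotated])
    qed
    have "map_poly (\<lambda>x. x ^ Q) f = f"
      by (rule poly_eqI) (use f Q0 in \<open>simp add: coeff_map_poly monic_polys_def K_iff\<close>)
    hence "mset_poly (image_mset (\<lambda>x. x ^ Q) (proots f)) = mset_poly (proots f)"
      using feq map_poly_frob_mset_poly by metis
    hence "image_mset (\<lambda>x. x ^ Q) (proots f) = proots f" by (metis proots_mset_poly)
    hence "proots f \<in> stable_msets Q n"
      using size_proots_alg_closed(1)[OF f0] f by (simp add: stable_msets_def frob_stable_def monic_polys_def)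
    thus "f \<in> mset_poly ` stable_msets Q n" using feq by blast
  qed
qed

lemma proots_monic:
  assumes "f \<in> monic_polys n"
  shows "mset_poly (proots f) = f" "size (proots f) = n" "frob_stable Q (proots f)"
proof -
  have "f \<in> mset_poly ` stable_msets Q n"
    using bij_betw_imp_surj_on[OF bij_betw_stable_msets[of n]] assms by simp
  then obtain M where "f = mset_poly M" "M \<in> stable_msets Q n" by blast
  thus "mset_poly (proots f) = f" "size (proots f) = n" "frob_stable Q (proots f)"
    by (auto simp: stable_msets_def)
qed

lemma power_sum_proots_perturb:
  assumes f: "f \<in> monic_polys n" and g: "f + Polynomial.monom a (n - j) \<in> monic_polys n" and j: "0 < j" "j \<le> n"
  shows "power_sum (proots (f + Polynomial.monom a (n - j))) j = power_sum (proots f) j - of_nat j * a"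
proof (rule power_sum_perturb)
  fix i assume i: "i \<le> j"
  have "fps_nth (elem_sym_fps (proots h)) i = Polynomial.coeff h (n - i)" if "h \<in> monic_polys n" for h
    using coeff_mset_poly[of i "proots h"] proots_monic[OF that] i j by simp
  thus "fps_nth (elem_sym_fps (proots (f + Polynomial.monom a (n - j)))) i =
    fps_nth (elem_sym_fps (proots f)) i + (if i = j then a else 0)"
    using f g i j by auto
qed (use j in auto)

lemma prod_proots:
  assumes "f \<in> monic_polys n"
  shows "\<Prod>\<^sub># (proots f) = (-1) ^ n * Polynomial.coeff f 0"
  using coeff_0_mset_poly[of "proots f"] proots_monic[OF assms]
  by (simp add: mult.assoc[symmetric] power_mult_distrib[symmetric])

lemma monic_polys_add_monom:
  assumes "f \<in> monic_polys n" "a \<in> K" "i < n"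
  shows "f + Polynomial.monom a i \<in> monic_polys n"
proof -
  have "Polynomial.degree (f + Polynomial.monom a i) = n"
    using assms degree_monom_le[of a i] by (subst degree_add_eq_left) (auto simp: monic_polys_def)
  thus ?thesis using assms by (auto simp: monic_polys_def)
qed

text \<open>
The sum over all polynomials is organized so that the inner sum varies a single coefficient.
\<close>
lemma sum_stable_msets_split:
  assumes j: "0 < j" "j \<le> n"
  shows "(\<Sum>M\<in>stable_msets Q n. \<Lambda> M) =
    (\<Sum>f | f \<in> monic_polys n \<and> Polynomial.coeff f (n - j) = 0.
      \<Sum>a\<in>K. \<Lambda> (proots (f + Polynomial.monom a (n - j))))"
proof -
  let ?i = "n - j"
  have i: "?i < n" using j by simp
  have "(\<Sum>M\<in>stable_msets Q n. \<Lambda> M) = (\<Sum>M\<in>stable_msets Q n. \<Lambda> (proots (mset_poly M)))" by simp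
  also have "\<dots> = (\<Sum>f\<in>monic_polys n. \<Lambda> (proots f))"
    by (rule sum.reindex_bij_betw[OF bij_betw_stable_msets])
  also have "\<dots> = (\<Sum>(f, a)\<in>{f \<in> monic_polys n. Polynomial.coeff f ?i = 0} \<times> K. \<Lambda> (proots (f + Polynomial.monom a ?i)))"
  proof (rule sum.reindex_bij_witness[of _ "\<lambda>(f, a). f + Polynomial.monom a ?i"
        "\<lambda>f. (f + Polynomial.monom (- Polynomial.coeff f ?i) ?i, Polynomial.coeff f ?i)"], goal_cases)
    case (2 f)
    hence "f + Polynomial.monom (- Polynomial.coeff f ?i) ?i \<in> monic_polys n"
      by (intro monic_polys_add_monom i) (auto simp: monic_polys_def)
    thus ?case using 2 by (auto simp: monic_polys_def)
  qed (auto intro!: monic_polys_add_monom i simp: add_monom minus_monom add.assoc)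
  also have "\<dots> = (\<Sum>f | f \<in> monic_polys n \<and> Polynomial.coeff f ?i = 0. \<Sum>a\<in>K. \<Lambda> (proots (f + Polynomial.monom a ?i)))"
    by (subst sum.cartesian_product[symmetric]) simp
  finally show ?thesis .
qed

end

section \<open>The Davenport--Hasse relations\<close>

lemma log_deriv_unique:
  fixes F E S :: "'c::field_char_0 fps"
  assumes "fps_X * fps_deriv F = F * S" "fps_X * fps_deriv E = E * S" "fps_nth S 0 = 0"
    and "fps_nth F 0 = fps_nth E 0"
  shows "F = E"
proof (rule fps_ext)
  have rec: "of_nat k * fps_nth H k = (\<Sum>i<k. fps_nth H i * fps_nth S (k - i))"
    if "fps_X * fps_deriv H = H * S" for H k
  proof -
    have "of_nat k * fps_nth H k = fps_nth (fps_X * fps_deriv H) k" by (cases k) auto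
    also have "\<dots> = (\<Sum>i=0..k. fps_nth H i * fps_nth S (k - i))"
      by (simp add: that fps_mult_nth)
    also have "\<dots> = (\<Sum>i<k. fps_nth H i * fps_nth S (k - i))"
      using assms(3) by (intro sum.mono_neutral_right) (auto simp: le_less)
    finally show ?thesis .
  qed
  fix k show "fps_nth F k = fps_nth E k"
  proof (induction k rule: less_induct)
    case (less k)
    show ?case
    proof (cases "k = 0")
      case False
      have "of_nat k * fps_nth F k = of_nat k * fps_nth E k"
        unfolding rec[OF assms(1)] rec[OF assms(2)] using less by (intro sum.cong) auto
      thus ?thesis using False by simp
    qed (use assms in simp)
  qed
qed

lemma (in finite_subfield) prod_mset_stable_in_K:
  assumes "frob_stable Q M"
  shows "\<Prod>\<^sub># M \<in> K"
proof -
  have "(\<Prod>\<^sub># M) ^ Q = (\<Prod>y\<in>#M. y ^ Q)" by (induction M) (auto simp: power_mult_distrib)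
  also have "\<dots> = \<Prod>\<^sub># M" using assms by (simp add: frob_stable_def)
  finally show ?thesis by (simp add: K_iff)
qed

lemma (in finite_subfield) power_sum_stable_in_K:
  assumes "frob_stable Q M"
  shows "power_sum M m \<in> K"
proof -
  have Q0: "(0::'b) ^ Q = 0" using Q_gt_1 by (simp add: power_0_left)
  have "(power_sum M m) ^ Q = (\<Sum>y\<in>#M. (y ^ Q) ^ m)"
    by (induction M) (auto simp: power_sum_def frob_add Q0 power_mult[symmetric] mult.commute)
  also have "\<dots> = (\<Sum>y\<in>#image_mset (\<lambda>x. x ^ Q) M. y ^ m)"
    by (simp add: multiset.map_comp comp_def)
  also have "\<dots> = power_sum M m" using assms by (simp add: frob_stable_def power_sum_def)
  finally show ?thesis by (simp add: K_iff)
qed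

definition frob_norm :: "nat \<Rightarrow> nat \<Rightarrow> 'b::field \<Rightarrow> 'b" where
  "frob_norm Q s x = (\<Prod>i<s. x ^ (Q ^ i))"

definition frob_trace :: "nat \<Rightarrow> nat \<Rightarrow> 'b::field \<Rightarrow> 'b" where
  "frob_trace Q s x = (\<Sum>i<s. x ^ (Q ^ i))"

lemma prod_frob_orbit: "\<Prod>\<^sub># (frob_orbit Q s x) = frob_norm Q s x"
  unfolding frob_orbit_def frob_norm_def prod_mset_prod_list
  by (simp add: prod.list_conv_set_nth atLeast0LessThan)

lemma power_sum_frob_orbit: "power_sum (frob_orbit Q s x) m = frob_trace Q s (x ^ m)"
proof -
  have "power_sum (frob_orbit Q s x) m = (\<Sum>i<s. (x ^ (Q ^ i)) ^ m)"
    by (induction s) (auto simp: frob_orbit_def power_sum_def add.commute)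
  thus ?thesis by (simp add: frob_trace_def power_mult[symmetric] mult.commute)
qed

lemma frob_norm_power: "frob_norm Q s (x ^ m) = frob_norm Q s x ^ m"
  by (simp add: frob_norm_def prod_power_distrib power_mult[symmetric] mult.commute)

lemma frob_norm_mult: "frob_norm Q s (x * y) = frob_norm Q s x * frob_norm Q s y"
  by (simp add: frob_norm_def power_mult_distrib prod.distrib)

lemma frob_norm_eq_0_iff: "s > 0 \<Longrightarrow> Q > 0 \<Longrightarrow> frob_norm Q s x = 0 \<longleftrightarrow> x = 0"
  by (auto simp: frob_norm_def)

lemma geometric_sum_nat: "Q > 1 \<Longrightarrow> (\<Sum>i<s. Q ^ i) * (Q - 1) = Q ^ s - (1::nat)"
proof -
  assume Q: "Q > 1"
  have "int ((\<Sum>i<s. Q ^ i) * (Q - 1)) = int (Q ^ s - 1)"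
    using Q power_diff_1_eq[of "int Q" s] by (simp add: of_nat_diff mult.commute)
  thus ?thesis by linarith
qed

lemma frob_norm_as_power:
  assumes "Q > 1" "m dvd Q - 1"
  shows "frob_norm Q s x ^ ((Q - 1) div m) = x ^ ((Q ^ s - 1) div m)" "m dvd Q ^ s - 1"
proof -
  have "(Q ^ s - 1) div m = (\<Sum>i<s. Q ^ i) * ((Q - 1) div m)"
    using geometric_sum_nat[OF assms(1), of s] assms(2) by (metis div_mult_swap)
  moreover have "frob_norm Q s x = x ^ (\<Sum>i<s. Q ^ i)" by (simp add: frob_norm_def power_sum)
  ultimately show "frob_norm Q s x ^ ((Q - 1) div m) = x ^ ((Q ^ s - 1) div m)"
    by (simp add: power_mult[symmetric])
  show "m dvd Q ^ s - 1" using geometric_sum_nat[OF assms(1), of s] assms(2) by (metis dvd_mult)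
qed

context finite_subfield_add_char
begin

text \<open>
This weight is multiplicative on stable multisets. Its two factors are the analogues of the two
characters in a Gauss sum.
\<close>
definition weight :: "('b \<Rightarrow> qbar) \<Rightarrow> nat \<Rightarrow> 'b multiset \<Rightarrow> qbar" where
  "weight \<alpha> m M = \<alpha> (\<Prod>\<^sub># M) * \<psi> (power_sum M m)"

definition weight_series :: "('b \<Rightarrow> qbar) \<Rightarrow> nat \<Rightarrow> qbar fps" where
  "weight_series \<alpha> m = Abs_fps (\<lambda>n. \<Sum>M\<in>stable_msets Q n. weight \<alpha> m M)"

definition point_series :: "('b \<Rightarrow> qbar) \<Rightarrow> nat \<Rightarrow> qbar fps" where
  "point_series \<alpha> m = Abs_fps (\<lambda>s. if s = 0 then 0 else \<Sum>x\<in>E s. \<alpha> (frob_norm Q s x) * \<psi> (frob_trace Q s (x ^ m)))"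

lemma weight_series_deriv:
  assumes "\<alpha> \<in> mult_chars K"
  shows "fps_X * fps_deriv (weight_series \<alpha> m) = weight_series \<alpha> m * point_series \<alpha> m"
proof (rule fps_ext)
  fix n
  have mult: "weight \<alpha> m (M + N) = weight \<alpha> m M * weight \<alpha> m N"
    if "frob_stable Q M" "frob_stable Q N" for M N
  proof -
    have "power_sum (M + N) m = power_sum M m + power_sum N m" by (simp add: power_sum_def)
    thus ?thesis using that assms
      by (simp add: weight_def char_mult prod_mset_stable_in_K psi_add power_sum_stable_in_K)
  qed
  have "fps_nth (fps_X * fps_deriv (weight_series \<alpha> m)) n = of_nat n * (\<Sum>M\<in>stable_msets Q n. weight \<alpha> m M)"
    by (cases n) (auto simp: weight_series_def)
  also have "\<dots> = (\<Sum>s=1..n. (\<Sum>x\<in>E s. weight \<alpha> m (frob_orbit Q s x)) * (\<Sum>M\<in>stable_msets Q (n - s). weight \<alpha> m M))"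
    by (rule stable_msets_recursion) (rule mult)
  also have "\<dots> = (\<Sum>s=0..n. fps_nth (point_series \<alpha> m) s * fps_nth (weight_series \<alpha> m) (n - s))"
    by (rule sum.mono_neutral_cong_left)
       (auto simp: point_series_def weight_series_def weight_def prod_frob_orbit power_sum_frob_orbit)
  also have "\<dots> = fps_nth (weight_series \<alpha> m * point_series \<alpha> m) n"
    by (subst mult.commute) (simp add: fps_mult_nth)
  finally show "fps_nth (fps_X * fps_deriv (weight_series \<alpha> m)) n = fps_nth (weight_series \<alpha> m * point_series \<alpha> m) n" .
qed

lemma stable_msets_0: "stable_msets Q 0 = {{#}}"
  by (auto simp: stable_msets_def frob_stable_def)

lemma stable_msets_1: "stable_msets Q 1 = (\<lambda>x. {#x#}) ` K"
proof (intro equalityI subsetI)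
  fix M :: "'b multiset" assume M: "M \<in> stable_msets Q 1"
  then obtain x where "M = {#x#}" using size_1_singleton_mset by (auto simp: stable_msets_def)
  thus "M \<in> (\<lambda>x. {#x#}) ` K" using M by (auto simp: stable_msets_def frob_stable_def K_iff)
qed (auto simp: stable_msets_def frob_stable_def K_iff)

lemma weight_series_0 [simp]: "\<alpha> \<in> mult_chars K \<Longrightarrow> fps_nth (weight_series \<alpha> m) 0 = 1"
  by (simp add: weight_series_def stable_msets_0 weight_def power_sum_def)

text \<open>
For \<open>n \<ge> 2\<close> the sum of the roots is minus the coefficient of \<open>X ^ (n - 1)\<close>, which is independent of
the constant term. Summing \<open>\<psi>\<close> over this coefficient gives \<open>0\<close>.
\<close>
lemma weight_series_linear:
  assumes \<alpha>: "\<alpha> \<in> mult_chars K"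
  shows "weight_series \<alpha> 1 = elem_sym_fps {#gauss_sum K \<psi> \<alpha>#}"
proof (rule fps_ext)
  fix n :: nat
  consider "n = 0" | "n = 1" | "n \<ge> 2" by linarith
  thus "fps_nth (weight_series \<alpha> 1) n = fps_nth (elem_sym_fps {#gauss_sum K \<psi> \<alpha>#}) n"
  proof cases
    case 2
    have "fps_nth (weight_series \<alpha> 1) 1 = (\<Sum>x\<in>K. \<alpha> x * \<psi> x)"
      unfolding weight_series_def fps_nth_Abs_fps stable_msets_1
      by (subst sum.reindex) (auto simp: inj_on_def weight_def power_sum_def)
    also have "\<dots> = - gauss_sum K \<psi> \<alpha>"
      using \<alpha> by (subst sum.remove[of K 0]) (auto simp: gauss_sum_def)
    finally show ?thesis using 2 by (simp add: elem_sym_fps_def)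
  next
    case 3
    have "fps_nth (weight_series \<alpha> 1) n = (\<Sum>f | f \<in> monic_polys n \<and> Polynomial.coeff f (n - 1) = 0.
      \<Sum>a\<in>K. weight \<alpha> 1 (proots (f + Polynomial.monom a (n - 1))))"
      unfolding weight_series_def fps_nth_Abs_fps by (rule sum_stable_msets_split) (use 3 in auto)
    also have "\<dots> = (\<Sum>f | f \<in> monic_polys n \<and> Polynomial.coeff f (n - 1) = 0. 0)"
    proof (rule sum.cong[OF refl])
      fix f assume "f \<in> {f \<in> monic_polys n. Polynomial.coeff f (n - 1) = 0}"
      hence f: "f \<in> monic_polys n" by simp
      have pK: "power_sum (proots f) 1 \<in> K" using proots_monic(3)[OF f] by (rule power_sum_stable_in_K)
      have "(\<Sum>a\<in>K. weight \<alpha> 1 (proots (f + Polynomial.monom a (n - 1)))) =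
        (\<Sum>a\<in>K. \<alpha> ((-1) ^ n * Polynomial.coeff f 0) * \<psi> (power_sum (proots f) 1) * \<psi> ((-1) * a))"
      proof (rule sum.cong[OF refl])
        fix a assume a: "a \<in> K"
        have g: "f + Polynomial.monom a (n - 1) \<in> monic_polys n"
          using monic_polys_add_monom[OF f a, of "n - 1"] 3 by simp
        have "power_sum (proots (f + Polynomial.monom a (n - 1))) 1 = power_sum (proots f) 1 - of_nat 1 * a"
          by (rule power_sum_proots_perturb[OF f g]) (use 3 in auto)
        moreover have "\<Prod>\<^sub># (proots (f + Polynomial.monom a (n - 1))) = (-1) ^ n * Polynomial.coeff f 0"
          using prod_proots[OF g] 3 by simp
        ultimately show "weight \<alpha> 1 (proots (f + Polynomial.monom a (n - 1))) =
          \<alpha> ((-1) ^ n * Polynomial.coeff f 0) * \<psi> (power_sum (proots f) 1) * \<psi> ((-1) * a)"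
          using 3 a pK by (simp add: weight_def psi_diff psi_minus divide_inverse)
      qed
      also have "\<dots> = 0"
        unfolding sum_distrib_left[symmetric] by (subst sum_psi_mult) auto
      finally show "(\<Sum>a\<in>K. weight \<alpha> 1 (proots (f + Polynomial.monom a (n - 1)))) = 0" .
    qed
    finally show ?thesis using 3 by (auto simp: elem_sym_fps_def)
  qed (use \<alpha> in simp)
qed

text \<open>
  The lifting relation: the two logarithmic derivatives of the series \<open>1 - g t\<close>, one from points of
  the extensions and one from its single root, have the same coefficients.
\<close>
theorem davenport_hasse_lifting:
  assumes \<alpha>: "\<alpha> \<in> mult_chars K" and s: "s > 0"
  shows "(\<Sum>x\<in>E s. \<alpha> (frob_norm Q s x) * \<psi> (frob_trace Q s x)) = - (gauss_sum K \<psi> \<alpha> ^ s)"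
proof -
  let ?W = "weight_series \<alpha> 1"
  have "?W * point_series \<alpha> 1 = - (?W * power_sum_fps {#gauss_sum K \<psi> \<alpha>#})"
    using weight_series_deriv[OF \<alpha>, of 1] newton_fps[of "{#gauss_sum K \<psi> \<alpha>#}"]
    unfolding weight_series_linear[OF \<alpha>] by simp
  hence "?W * point_series \<alpha> 1 = ?W * - power_sum_fps {#gauss_sum K \<psi> \<alpha>#}" by simp
  moreover have "?W \<noteq> 0" using weight_series_0[OF \<alpha>, of 1] by auto
  ultimately have "point_series \<alpha> 1 = - power_sum_fps {#gauss_sum K \<psi> \<alpha>#}"
    using mult_left_cancel by blast
  hence "fps_nth (point_series \<alpha> 1) s = fps_nth (- power_sum_fps {#gauss_sum K \<psi> \<alpha>#}) s" by simp
  thus ?thesis using s by (simp add: point_series_def power_sum_fps_def power_sum_def)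
qed

lemma frob_norm_in_K: "x \<in> E s \<Longrightarrow> frob_norm Q s x \<in> K"
  using prod_mset_stable_in_K[OF frob_stable_orbit, of x s] by (simp add: prod_frob_orbit)

end

text \<open>
These are the characters of exact order \<open>m\<close>, for \<open>m\<close> dividing \<open>Q - 1\<close>. This form of the condition passes to
extensions without a choice of generators.
\<close>
definition (in finite_subfield) power_residue_char :: "nat \<Rightarrow> ('b \<Rightarrow> qbar) \<Rightarrow> bool" where
  "power_residue_char m \<rho> \<longleftrightarrow>
     \<rho> \<in> mult_chars K \<and> (\<forall>x\<in>K - {0}. \<rho> x = 1 \<longleftrightarrow> x ^ ((Q - 1) div m) = 1)"

text \<open>
  A character of order \<open>m\<close>, pulled back by the norm, detects the \<open>m\<close>-th powers in every extension.
\<close>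
lemma (in finite_subfield) card_mth_roots:
  assumes \<rho>: "power_residue_char m \<rho>"
    and m: "m > 0" "m dvd Q - 1" and s: "s > 0" and x: "x \<in> E s" "x \<noteq> 0"
    and N: "frob_norm Q s x \<in> K"
  shows "of_nat (card {y \<in> E s. y ^ m = x}) = (\<Sum>j<m. \<rho> (frob_norm Q s x) ^ j)"
proof -
  let ?N = "frob_norm Q s x"
  have \<rho>1: "\<rho> \<in> mult_chars K" using \<rho> by (simp add: power_residue_char_def)
  have \<rho>2: "\<rho> z = 1 \<longleftrightarrow> z ^ ((Q - 1) div m) = 1" if "z \<in> K - {0}" for z
    using \<rho> that by (simp add: power_residue_char_def)
  have N0: "?N \<in> K - {0}" using N x s Q_gt_1 by (simp add: frob_norm_eq_0_iff)
  have ext: "finite_subfield (Q ^ s) (E s)" by (rule extension[OF s])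
  have crit: "\<rho> ?N = 1 \<longleftrightarrow> x ^ ((Q ^ s - 1) div m) = 1"
    using \<rho>2[OF N0] frob_norm_as_power(1)[OF Q_gt_1 m(2), of s x] by simp
  have y: "y \<in> E s \<longleftrightarrow> x ^ ((Q ^ s - 1) div m) = 1" if "y ^ m = x" for y
  proof -
    have "y \<noteq> 0" using that x m by (auto simp: power_0_left)
    hence "y \<in> E s \<longleftrightarrow> y ^ (Q ^ s - 1) = 1"
      using finite_subfield.K_units_eq[OF ext] by auto
    also have "y ^ (Q ^ s - 1) = (y ^ m) ^ ((Q ^ s - 1) div m)"
      using frob_norm_as_power(2)[OF Q_gt_1 m(2), of s] by (simp add: power_mult[symmetric])
    finally show ?thesis using that by simp
  qed
  show ?thesis
  proof (cases "\<rho> ?N = 1")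
    case True
    hence "{y \<in> E s. y ^ m = x} = {y. y ^ m = x}" using y crit by auto
    thus ?thesis using True card_roots_of_power(1)[of m x] of_nat_dvd_nonzero[OF m(2)] x by simp
  next
    case False
    hence e: "{y \<in> E s. y ^ m = x} = {}" using y crit by auto
    have "\<rho> ?N ^ m = 1"
    proof -
      have "(?N ^ m) ^ ((Q - 1) div m) = 1"
        using m(2) N0 K_units_eq by (auto simp: power_mult[symmetric])
      hence "\<rho> (?N ^ m) = 1" using \<rho>2[of "?N ^ m"] N0 by (auto simp: K_power)
      thus ?thesis using char_power[OF \<rho>1] N0 by simp
    qed
    hence "(\<rho> ?N - 1) * (\<Sum>j<m. \<rho> ?N ^ j) = 0" by (simp add: power_diff_1_eq[symmetric])
    thus ?thesis using False unfolding e by simp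
  qed
qed

lemma elem_sym_fps_top: "fps_nth (elem_sym_fps M) (size M) = (-1) ^ size M * \<Prod>\<^sub># M"
  using coeff_mset_poly[of "size M" M] coeff_0_mset_poly[of M] by simp

context finite_subfield_add_char
begin

lemma char_twist_in: "\<alpha> \<in> mult_chars K \<Longrightarrow> \<rho> \<in> mult_chars K \<Longrightarrow> (\<lambda>x. \<alpha> x * \<rho> x ^ j) \<in> mult_chars K"
  by (auto simp: mult_chars_def power_mult_distrib)

text \<open>
In the sum over the points \<open>y\<close> of an extension the summand depends only on \<open>y ^ m\<close>. Collecting the
\<open>m\<close>-th roots of each \<open>x\<close> by \<open>card_mth_roots\<close> gives the sums for the characters \<open>\<alpha> * \<rho> ^ j\<close>, which the lifting relation
identifies as powers of Gauss sums.
\<close>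
lemma weight_series_m:
  assumes \<alpha>: "\<alpha> \<in> mult_chars K"
    and \<rho>: "power_residue_char m \<rho>"
    and m: "m > 0" "m dvd Q - 1"
  shows "weight_series (\<lambda>x. \<alpha> x ^ m) m =
    elem_sym_fps (image_mset (\<lambda>j. gauss_sum K \<psi> (\<lambda>x. \<alpha> x * \<rho> x ^ j)) (mset_set {..<m}))"
    (is "?W = elem_sym_fps ?M")
proof (rule log_deriv_unique)
  have \<rho>1: "\<rho> \<in> mult_chars K" using \<rho> by (simp add: power_residue_char_def)
  have \<alpha>m: "(\<lambda>x. \<alpha> x ^ m) \<in> mult_chars K" using m(1) \<alpha> by (rule char_power_in')
  show "fps_X * fps_deriv ?W = ?W * point_series (\<lambda>x. \<alpha> x ^ m) m" by (rule weight_series_deriv[OF \<alpha>m])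
  show "fps_nth ?W 0 = fps_nth (elem_sym_fps ?M) 0" using weight_series_0[OF \<alpha>m] by simp
  show "fps_nth (point_series (\<lambda>x. \<alpha> x ^ m) m) 0 = 0" by (simp add: point_series_def)
  have "point_series (\<lambda>x. \<alpha> x ^ m) m = - power_sum_fps ?M"
  proof (rule fps_ext)
    fix s
    show "fps_nth (point_series (\<lambda>x. \<alpha> x ^ m) m) s = fps_nth (- power_sum_fps ?M) s"
    proof (cases "s = 0")
      case False
      hence s: "s > 0" by simp
      define H where "H x = \<alpha> (frob_norm Q s x) * \<psi> (frob_trace Q s x)" for x
      have fin: "finite (E s)" by (rule finite_E[OF s])
      have "fps_nth (point_series (\<lambda>x. \<alpha> x ^ m) m) s = (\<Sum>y\<in>E s. H (y ^ m))"
        using False \<alpha> by (auto simp: point_series_def H_def frob_norm_power char_power frob_norm_in_K intro!: sum.cong)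
      also have "\<dots> = (\<Sum>x\<in>E s. \<Sum>y | y \<in> E s \<and> y ^ m = x. H (y ^ m))"
        by (rule sum.group[symmetric, OF fin fin])
           (auto simp: power_mult[symmetric], metis mult.commute power_mult)
      also have "\<dots> = (\<Sum>x\<in>E s. of_nat (card {y \<in> E s. y ^ m = x}) * H x)"
        by (intro sum.cong refl) simp
      also have "\<dots> = (\<Sum>x\<in>E s. \<Sum>j<m. \<alpha> (frob_norm Q s x) * \<rho> (frob_norm Q s x) ^ j * \<psi> (frob_trace Q s x))"
      proof (rule sum.cong[OF refl])
        fix x assume x: "x \<in> E s"
        show "of_nat (card {y \<in> E s. y ^ m = x}) * H x =
          (\<Sum>j<m. \<alpha> (frob_norm Q s x) * \<rho> (frob_norm Q s x) ^ j * \<psi> (frob_trace Q s x))"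
        proof (cases "x = 0")
          case True
          thus ?thesis using \<alpha> s Q_gt_1 frob_norm_eq_0_iff[of s Q x] by (simp add: H_def)
        next
          case False
          show ?thesis
            unfolding card_mth_roots[OF \<rho> m s x False frob_norm_in_K[OF x]] H_def sum_distrib_right
            by (intro sum.cong refl) (simp add: mult_ac)
        qed
      qed
      also have "\<dots> = (\<Sum>j<m. \<Sum>x\<in>E s. \<alpha> (frob_norm Q s x) * \<rho> (frob_norm Q s x) ^ j * \<psi> (frob_trace Q s x))"
        by (rule sum.swap)
      also have "\<dots> = (\<Sum>j<m. - (gauss_sum K \<psi> (\<lambda>x. \<alpha> x * \<rho> x ^ j) ^ s))"
        by (intro sum.cong refl davenport_hasse_lifting[OF char_twist_in[OF \<alpha> \<rho>1] s])
      also have "\<dots> = fps_nth (- power_sum_fps ?M) s"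
        using False by (simp add: power_sum_fps_def power_sum_def sum_negf multiset.map_comp comp_def sum_unfold_sum_mset)
      finally show ?thesis .
    qed (simp add: point_series_def power_sum_fps_def)
  qed
  thus "fps_X * fps_deriv (elem_sym_fps ?M) = elem_sym_fps ?M * point_series (\<lambda>x. \<alpha> x ^ m) m"
    by (simp add: newton_fps)
qed

text \<open>
The factor that remains when the constant term is split off. What matters is that it does not involve
the multiplicative character.
\<close>
definition power_sum_total :: "nat \<Rightarrow> qbar" where
  "power_sum_total m = (\<Sum>f | f \<in> monic_polys m \<and> Polynomial.coeff f 0 = 0. \<psi> (power_sum (proots f) m))"

text \<open>
Only the constant term \<open>a\<close> of a polynomial of degree \<open>m\<close> enters the multiplicative character, and it
enters the \<open>m\<close>-th power sum of the roots as \<open>- m * a\<close>. So the sum over \<open>a\<close> is a Gauss sum of \<open>\<alpha> ^ m\<close>.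
\<close>
lemma weight_series_top:
  assumes \<alpha>: "\<alpha> \<in> mult_chars K" and m: "m > 0" "m dvd Q - 1"
  shows "fps_nth (weight_series (\<lambda>x. \<alpha> x ^ m) m) m =
    - (power_sum_total m * gauss_sum K \<psi> (\<lambda>x. \<alpha> x ^ m) / \<alpha> (of_nat m) ^ m)"
proof -
  have \<alpha>m: "(\<lambda>x. \<alpha> x ^ m) \<in> mult_chars K" using m(1) \<alpha> by (rule char_power_in')
  have mK: "- of_nat m \<in> K - {0}" using of_nat_dvd_nonzero[OF m(2)] by simp
  define c where "c = \<alpha> ((-1) ^ m) ^ m"
  have "fps_nth (weight_series (\<lambda>x. \<alpha> x ^ m) m) m =
      (\<Sum>f | f \<in> monic_polys m \<and> Polynomial.coeff f (m - m) = 0.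
        \<Sum>a\<in>K. weight (\<lambda>x. \<alpha> x ^ m) m (proots (f + Polynomial.monom a (m - m))))"
    unfolding weight_series_def fps_nth_Abs_fps by (rule sum_stable_msets_split) (use m in auto)
  also have "\<dots> = (\<Sum>f | f \<in> monic_polys m \<and> Polynomial.coeff f 0 = 0.
      \<psi> (power_sum (proots f) m) * (c * (\<Sum>a\<in>K. \<alpha> a ^ m * \<psi> (- of_nat m * a))))"
  proof (rule sum.cong)
    fix f assume "f \<in> {f \<in> monic_polys m. Polynomial.coeff f 0 = 0}"
    hence f: "f \<in> monic_polys m" "Polynomial.coeff f 0 = 0" by auto
    have pK: "power_sum (proots f) m \<in> K" using proots_monic(3)[OF f(1)] by (rule power_sum_stable_in_K)
    show "(\<Sum>a\<in>K. weight (\<lambda>x. \<alpha> x ^ m) m (proots (f + Polynomial.monom a (m - m)))) =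
      \<psi> (power_sum (proots f) m) * (c * (\<Sum>a\<in>K. \<alpha> a ^ m * \<psi> (- of_nat m * a)))"
      unfolding sum_distrib_left
    proof (rule sum.cong[OF refl])
      fix a assume a: "a \<in> K"
      have g: "f + Polynomial.monom a (m - m) \<in> monic_polys m"
        using monic_polys_add_monom[OF f(1) a, of "m - m"] m by simp
      have "power_sum (proots (f + Polynomial.monom a (m - m))) m = power_sum (proots f) m - of_nat m * a"
        by (rule power_sum_proots_perturb[OF f(1) g]) (use m in auto)
      also have "\<psi> \<dots> = \<psi> (power_sum (proots f) m) * \<psi> (- of_nat m * a)"
        using psi_add[OF pK, of "- of_nat m * a"] a by auto
      finally have "\<psi> (power_sum (proots (f + Polynomial.monom a (m - m))) m) =
        \<psi> (power_sum (proots f) m) * \<psi> (- of_nat m * a)" .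
      moreover have "\<Prod>\<^sub># (proots (f + Polynomial.monom a (m - m))) = (-1) ^ m * a"
        using prod_proots[OF g] f by simp
      moreover have "\<alpha> ((-1) ^ m * a) = \<alpha> ((-1) ^ m) * \<alpha> a"
        by (rule char_mult[OF \<alpha>]) (use a in \<open>auto intro!: K_power\<close>)
      ultimately show "weight (\<lambda>x. \<alpha> x ^ m) m (proots (f + Polynomial.monom a (m - m))) =
        \<psi> (power_sum (proots f) m) * (c * (\<alpha> a ^ m * \<psi> (- of_nat m * a)))"
        unfolding weight_def c_def by (simp add: power_mult_distrib)
    qed
  qed simp
  also have "\<dots> = power_sum_total m * (c * (\<Sum>a\<in>K. \<alpha> a ^ m * \<psi> (- of_nat m * a)))"
    by (simp add: power_sum_total_def sum_distrib_right)
  also have "(\<Sum>a\<in>K. \<alpha> a ^ m * \<psi> (- of_nat m * a)) = (\<Sum>a\<in>K - {0}. \<alpha> a ^ m * \<psi> (- of_nat m * a))"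
    using m \<alpha> by (subst sum.remove[of K 0]) (auto simp: power_0_left)
  also have "\<dots> = - (gauss_sum K \<psi> (\<lambda>x. \<alpha> x ^ m) / \<alpha> (- of_nat m) ^ m)"
    by (rule gauss_twist[OF \<alpha>m mK])
  also have "\<alpha> (- of_nat m) = \<alpha> (-1) * \<alpha> (of_nat m)"
    using char_mult[OF \<alpha>, of "-1" "of_nat m"] by simp
  finally have "fps_nth (weight_series (\<lambda>x. \<alpha> x ^ m) m) m =
    - (power_sum_total m * gauss_sum K \<psi> (\<lambda>x. \<alpha> x ^ m) / \<alpha> (of_nat m) ^ m) * (c / \<alpha> (-1) ^ m)"
    by (simp add: power_mult_distrib mult_ac)
  moreover have "c / \<alpha> (-1) ^ m = 1"
  proof -
    \<comment> \<open>the signs drop out because \<open>m * m\<close> and \<open>m\<close> have the same parity\<close>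
    have sq: "\<alpha> (-1) ^ 2 = 1" using char_m1_square[OF \<alpha>] by (simp add: power2_eq_square)
    have ev: "\<alpha> (-1) ^ (2 * j) = 1" for j by (simp only: power_mult sq power_one)
    have nz: "\<alpha> (-1) \<noteq> 0" using \<alpha> by (simp add: char_zero_iff)
    have "c = \<alpha> (-1) ^ (m * m)" unfolding c_def using \<alpha> by (subst char_power) (auto simp: power_mult)
    also have "\<dots> = \<alpha> (-1) ^ m"
    proof (cases "even m")
      case True
      then obtain k where k: "m = 2 * k" by (elim evenE)
      have "m * m = 2 * (k * m)" using k by simp
      thus ?thesis using ev[of k] ev[of "k * m"] k by simp
    next
      case False
      then obtain k where k: "m = 2 * k + 1" by (elim oddE)
      have "m * m = 2 * (2 * k * k + k) + m" using k by (simp add: algebra_simps)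
      thus ?thesis using ev[of "2 * k * k + k"] by (simp add: power_add)
    qed
    finally show ?thesis using nz by simp
  qed
  ultimately show ?thesis by simp
qed

text \<open>
The top coefficient of \<open>weight_series_m\<close> is compared with \<open>weight_series_top\<close>, once for \<open>\<alpha>\<close> and once for the
trivial character; the quotient of the two equations is free of \<open>power_sum_total\<close>.
\<close>
theorem davenport_hasse_multiplication:
  assumes \<alpha>: "\<alpha> \<in> mult_chars K"
    and \<rho>: "power_residue_char m \<rho>"
    and m: "m > 0" "m dvd Q - 1"
  shows "(\<Prod>j<m. gauss_sum K \<psi> (\<lambda>x. \<alpha> x * \<rho> x ^ j)) * \<alpha> (of_nat m) ^ m =
    gauss_sum K \<psi> (\<lambda>x. \<alpha> x ^ m) * (\<Prod>j<m. gauss_sum K \<psi> (\<lambda>x. trivial_char K x * \<rho> x ^ j))"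
proof -
  have top: "(-1) ^ m * (\<Prod>j<m. gauss_sum K \<psi> (\<lambda>x. \<beta> x * \<rho> x ^ j)) =
      - (power_sum_total m * gauss_sum K \<psi> (\<lambda>x. \<beta> x ^ m) / \<beta> (of_nat m) ^ m)"
    if \<beta>: "\<beta> \<in> mult_chars K" for \<beta>
    using weight_series_top[OF \<beta> m] unfolding weight_series_m[OF \<beta> \<rho> m]
    using elem_sym_fps_top[of "image_mset (\<lambda>j. gauss_sum K \<psi> (\<lambda>x. \<beta> x * \<rho> x ^ j)) (mset_set {..<m})"]
    by (simp add: prod_unfold_prod_mset)
  have mK: "of_nat m \<in> K - {0}" using of_nat_dvd_nonzero[OF m(2)] by simp
  have nz: "\<alpha> (of_nat m) \<noteq> 0" using mK \<alpha> by (simp add: char_zero_iff)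
  have t: "(\<lambda>x. trivial_char K x ^ m) = trivial_char K" "trivial_char K (of_nat m) = 1"
    using m(1) mK by (auto simp: trivial_char_def power_0_left)
  let ?P = "\<Prod>j<m. gauss_sum K \<psi> (\<lambda>x. trivial_char K x * \<rho> x ^ j)"
  have "(-1) ^ m * ?P = - power_sum_total m"
    using top[OF trivial_char_K] by (simp add: t gauss_trivial)
  hence C: "power_sum_total m = - ((-1) ^ m * ?P)" by simp
  have "(-1) ^ m * ((\<Prod>j<m. gauss_sum K \<psi> (\<lambda>x. \<alpha> x * \<rho> x ^ j)) * \<alpha> (of_nat m) ^ m) =
    (-1) ^ m * (gauss_sum K \<psi> (\<lambda>x. \<alpha> x ^ m) * ?P)"
    using top[OF \<alpha>] nz unfolding C by (simp add: field_simps)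
  thus ?thesis by simp
qed

end

section \<open>Evaluation of the hypergeometric terms\<close>

context finite_subfield
begin

text \<open>
The case distinction makes the exponent \<open>0\<close> yield the trivial character, which is \<open>0\<close> at \<open>0\<close>, in agreement
with the powers in \<open>char_group\<close>.
\<close>
definition char_pow :: "('b \<Rightarrow> qbar) \<Rightarrow> nat \<Rightarrow> 'b \<Rightarrow> qbar" where
  "char_pow \<eta> n = (\<lambda>x. if x \<in> K - {0} then \<eta> x ^ n else 0)"

lemma char_pow_in [simp]: "\<eta> \<in> mult_chars K \<Longrightarrow> char_pow \<eta> n \<in> mult_chars K"
  unfolding char_pow_def by (rule char_power_in)

lemma char_group_pow_eq: "\<eta> \<in> mult_chars K \<Longrightarrow> \<eta> [^]\<^bsub>char_group K\<^esub> n = char_pow \<eta> n"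
  unfolding char_pow_def by (rule char_group_nat_pow)

lemma char_pow_trivial_iff:
  "\<eta> \<in> mult_chars K \<Longrightarrow> char_pow \<eta> n = trivial_char K \<longleftrightarrow> (\<forall>x\<in>K - {0}. \<eta> x ^ n = 1)"
  by (auto simp: char_pow_def trivial_char_def fun_eq_iff)

lemma power_residue_char_in: "power_residue_char m \<rho> \<Longrightarrow> \<rho> \<in> mult_chars K"
  by (simp add: power_residue_char_def)

lemma residue_char_pow_trivial:
  assumes \<rho>: "power_residue_char m \<rho>" and m: "m > 0" "m dvd Q - 1"
  shows "char_pow \<rho> i = trivial_char K \<longleftrightarrow> m dvd i"
proof -
  have \<rho>1: "\<rho> \<in> mult_chars K" using \<rho> by (rule power_residue_char_in)
  have *: "\<rho> x ^ i = 1 \<longleftrightarrow> x ^ (i * ((Q - 1) div m)) = 1" if "x \<in> K - {0}" for x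
  proof -
    have "\<rho> x ^ i = \<rho> (x ^ i)" using that \<rho>1 by (simp add: char_power)
    also have "\<dots> = 1 \<longleftrightarrow> (x ^ i) ^ ((Q - 1) div m) = 1"
      using \<rho> that by (auto simp: power_residue_char_def K_power)
    finally show ?thesis by (simp add: power_mult)
  qed
  show ?thesis
  proof
    assume triv: "char_pow \<rho> i = trivial_char K"
    obtain g where g: "g \<in> K - {0}" "K - {0} = (\<lambda>i. g ^ i) ` {..<Q - 1}" "inj_on (\<lambda>i. g ^ i) {..<Q - 1}"
      using ex_generator by blast
    let ?e = "i * ((Q - 1) div m)"
    have gQ: "g ^ (Q - 1) = 1" using g(1) K_units_eq by auto
    have "g ^ ?e = 1" using triv * g(1) by (simp add: char_pow_trivial_iff[OF \<rho>1])
    moreover have "g ^ ?e = g ^ (?e mod (Q - 1))"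
      by (metis gQ mult_div_mod_eq mult_1 power_add power_mult power_one)
    ultimately have "?e mod (Q - 1) = 0"
      using inj_onD[OF g(3), of "?e mod (Q - 1)" 0] Q_gt_1 by simp
    hence "(Q - 1) dvd ?e" by auto
    moreover obtain k where k: "Q - 1 = m * k" using m(2) by (elim dvdE)
    moreover have "k > 0" using k Q_gt_1 by (cases k) auto
    ultimately show "m dvd i" using m(1) by simp
  next
    assume "m dvd i"
    then obtain k where k: "i = m * k" by (elim dvdE)
    have "x ^ (i * ((Q - 1) div m)) = 1" if "x \<in> K - {0}" for x
    proof -
      have "i * ((Q - 1) div m) = (Q - 1) * k" using k m by simp
      thus ?thesis using that K_units_eq by (auto simp: power_mult)
    qed
    thus "char_pow \<rho> i = trivial_char K" using * by (simp add: char_pow_trivial_iff[OF \<rho>1])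
  qed
qed

lemma residue_char_pow_eq_iff:
  assumes \<rho>: "power_residue_char m \<rho>" and m: "m > 0" "m dvd Q - 1"
  shows "char_pow \<rho> i = char_pow \<rho> j \<longleftrightarrow> i mod m = j mod m"
proof -
  have \<rho>1: "\<rho> \<in> mult_chars K" using \<rho> by (rule power_residue_char_in)
  have *: "char_pow \<rho> i = char_pow \<rho> j \<longleftrightarrow> i mod m = j mod m" if "i \<le> j" for i j
  proof -
    have "char_pow \<rho> i = char_pow \<rho> j \<longleftrightarrow> char_pow \<rho> (j - i) = trivial_char K"
    proof -
      have "\<rho> x ^ i = \<rho> x ^ j \<longleftrightarrow> \<rho> x ^ (j - i) = 1" if x: "x \<in> K - {0}" for x
      proof -
        have "\<rho> x \<noteq> 0" using x \<rho>1 by (simp add: char_zero_iff)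
        moreover have "\<rho> x ^ j = \<rho> x ^ i * \<rho> x ^ (j - i)" using \<open>i \<le> j\<close> by (simp flip: power_add)
        ultimately show ?thesis by (metis mult_cancel_left2 mult_cancel_left1 power_not_zero)
      qed
      hence "(\<forall>x\<in>K - {0}. \<rho> x ^ i = \<rho> x ^ j) \<longleftrightarrow> char_pow \<rho> (j - i) = trivial_char K"
        unfolding char_pow_trivial_iff[OF \<rho>1] by blast
      moreover have "(\<forall>x\<in>K - {0}. \<rho> x ^ i = \<rho> x ^ j) \<longleftrightarrow> char_pow \<rho> i = char_pow \<rho> j"
        unfolding char_pow_def fun_eq_iff by metis
      ultimately show ?thesis by blast
    qed
    also have "\<dots> \<longleftrightarrow> m dvd j - i" by (rule residue_char_pow_trivial[OF \<rho> m])
    also have "\<dots> \<longleftrightarrow> i mod m = j mod m" using that by (metis mod_eq_dvd_iff_nat)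
    finally show ?thesis .
  qed
  show ?thesis using *[of i j] *[of j i] by (metis linear)
qed

text \<open>
The powers of \<open>\<theta>\<close> are \<open>d\<close> different characters \<open>\<nu>\<close> with trivial \<open>\<nu> ^ d\<close>. Because the group of units is cyclic,
there are no others.
\<close>
lemma card_torsion_shift:
  assumes \<theta>: "power_residue_char d \<theta>" and d: "d > 0" "d dvd Q - 1" and \<nu>: "\<nu> \<in> mult_chars K"
  shows "card {j. j < d \<and> (\<lambda>x. char_pow \<theta> j x * \<nu> x) = trivial_char K} = (if (\<lambda>x. \<nu> x ^ d) = trivial_char K then 1 else 0)"
proof -
  have \<theta>1: "\<theta> \<in> mult_chars K" using \<theta> by (rule power_residue_char_in)
  define T where "T = {\<nu> \<in> mult_chars K. (\<lambda>x. \<nu> x ^ d) = trivial_char K}"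
  have tw: "\<theta> x ^ d = 1" if "x \<in> K - {0}" for x
    using residue_char_pow_trivial[OF \<theta> d, of d] that by (simp add: char_pow_trivial_iff[OF \<theta>1])
  have inj: "inj_on (\<lambda>j. char_pow \<theta> j) {..<d}"
    by (rule inj_onI) (simp add: residue_char_pow_eq_iff[OF \<theta> d])
  have sub: "(\<lambda>j. char_pow \<theta> j) ` {..<d} \<subseteq> T"
  proof (clarsimp simp: T_def \<theta>1)
    fix j
    have "(\<theta> x ^ j) ^ d = 1" if "x \<in> K - {0}" for x
      using tw[OF that] by (metis power_mult mult.commute power_one)
    thus "(\<lambda>x. char_pow \<theta> j x ^ d) = trivial_char K"
      using d by (auto simp: char_pow_def trivial_char_def power_0_left fun_eq_iff)
  qed
  have "finite T" by (simp add: T_def)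
  moreover have "card T \<le> card ((\<lambda>j. char_pow \<theta> j) ` {..<d})"
    unfolding card_image[OF inj] using card_char_torsion[OF d(1)] by (simp add: T_def)
  ultimately have T: "(\<lambda>j. char_pow \<theta> j) ` {..<d} = T" using sub card_seteq by blast
  have inv: "(\<lambda>x. char_pow \<theta> j x * \<nu> x) = trivial_char K \<longleftrightarrow> char_pow \<theta> j = (\<lambda>x. inverse (\<nu> x))" for j
  proof -
    have nz: "x \<in> K - {0} \<Longrightarrow> \<nu> x \<noteq> 0" for x using \<nu> by (simp add: char_zero_iff)
    have z: "x \<notin> K - {0} \<Longrightarrow> \<nu> x = 0" for x using \<nu> char_zero_iff by blast
    show ?thesis
    proof
      assume *: "(\<lambda>x. char_pow \<theta> j x * \<nu> x) = trivial_char K"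
      show "char_pow \<theta> j = (\<lambda>x. inverse (\<nu> x))"
      proof
        fix x show "char_pow \<theta> j x = inverse (\<nu> x)"
          using fun_cong[OF *, of x] nz[of x] z[of x]
          by (cases "x \<in> K - {0}") (auto simp: trivial_char_def char_pow_def field_simps)
      qed
    next
      assume *: "char_pow \<theta> j = (\<lambda>x. inverse (\<nu> x))"
      show "(\<lambda>x. char_pow \<theta> j x * \<nu> x) = trivial_char K"
      proof
        fix x show "char_pow \<theta> j x * \<nu> x = trivial_char K x"
          unfolding * using nz[of x] z[of x] by (cases "x \<in> K - {0}") (auto simp: trivial_char_def)
      qed
    qed
  qed
  show ?thesis
  proof (cases "(\<lambda>x. \<nu> x ^ d) = trivial_char K")
    case True
    have "(\<lambda>x. inverse (\<nu> x)) \<in> T"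
      unfolding T_def mem_Collect_eq
    proof
      show "(\<lambda>x. inverse (\<nu> x) ^ d) = trivial_char K"
      proof
        fix x show "inverse (\<nu> x) ^ d = trivial_char K x"
          using fun_cong[OF True, of x] by (simp add: power_inverse trivial_char_def split: if_splits)
      qed
    qed (rule mult_chars_inverse[OF \<nu>])
    hence "(\<lambda>x. inverse (\<nu> x)) \<in> (\<lambda>j. char_pow \<theta> j) ` {..<d}" unfolding T .
    then obtain j where j: "j < d" "(\<lambda>x. inverse (\<nu> x)) = char_pow \<theta> j" by (auto elim!: imageE)
    have "{j. j < d \<and> (\<lambda>x. char_pow \<theta> j x * \<nu> x) = trivial_char K} = {j}"
      unfolding inv j(2) using j(1) inj by (auto simp: inj_on_def)
    thus ?thesis using True by simp
  next
    case False
    have "(\<lambda>x. inverse (\<nu> x)) \<notin> T"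
    proof
      assume "(\<lambda>x. inverse (\<nu> x)) \<in> T"
      hence *: "inverse (\<nu> x) ^ d = trivial_char K x" for x by (auto simp: T_def fun_eq_iff)
      have "\<nu> x ^ d = trivial_char K x" for x
        using *[of x] by (auto simp: power_inverse trivial_char_def split: if_splits)
      thus False using False by auto
    qed
    hence "{j. j < d \<and> (\<lambda>x. char_pow \<theta> j x * \<nu> x) = trivial_char K} = {}"
      unfolding inv T[symmetric] by (auto simp: image_iff) (metis lessThan_iff)
    thus ?thesis using False by (simp only: card.empty if_False)
  qed
qed

end

lemma prod_mset_sum:
  "finite A \<Longrightarrow> (\<Prod>x\<in>#(\<Sum>i\<in>A. M i). f x) = (\<Prod>i\<in>A. \<Prod>x\<in>#M i. f x :: 'c::comm_monoid_mult)"
  by (induction A rule: finite_induct) auto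

text \<open>
Over the field with \<open>Q = q ^ r\<close> elements, \<open>\<theta>\<close> stands for the lift of \<open>\<phi>\<^sub>d\<close> and \<open>\<rho> i\<close> for the lift of the character of
order \<open>d * h i\<close>.
\<close>
locale hypergeom_data = finite_subfield_add_char Q K \<psi>
  for Q :: nat and K :: "'b::alg_closed_field set" and \<psi> :: "'b \<Rightarrow> qbar" +
  fixes d :: nat and h w :: "'n::finite \<Rightarrow> nat" and \<theta> :: "'b \<Rightarrow> qbar" and \<rho> :: "'n \<Rightarrow> 'b \<Rightarrow> qbar"
  assumes d: "d > 0" "d dvd Q - 1"
    and h: "\<And>i. h i > 0" "\<And>i. d * h i dvd Q - 1" and sum_h: "(\<Sum>i\<in>UNIV. h i) = d"
    and gcd_h: "\<And>m. (\<And>i. d dvd m * h i) \<Longrightarrow> d dvd m"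
    and \<theta>: "power_residue_char d \<theta>" and \<rho>: "\<And>i. power_residue_char (d * h i) (\<rho> i)"
    and \<rho>_power: "\<And>i x. x \<in> K - {0} \<Longrightarrow> \<rho> i x ^ h i = \<theta> x"
    and sum_w: "d dvd (\<Sum>i\<in>UNIV. w i)"
begin

lemma \<theta>_in [simp]: "\<theta> \<in> mult_chars K" and \<rho>_in [simp]: "\<rho> i \<in> mult_chars K"
  using \<theta> \<rho> by (auto intro: power_residue_char_in)

definition \<eta> :: "'n \<Rightarrow> 'b \<Rightarrow> qbar" where "\<eta> i = char_pow \<theta> (w i)"

lemma \<eta>_in [simp]: "\<eta> i \<in> mult_chars K"
  by (simp add: \<eta>_def)

lemma \<theta>_pow_d: "x \<in> K - {0} \<Longrightarrow> \<theta> x ^ d = 1"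
  using residue_char_pow_trivial[OF \<theta> d, of d] by (simp add: char_pow_trivial_iff)

lemma prod_\<eta>: "x \<in> K - {0} \<Longrightarrow> (\<Prod>i\<in>UNIV. \<eta> i x) = 1"
proof -
  assume x: "x \<in> K - {0}"
  obtain k where k: "(\<Sum>i\<in>UNIV. w i) = d * k" using sum_w by (elim dvdE)
  have "(\<Prod>i\<in>UNIV. \<eta> i x) = \<theta> x ^ (\<Sum>i\<in>UNIV. w i)" using x by (simp add: \<eta>_def char_pow_def power_sum)
  thus ?thesis using \<theta>_pow_d[OF x] by (simp add: k power_mult)
qed

lemma upper_residue_char: "power_residue_char (h i) (char_pow (\<rho> i) d)"
  unfolding power_residue_char_def
proof (intro conjI ballI)
  fix x assume x: "x \<in> K - {0}"
  have "\<rho> i x ^ d = \<rho> i (x ^ d)" using x by (simp add: char_power)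
  also have "\<dots> = 1 \<longleftrightarrow> (x ^ d) ^ ((Q - 1) div (d * h i)) = 1"
    using \<rho>[of i] x by (auto simp: power_residue_char_def K_power)
  also have "(x ^ d) ^ ((Q - 1) div (d * h i)) = x ^ ((Q - 1) div h i)"
  proof -
    obtain k where "Q - 1 = d * h i * k" using h(2)[of i] by (elim dvdE)
    thus ?thesis using d(1) h(1)[of i] by (simp add: power_mult[symmetric])
  qed
  finally show "char_pow (\<rho> i) d x = 1 \<longleftrightarrow> x ^ ((Q - 1) div h i) = 1"
    using x by (simp add: char_pow_def)
qed simp

lemma upper_product:
  assumes \<nu>: "\<nu> \<in> mult_chars K"
  shows "(\<Prod>j<h i. poch K \<psi> (char_pow (\<rho> i) (w i + d * j)) \<nu>) * \<nu> (of_nat (h i)) ^ h i =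
    gauss_sum K \<psi> (\<lambda>x. \<eta> i x * \<nu> x ^ h i) / gauss_sum K \<psi> (\<eta> i)"
proof -
  define \<alpha> where "\<alpha> = char_pow (\<rho> i) (w i)"
  define \<sigma> where "\<sigma> = char_pow (\<rho> i) d"
  have \<alpha>: "\<alpha> \<in> mult_chars K" by (simp add: \<alpha>_def)
  have \<sigma>: "power_residue_char (h i) \<sigma>" unfolding \<sigma>_def by (rule upper_residue_char)
  have hd: "h i dvd Q - 1" using h(2)[of i] by (rule dvd_mult_right)
  define P where "P = (\<Prod>j<h i. gauss_sum K \<psi> (\<lambda>x. trivial_char K x * \<sigma> x ^ j))"
  have \<sigma>1: "\<sigma> \<in> mult_chars K" using \<sigma> by (rule power_residue_char_in)
  have P: "P \<noteq> 0" unfolding P_def using char_twist_in[OF trivial_char_K \<sigma>1] gauss_nonzero by simp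
  have hK: "of_nat (h i) \<in> K - {0}" using of_nat_dvd_nonzero[OF hd] by simp
  have \<alpha>\<nu>: "(\<lambda>x. \<alpha> x * \<nu> x) \<in> mult_chars K" using \<alpha> \<nu> by (rule mult_chars_mult)
  have \<alpha>h: "\<alpha> x ^ h i = \<eta> i x" for x
  proof (cases "x \<in> K - {0}")
    case True
    thus ?thesis using \<rho>_power[OF True, of i]
      by (simp add: \<alpha>_def \<eta>_def char_pow_def) (metis mult.commute power_mult)
  next
    case False thus ?thesis using h(1)[of i] by (auto simp: \<alpha>_def \<eta>_def char_pow_def)
  qed
  have e1: "(\<Prod>j<h i. gauss_sum K \<psi> (\<lambda>x. \<alpha> x * \<nu> x * \<sigma> x ^ j)) * (\<alpha> (of_nat (h i)) * \<nu> (of_nat (h i))) ^ h i =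
      gauss_sum K \<psi> (\<lambda>x. \<eta> i x * \<nu> x ^ h i) * P"
    using davenport_hasse_multiplication[OF \<alpha>\<nu> \<sigma> h(1) hd] by (simp add: P_def power_mult_distrib \<alpha>h)
  have e2: "(\<Prod>j<h i. gauss_sum K \<psi> (\<lambda>x. \<alpha> x * \<sigma> x ^ j)) * \<alpha> (of_nat (h i)) ^ h i = gauss_sum K \<psi> (\<eta> i) * P"
    using davenport_hasse_multiplication[OF \<alpha> \<sigma> h(1) hd] by (simp add: P_def \<alpha>h)
  have up: "char_pow (\<rho> i) (w i + d * j) = (\<lambda>x. \<alpha> x * \<sigma> x ^ j)" for j
    by (auto simp: char_pow_def \<alpha>_def \<sigma>_def fun_eq_iff power_add power_mult)
  have comm: "(\<lambda>x. \<alpha> x * \<sigma> x ^ j * \<nu> x) = (\<lambda>x. \<alpha> x * \<nu> x * \<sigma> x ^ j)" for j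
    by (simp add: mult_ac)
  have "(\<Prod>j<h i. poch K \<psi> (char_pow (\<rho> i) (w i + d * j)) \<nu>) =
      (\<Prod>j<h i. gauss_sum K \<psi> (\<lambda>x. \<alpha> x * \<nu> x * \<sigma> x ^ j)) / (\<Prod>j<h i. gauss_sum K \<psi> (\<lambda>x. \<alpha> x * \<sigma> x ^ j))"
    by (simp only: poch_def up char_group_simps prod_dividef comm)
  moreover have "(\<Prod>j<h i. gauss_sum K \<psi> (\<lambda>x. \<alpha> x * \<sigma> x ^ j)) \<noteq> 0"
    using char_twist_in[OF \<alpha> \<sigma>1] gauss_nonzero by simp
  moreover have "\<alpha> (of_nat (h i)) \<noteq> 0" using \<alpha> hK by (simp add: char_zero_iff)
  moreover have "gauss_sum K \<psi> (\<eta> i) \<noteq> 0" by (simp add: gauss_nonzero)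
  moreover have "x1 / x2 * \<nu>h = g1 / g2"
    if "x1 * (ah * \<nu>h) = g1 * P" "x2 * ah = g2 * P" "x2 \<noteq> 0" "ah \<noteq> 0" "g2 \<noteq> 0" for x1 x2 \<nu>h g1 g2 ah :: qbar
  proof -
    have "x1 * \<nu>h * g2 * (P * ah) = (x1 * (ah * \<nu>h)) * (g2 * P)" by (simp add: mult_ac)
    also have "\<dots> = g1 * x2 * (P * ah)" unfolding that(1) that(2)[symmetric] by (simp add: mult_ac)
    finally have "x1 * \<nu>h * g2 = g1 * x2" using P that by simp
    thus ?thesis using that by (simp add: field_simps)
  qed
  ultimately show ?thesis using e1 e2 by (simp add: power_mult_distrib)
qed

lemma \<nu>_power_in: "\<nu> \<in> mult_chars K \<Longrightarrow> (\<lambda>x. \<nu> x ^ d) \<in> mult_chars K"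
  by (rule char_power_in'[OF d(1)])

text \<open>
Exactly one of the \<open>d\<close> shifts of \<open>\<nu>\<close> is trivial if \<open>\<nu> ^ d\<close> is, and none otherwise. Therefore the
multiplication relation holds for \<open>gauss_sum_circ\<close> as well.
\<close>
lemma prod_gauss_circ:
  assumes \<nu>: "\<nu> \<in> mult_chars K"
  shows "(\<Prod>j<d. gauss_sum_circ K \<psi> (\<lambda>x. char_pow \<theta> j x * \<nu> x)) * \<nu> (of_nat d) ^ d =
    gauss_sum_circ K \<psi> (\<lambda>x. \<nu> x ^ d) * (\<Prod>j<d. gauss_sum K \<psi> (\<lambda>x. trivial_char K x * \<theta> x ^ j))"
proof -
  have eq: "(\<lambda>x. \<nu> x * \<theta> x ^ j) = (\<lambda>x. char_pow \<theta> j x * \<nu> x)" for j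
    using \<nu> char_zero_iff[OF \<nu>] by (auto simp: char_pow_def fun_eq_iff)
  have "(\<Prod>j<d. gauss_sum_circ K \<psi> (\<lambda>x. char_pow \<theta> j x * \<nu> x)) =
    (\<Prod>j<d. of_nat Q ^ (if (\<lambda>x. char_pow \<theta> j x * \<nu> x) = trivial_char K then 1 else 0)) *
    (\<Prod>j<d. gauss_sum K \<psi> (\<lambda>x. \<nu> x * \<theta> x ^ j))"
    by (simp only: gauss_sum_circ_def card_K prod.distrib eq)
  also have "(\<Prod>j<d. of_nat Q ^ (if (\<lambda>x. char_pow \<theta> j x * \<nu> x) = trivial_char K then 1 else 0)) =
    (of_nat Q :: qbar) ^ (\<Sum>j<d. if (\<lambda>x. char_pow \<theta> j x * \<nu> x) = trivial_char K then 1 else 0)"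
    by (rule power_sum[symmetric])
  also have "(\<Sum>j<d. if (\<lambda>x. char_pow \<theta> j x * \<nu> x) = trivial_char K then 1 else (0::nat)) =
    card {j. j < d \<and> (\<lambda>x. char_pow \<theta> j x * \<nu> x) = trivial_char K}"
    by (simp add: sum.If_cases Collect_conj_eq lessThan_def)
  also have "\<dots> = (if (\<lambda>x. \<nu> x ^ d) = trivial_char K then 1 else 0)"
    by (rule card_torsion_shift[OF \<theta> d \<nu>])
  finally show ?thesis
    using davenport_hasse_multiplication[OF \<nu> \<theta> d] by (simp only: gauss_sum_circ_def card_K mult.assoc)
qed

lemma lower_product:
  assumes \<nu>: "\<nu> \<in> mult_chars K"
  shows "(\<Prod>j<d. poch_circ K \<psi> (char_pow \<theta> j) \<nu>) * \<nu> (of_nat d) ^ d =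
    gauss_sum_circ K \<psi> (\<lambda>x. \<nu> x ^ d) / of_nat Q"
proof -
  define P where "P = (\<Prod>j<d. gauss_sum K \<psi> (\<lambda>x. trivial_char K x * \<theta> x ^ j))"
  have P: "P \<noteq> 0" unfolding P_def using char_twist_in[OF trivial_char_K \<theta>_in] gauss_nonzero by simp
  have dK: "of_nat d \<in> K - {0}" using of_nat_dvd_nonzero[OF d(2)] by simp
  have t: "(\<lambda>x. trivial_char K x ^ d) = trivial_char K" "trivial_char K (of_nat d) = 1"
    "(\<lambda>x. char_pow \<theta> j x * trivial_char K x) = char_pow \<theta> j" for j
    using d(1) dK by (auto simp: trivial_char_def power_0_left char_pow_def)
  have "(\<Prod>j<d. gauss_sum_circ K \<psi> (char_pow \<theta> j)) = of_nat Q * P"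
    using prod_gauss_circ[OF trivial_char_K] gauss_trivial by (simp add: t P_def gauss_sum_circ_def[of _ _ "trivial_char K"] card_K)
  moreover have "(\<Prod>j<d. poch_circ K \<psi> (char_pow \<theta> j) \<nu>) =
    (\<Prod>j<d. gauss_sum_circ K \<psi> (\<lambda>x. char_pow \<theta> j x * \<nu> x)) / (\<Prod>j<d. gauss_sum_circ K \<psi> (char_pow \<theta> j))"
    by (simp add: poch_circ_def prod_dividef)
  ultimately have "(\<Prod>j<d. poch_circ K \<psi> (char_pow \<theta> j) \<nu>) * \<nu> (of_nat d) ^ d =
    ((\<Prod>j<d. gauss_sum_circ K \<psi> (\<lambda>x. char_pow \<theta> j x * \<nu> x)) * \<nu> (of_nat d) ^ d) / (of_nat Q * P)"
    by simp
  thus ?thesis unfolding prod_gauss_circ[OF \<nu>] P_def[symmetric] using P by simp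
qed

definition upper :: "('b \<Rightarrow> qbar) multiset" where
  "upper = (\<Sum>i\<in>UNIV. {#char_pow (\<rho> i) (w i + d * j). j \<in># mset_set {..<h i}#})"

definition lower :: "('b \<Rightarrow> qbar) multiset" where
  "lower = {#char_pow \<theta> j. j \<in># mset_set {..<d}#}"

definition argument :: "'b \<Rightarrow> 'b" where
  "argument L = (\<Prod>i\<in>UNIV. of_nat (h i) ^ h i) * L ^ d"

definition hyper_term :: "'b \<Rightarrow> ('b \<Rightarrow> qbar) \<Rightarrow> qbar" where
  "hyper_term L \<nu> = (\<Prod>\<alpha>\<in>#upper. poch K \<psi> \<alpha> \<nu>) / (\<Prod>\<beta>\<in>#lower. poch_circ K \<psi> \<beta> \<nu>) * \<nu> (argument L)"

text \<open>
  By the multiplication relation the \<open>h i\<close> upper parameters that belong to \<open>i\<close> collapse to one Gauss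
  sum, and so do the \<open>d\<close> lower parameters. The factors \<open>h i ^ h i\<close> in the argument absorb the values
  of \<open>\<nu>\<close> which that relation produces.
\<close>
lemma hyper_term_eq:
  assumes \<nu>: "\<nu> \<in> mult_chars K" and L: "L \<in> K - {0}"
  shows "hyper_term L \<nu> = (\<Prod>i\<in>UNIV. gauss_sum K \<psi> (\<lambda>x. \<eta> i x * \<nu> x ^ h i)) / (\<Prod>i\<in>UNIV. gauss_sum K \<psi> (\<eta> i))
    * of_nat Q / gauss_sum_circ K \<psi> (\<lambda>x. \<nu> x ^ d) * \<nu> ((of_nat d * L) ^ d)"
proof -
  have hK: "of_nat (h i) \<in> K - {0}" for i
    using of_nat_dvd_nonzero[OF dvd_mult_right[OF h(2)[of i]]] by simp
  have dK: "of_nat d \<in> K - {0}" using of_nat_dvd_nonzero[OF d(2)] by simp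
  have "(\<Prod>\<alpha>\<in>#upper. poch K \<psi> \<alpha> \<nu>) = (\<Prod>i\<in>UNIV. \<Prod>j<h i. poch K \<psi> (char_pow (\<rho> i) (w i + d * j)) \<nu>)"
    by (simp add: upper_def prod_mset_sum multiset.map_comp comp_def prod_unfold_prod_mset)
  moreover have "\<nu> (argument L) = (\<Prod>i\<in>UNIV. \<nu> (of_nat (h i)) ^ h i) * \<nu> L ^ d"
  proof -
    have "\<nu> (\<Prod>i\<in>UNIV. of_nat (h i) ^ h i) = (\<Prod>i\<in>UNIV. \<nu> (of_nat (h i)) ^ h i)"
      using \<nu> by (subst char_prod) (auto simp: char_power intro!: K_power)
    moreover have "(\<Prod>i\<in>(UNIV::'n set). of_nat (h i) ^ h i) \<in> K" by (auto intro!: K_power)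
    ultimately show ?thesis unfolding argument_def using L \<nu> by (simp add: char_mult char_power K_power)
  qed
  ultimately have "(\<Prod>\<alpha>\<in>#upper. poch K \<psi> \<alpha> \<nu>) * \<nu> (argument L) =
    (\<Prod>i\<in>UNIV. (\<Prod>j<h i. poch K \<psi> (char_pow (\<rho> i) (w i + d * j)) \<nu>) * \<nu> (of_nat (h i)) ^ h i) * \<nu> L ^ d"
    by (simp add: prod.distrib mult_ac)
  hence A: "(\<Prod>\<alpha>\<in>#upper. poch K \<psi> \<alpha> \<nu>) * \<nu> (argument L) =
    (\<Prod>i\<in>UNIV. gauss_sum K \<psi> (\<lambda>x. \<eta> i x * \<nu> x ^ h i)) / (\<Prod>i\<in>UNIV. gauss_sum K \<psi> (\<eta> i)) * \<nu> L ^ d"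
    by (simp add: upper_product[OF \<nu>] prod_dividef)
  have "(\<Prod>\<beta>\<in>#lower. poch_circ K \<psi> \<beta> \<nu>) = (\<Prod>j<d. poch_circ K \<psi> (char_pow \<theta> j) \<nu>)"
    by (simp add: lower_def multiset.map_comp comp_def prod_unfold_prod_mset)
  hence B: "(\<Prod>\<beta>\<in>#lower. poch_circ K \<psi> \<beta> \<nu>) * \<nu> (of_nat d) ^ d = gauss_sum_circ K \<psi> (\<lambda>x. \<nu> x ^ d) / of_nat Q"
    using lower_product[OF \<nu>] by simp
  have nz: "\<nu> (of_nat d) \<noteq> 0" "gauss_sum_circ K \<psi> (\<lambda>x. \<nu> x ^ d) \<noteq> 0"
    using dK \<nu> gauss_circ_nonzero[OF \<nu>_power_in[OF \<nu>]] by (auto simp: char_zero_iff)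
  have "\<nu> ((of_nat d * L) ^ d) = \<nu> (of_nat d) ^ d * \<nu> L ^ d"
    using L \<nu> by (subst char_power) (auto simp: char_mult power_mult_distrib)
  moreover have "hyper_term L \<nu> = ((\<Prod>\<alpha>\<in>#upper. poch K \<psi> \<alpha> \<nu>) * \<nu> (argument L)) / (\<Prod>\<beta>\<in>#lower. poch_circ K \<psi> \<beta> \<nu>)"
    by (simp add: hyper_term_def)
  moreover have "(\<Prod>\<beta>\<in>#lower. poch_circ K \<psi> \<beta> \<nu>) = gauss_sum_circ K \<psi> (\<lambda>x. \<nu> x ^ d) / of_nat Q / \<nu> (of_nat d) ^ d"
    using B nz by (metis nonzero_mult_div_cancel_right power_not_zero)
  ultimately show ?thesis unfolding A using nz Q_gt_1 by (simp add: field_simps)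
qed

end

section \<open>Hypergeometric functions as character sums over an affine hypersurface\<close>

context hypergeom_data
begin

definition F_val :: "'b \<Rightarrow> qbar" where
  "F_val L = 1 / (1 - of_nat Q) * (\<Sum>\<nu>\<in>mult_chars K. hyper_term L \<nu>)"

lemma F_val_hypergeom: "hypergeom K \<psi> upper lower (argument L) = F_val L"
  by (simp add: hypergeom_def F_val_def hyper_term_def card_K)

definition twist :: "('b \<Rightarrow> qbar) \<Rightarrow> 'n \<Rightarrow> 'b \<Rightarrow> qbar" where
  "twist \<nu> i = (\<lambda>x. \<eta> i x * \<nu> x ^ h i)"

lemma twist_in [simp]: "\<nu> \<in> mult_chars K \<Longrightarrow> twist \<nu> i \<in> mult_chars K"
  unfolding twist_def by (rule char_twist_in) auto

lemma prod_twist: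
  assumes \<nu>: "\<nu> \<in> mult_chars K"
  shows "(\<lambda>x. \<Prod>i\<in>UNIV. twist \<nu> i x) = (\<lambda>x. \<nu> x ^ d)"
proof
  fix x show "(\<Prod>i\<in>UNIV. twist \<nu> i x) = \<nu> x ^ d"
  proof (cases "x \<in> K - {0}")
    case True
    thus ?thesis using prod_\<eta>[OF True] by (simp add: twist_def prod.distrib sum_h flip: power_sum)
  next
    case False
    hence "\<nu> x = 0" "twist \<nu> i x = 0" for i using char_zero_iff \<nu> twist_in by blast+
    thus ?thesis using d(1) by (simp add: power_0_left)
  qed
qed

text \<open>
If all the characters \<open>\<eta> i * \<nu> ^ h i\<close> are trivial, then so is their product \<open>\<nu> ^ d\<close>. Thus \<open>\<nu>\<close> is
inverse to some \<open>\<theta> ^ m\<close>, and then \<open>w = m h\<close> modulo \<open>d\<close>.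
\<close>
lemma twist_trivial_iff:
  assumes \<nu>: "\<nu> \<in> mult_chars K"
  shows "(\<forall>i. twist \<nu> i = trivial_char K) \<longleftrightarrow>
    (\<exists>m<d. (\<forall>i. w i mod d = m * h i mod d) \<and> (\<lambda>x. char_pow \<theta> m x * \<nu> x) = trivial_char K)"
proof -
  have key: "twist \<nu> i = trivial_char K \<longleftrightarrow> w i mod d = m * h i mod d"
    if m: "(\<lambda>x. char_pow \<theta> m x * \<nu> x) = trivial_char K" for i m
  proof -
    have *: "char_pow \<theta> (m * h i) x * \<nu> x ^ h i = 1" if x: "x \<in> K - {0}" for x
    proof -
      have "char_pow \<theta> m x * \<nu> x = 1" using fun_cong[OF m, of x] x by (simp add: trivial_char_def)
      hence "(char_pow \<theta> m x * \<nu> x) ^ h i = 1" by simp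
      thus ?thesis using x by (simp add: char_pow_def power_mult power_mult_distrib)
    qed
    have "twist \<nu> i = trivial_char K \<longleftrightarrow> (\<forall>x\<in>K - {0}. \<eta> i x * \<nu> x ^ h i = 1)"
    proof
      assume "twist \<nu> i = trivial_char K"
      thus "\<forall>x\<in>K - {0}. \<eta> i x * \<nu> x ^ h i = 1" by (auto simp: twist_def trivial_char_def fun_eq_iff)
    next
      assume "\<forall>x\<in>K - {0}. \<eta> i x * \<nu> x ^ h i = 1"
      thus "twist \<nu> i = trivial_char K" by (intro char_trivialI) (auto simp: \<nu>, auto simp: twist_def)
    qed
    also have "\<dots> \<longleftrightarrow> (\<forall>x\<in>K - {0}. \<eta> i x = char_pow \<theta> (m * h i) x)"
      using * by (metis mult_cancel_right mult_zero_right zero_neq_one)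
    also have "\<dots> \<longleftrightarrow> \<eta> i = char_pow \<theta> (m * h i)"
      by (auto intro!: char_eqI)
    finally show ?thesis unfolding \<eta>_def residue_char_pow_eq_iff[OF \<theta> d] .
  qed
  show ?thesis
  proof
    assume triv: "\<forall>i. twist \<nu> i = trivial_char K"
    have "(\<lambda>x. \<nu> x ^ d) = trivial_char K"
    proof
      fix x show "\<nu> x ^ d = trivial_char K x"
        using fun_cong[OF prod_twist[OF \<nu>], of x] triv d(1) char_zero_iff[OF \<nu>, of x]
        by (cases "x \<in> K - {0}") (auto simp: trivial_char_def power_0_left)
    qed
    hence "card {j. j < d \<and> (\<lambda>x. char_pow \<theta> j x * \<nu> x) = trivial_char K} \<noteq> 0"
      using card_torsion_shift[OF \<theta> d \<nu>] by simp
    then obtain m where "m < d" "(\<lambda>x. char_pow \<theta> m x * \<nu> x) = trivial_char K"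
      by (metis (mono_tags, lifting) Collect_empty_eq card.empty)
    thus "\<exists>m<d. (\<forall>i. w i mod d = m * h i mod d) \<and> (\<lambda>x. char_pow \<theta> m x * \<nu> x) = trivial_char K"
      using triv key by blast
  qed (use key in blast)
qed

text \<open>
The points of the hypersurface without vanishing coordinates, in terms of the \<open>d\<close>-th powers of the coordinates scaled
to have sum \<open>1\<close>.
\<close>
definition affine_sum :: "'b \<Rightarrow> qbar" where
  "affine_sum c = (\<Sum>u | (\<forall>i. u i \<in> K - {0}) \<and> (\<Sum>i\<in>UNIV. u i) = 1 \<and> c * (\<Prod>i\<in>UNIV. u i ^ h i) = 1.
     \<Prod>i\<in>UNIV. \<eta> i (u i))"

text \<open>
The monomial equation is detected by the orthogonality of the characters \<open>\<nu>\<close>.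
\<close>
lemma affine_sum_jacobi:
  assumes c: "c \<in> K - {0}"
  shows "(\<Sum>\<nu>\<in>mult_chars K. \<nu> c * jacobi_at K (twist \<nu>) 1) = of_nat (Q - 1) * affine_sum c"
proof -
  let ?U = "{u :: 'n \<Rightarrow> 'b. (\<forall>i. u i \<in> K - {0}) \<and> (\<Sum>i\<in>UNIV. u i) = 1}"
  have fU: "finite ?U" by (rule finite_subset[OF _ finite_funs[OF finite_K_units]]) auto
  have "(\<Sum>\<nu>\<in>mult_chars K. \<nu> c * jacobi_at K (twist \<nu>) 1) =
      (\<Sum>u\<in>?U. \<Sum>\<nu>\<in>mult_chars K. \<nu> c * (\<Prod>i\<in>UNIV. twist \<nu> i (u i)))"
    unfolding jacobi_at_def sum_distrib_left by (rule sum.swap)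
  also have "\<dots> = (\<Sum>u\<in>?U. if c * (\<Prod>i\<in>UNIV. u i ^ h i) = 1 then of_nat (Q - 1) * (\<Prod>i\<in>UNIV. \<eta> i (u i)) else 0)"
  proof (rule sum.cong[OF refl])
    fix u assume u: "u \<in> ?U"
    have p: "(\<Prod>i\<in>UNIV. u i ^ h i) \<in> K" "(\<Prod>i\<in>UNIV. u i ^ h i) \<noteq> 0" using u by (auto intro!: K_power)
    have "(\<Sum>\<nu>\<in>mult_chars K. \<nu> c * (\<Prod>i\<in>UNIV. twist \<nu> i (u i))) =
        (\<Sum>\<nu>\<in>mult_chars K. (\<Prod>i\<in>UNIV. \<eta> i (u i)) * \<nu> (c * (\<Prod>i\<in>UNIV. u i ^ h i)))"
    proof (rule sum.cong[OF refl])
      fix \<nu> assume \<nu>: "\<nu> \<in> mult_chars K"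
      have "\<nu> (\<Prod>i\<in>UNIV. u i ^ h i) = (\<Prod>i\<in>UNIV. \<nu> (u i) ^ h i)"
        using \<nu> u by (subst char_prod) (auto simp: char_power intro!: K_power)
      thus "\<nu> c * (\<Prod>i\<in>UNIV. twist \<nu> i (u i)) = (\<Prod>i\<in>UNIV. \<eta> i (u i)) * \<nu> (c * (\<Prod>i\<in>UNIV. u i ^ h i))"
        using \<nu> c p by (simp add: char_mult twist_def prod.distrib)
    qed
    also have "\<dots> = (\<Prod>i\<in>UNIV. \<eta> i (u i)) * (\<Sum>\<nu>\<in>mult_chars K. \<nu> (c * (\<Prod>i\<in>UNIV. u i ^ h i)))"
      by (simp add: sum_distrib_left)
    also have "(\<Sum>\<nu>\<in>mult_chars K. \<nu> (c * (\<Prod>i\<in>UNIV. u i ^ h i))) =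
        (if c * (\<Prod>i\<in>UNIV. u i ^ h i) = 1 then of_nat (Q - 1) else 0)"
      by (rule sum_over_chars) (use c p in auto)
    finally show "(\<Sum>\<nu>\<in>mult_chars K. \<nu> c * (\<Prod>i\<in>UNIV. twist \<nu> i (u i))) =
      (if c * (\<Prod>i\<in>UNIV. u i ^ h i) = 1 then of_nat (Q - 1) * (\<Prod>i\<in>UNIV. \<eta> i (u i)) else 0)" by simp
  qed
  also have "\<dots> = of_nat (Q - 1) * affine_sum c"
    unfolding affine_sum_def sum_distrib_left using fU
    by (subst sum.inter_filter[symmetric]) (auto intro!: sum.cong)
  finally show ?thesis .
qed

definition G_prod :: qbar where "G_prod = (\<Prod>i\<in>UNIV. gauss_sum K \<psi> (\<eta> i))"

lemma G_prod_nonzero: "G_prod \<noteq> 0"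
  by (simp add: G_prod_def gauss_nonzero)

lemma affine_sum_hyper:
  assumes L: "L \<in> K - {0}"
  shows "affine_sum ((of_nat d * L) ^ d) = (-1) ^ CARD('n) * G_prod / of_nat Q * F_val L
    + of_nat (Q - 1) ^ CARD('n) / of_nat Q / of_nat (Q - 1) *
      (\<Sum>\<nu> | \<nu> \<in> mult_chars K \<and> (\<forall>i. twist \<nu> i = trivial_char K). \<nu> ((of_nat d * L) ^ d))"
proof -
  let ?c = "(of_nat d * L) ^ d"
  let ?q = "of_nat (Q - 1) :: qbar"
  have q: "?q \<noteq> 0" "1 - of_nat Q = - ?q" using Q_gt_1 by (auto simp: of_nat_diff)
  have c: "?c \<in> K - {0}" using L of_nat_dvd_nonzero[OF d(2)] by (auto intro!: K_power)
  have "?q * affine_sum ?c = (\<Sum>\<nu>\<in>mult_chars K. \<nu> ?c * jacobi_at K (twist \<nu>) 1)"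
    by (rule affine_sum_jacobi[OF c, symmetric])
  also have "\<dots> = (\<Sum>\<nu>\<in>mult_chars K. (if \<forall>i. twist \<nu> i = trivial_char K then \<nu> ?c * (?q ^ CARD('n) / of_nat Q) else 0)
      - (-1) ^ CARD('n) * G_prod / of_nat Q * hyper_term L \<nu>)"
  proof (rule sum.cong[OF refl])
    fix \<nu> assume \<nu>: "\<nu> \<in> mult_chars K"
    have "jacobi_at K (twist \<nu>) 1 = (if \<forall>i. twist \<nu> i = trivial_char K then ?q ^ CARD('n) / of_nat Q else 0)
      - (-1) ^ CARD('n) * (\<Prod>i\<in>UNIV. gauss_sum K \<psi> (twist \<nu> i)) / gauss_sum_circ K \<psi> (\<lambda>x. \<nu> x ^ d)"
      using jacobi_at_1[of "twist \<nu>"] \<nu> by (simp add: prod_twist)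
    moreover have "G_prod / of_nat Q * hyper_term L \<nu> =
        (\<Prod>i\<in>UNIV. gauss_sum K \<psi> (twist \<nu> i)) / gauss_sum_circ K \<psi> (\<lambda>x. \<nu> x ^ d) * \<nu> ?c"
      unfolding hyper_term_eq[OF \<nu> L] G_prod_def[symmetric] twist_def using G_prod_nonzero Q_gt_1 by simp
    ultimately show "\<nu> ?c * jacobi_at K (twist \<nu>) 1 =
      (if \<forall>i. twist \<nu> i = trivial_char K then \<nu> ?c * (?q ^ CARD('n) / of_nat Q) else 0)
      - (-1) ^ CARD('n) * G_prod / of_nat Q * hyper_term L \<nu>"
      by (simp add: right_diff_distrib mult.assoc times_divide_eq_right[symmetric] del: times_divide_eq_right) (simp add: mult_ac)
  qed
  also have "\<dots> = ?q ^ CARD('n) / of_nat Q * (\<Sum>\<nu> | \<nu> \<in> mult_chars K \<and> (\<forall>i. twist \<nu> i = trivial_char K). \<nu> ?c)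
      - (-1) ^ CARD('n) * G_prod / of_nat Q * (\<Sum>\<nu>\<in>mult_chars K. hyper_term L \<nu>)"
    unfolding sum_subtractf sum_distrib_left by (simp add: sum.inter_filter[symmetric] mult_ac)
  also have "(\<Sum>\<nu>\<in>mult_chars K. hyper_term L \<nu>) = - ?q * F_val L"
    using q by (simp add: F_val_def)
  finally have "?q * affine_sum ?c = ?q ^ CARD('n) / of_nat Q * (\<Sum>\<nu> | \<nu> \<in> mult_chars K \<and> (\<forall>i. twist \<nu> i = trivial_char K). \<nu> ?c)
      + ?q * ((-1) ^ CARD('n) * G_prod / of_nat Q * F_val L)" (is "_ = ?R") by simp
  hence "affine_sum ?c = ?R / ?q" using q by (metis nonzero_mult_div_cancel_left)
  thus ?thesis using q by (simp add: add_divide_distrib)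
qed

lemma prod_\<eta>_trivial: "(\<lambda>x. \<Prod>i\<in>UNIV. \<eta> i x) = trivial_char K"
proof
  fix x show "(\<Prod>i\<in>UNIV. \<eta> i x) = trivial_char K x"
  proof (cases "x \<in> K - {0}")
    case False
    hence "\<eta> i x = 0" for i using char_zero_iff[OF \<eta>_in] by blast
    thus ?thesis using False by (simp add: trivial_char_def power_0_left)
  qed (simp add: prod_\<eta> trivial_char_def)
qed

definition J_val :: qbar where "J_val = (-1) ^ (CARD('n) - 1) * jacobi_at K \<eta> 1"

lemma J_val_eq:
  assumes "\<not> (\<forall>i. \<eta> i = trivial_char K)"
  shows "J_val = G_prod / of_nat Q"
proof -
  have "jacobi_at K \<eta> 1 = - ((-1) ^ CARD('n)) * G_prod / of_nat Q"
    using jacobi_at_1[of \<eta>] assms unfolding prod_\<eta>_trivial G_prod_def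
    by (simp add: gauss_sum_circ_def gauss_trivial card_K)
  moreover have "(-1) ^ (CARD('n) - 1) * - ((-1) ^ CARD('n)) = (1 :: qbar)"
    by (cases "CARD('n)") (auto simp flip: power_add)
  ultimately show ?thesis unfolding J_val_def by (metis (no_types, lifting) mult.assoc mult_1 times_divide_eq_right)
qed

theorem affine_sum_generic:
  assumes L: "L \<in> K - {0}" and w: "\<And>m. m < d \<Longrightarrow> \<not> (\<forall>i. w i mod d = m * h i mod d)"
  shows "affine_sum ((of_nat d * L) ^ d) = (-1) ^ CARD('n) * (J_val * F_val L)"
proof -
  have empty: "{\<nu> \<in> mult_chars K. \<forall>i. twist \<nu> i = trivial_char K} = {}"
    using twist_trivial_iff w by blast
  have nt: "\<not> (\<forall>i. \<eta> i = trivial_char K)"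
  proof
    assume "\<forall>i. \<eta> i = trivial_char K"
    hence "d dvd w i" for i using residue_char_pow_trivial[OF \<theta> d, of "w i"] by (simp add: \<eta>_def)
    thus False using w[of 0] d(1) by simp
  qed
  show ?thesis unfolding affine_sum_hyper[OF L] J_val_eq[OF nt] empty by simp
qed

definition F_red :: "nat \<Rightarrow> 'b \<Rightarrow> qbar" where
  "F_red m L = hypergeom K \<psi> (upper - {#char_pow \<theta> m#}) (lower - {#char_pow \<theta> m#}) (argument L)"

text \<open>
Here one character \<open>\<nu>0\<close> makes all the characters \<open>\<eta> i * \<nu>0 ^ h i\<close> trivial. Cancelling the
parameter \<open>\<theta> ^ m\<close> multiplies the summand of the hypergeometric function at \<open>\<nu>0\<close> by \<open>Q\<close> and, if \<open>m = 0\<close>, divides all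
summands by \<open>Q\<close>. The term of \<open>\<nu>0\<close> is explicit, which accounts for the two additional summands.
\<close>
theorem affine_sum_special:
  assumes L: "L \<in> K - {0}" and m: "m < d" and w: "\<And>i. w i = m * h i mod d"
  shows "affine_sum ((of_nat d * L) ^ d) =
    (-1) ^ CARD('n) * (J_val ^ (if m = 0 then 0 else 1) * F_red m L) + (-1) ^ CARD('n) / of_nat Q
    + of_nat (Q - 1) ^ CARD('n) / of_nat Q / of_nat (Q - 1)"
proof -
  let ?c = "(of_nat d * L) ^ d"
  let ?\<rho> = "char_pow \<theta> m"
  have dK: "of_nat d \<in> K - {0}" using of_nat_dvd_nonzero[OF d(2)] by simp
  define \<nu>0 where "\<nu>0 = (\<lambda>x. inverse (?\<rho> x))"
  have \<nu>0: "\<nu>0 \<in> mult_chars K" unfolding \<nu>0_def by (rule mult_chars_inverse) simp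
  have \<rho>nz: "?\<rho> x \<noteq> 0" if "x \<in> K - {0}" for x using that by (simp add: char_zero_iff)
  have inv: "(\<lambda>x. ?\<rho> x * \<nu> x) = trivial_char K \<longleftrightarrow> \<nu> = \<nu>0" if \<nu>: "\<nu> \<in> mult_chars K" for \<nu>
  proof
    assume *: "(\<lambda>x. ?\<rho> x * \<nu> x) = trivial_char K"
    show "\<nu> = \<nu>0"
    proof (rule char_eqI[OF \<nu> \<nu>0])
      fix x assume x: "x \<in> K - {0}"
      show "\<nu> x = \<nu>0 x" using fun_cong[OF *, of x] x \<rho>nz[OF x] by (simp add: trivial_char_def \<nu>0_def field_simps)
    qed
  next
    assume *: "\<nu> = \<nu>0"
    show "(\<lambda>x. ?\<rho> x * \<nu> x) = trivial_char K"
    proof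
      fix x show "?\<rho> x * \<nu> x = trivial_char K x"
        unfolding * \<nu>0_def using \<rho>nz[of x] char_zero_iff[of ?\<rho> x]
        by (cases "x \<in> K - {0}") (auto simp: trivial_char_def)
    qed
  qed
  have uniq: "j = m" if "j < d" "\<And>i. w i mod d = j * h i mod d" for j
  proof -
    have *: "m' = j'" if "j' \<le> m'" "m' < d" "\<And>i. m' * h i mod d = j' * h i mod d" for m' j'
    proof -
      have "d dvd m' * h i - j' * h i" for i
        using that mod_eq_dvd_iff_nat[of "j' * h i" "m' * h i" d] by (simp add: mult_le_mono1)
      hence "d dvd (m' - j') * h i" for i by (simp add: diff_mult_distrib)
      hence "d dvd m' - j'" by (rule gcd_h)
      thus ?thesis using that(1,2) by (auto dest: dvd_imp_le)
    qed
    have "m * h i mod d = j * h i mod d" for i using that(2)[of i] w[of i] by simp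
    thus ?thesis using *[of j m] *[of m j] that(1) m by (metis linear)
  qed
  have triv_set: "{\<nu> \<in> mult_chars K. \<forall>i. twist \<nu> i = trivial_char K} = {\<nu>0}"
  proof -
    have "(\<forall>i. twist \<nu> i = trivial_char K) \<longleftrightarrow> \<nu> = \<nu>0" if \<nu>: "\<nu> \<in> mult_chars K" for \<nu>
      unfolding twist_trivial_iff[OF \<nu>] using inv[OF \<nu>] uniq m w by (metis mod_mod_trivial)
    thus ?thesis using \<nu>0 by auto
  qed
  have \<nu>0d: "\<nu>0 x ^ d = 1" if "x \<in> K - {0}" for x
  proof -
    have "?\<rho> x ^ d = (\<theta> x ^ d) ^ m" using that by (simp add: char_pow_def power_mult[symmetric] mult.commute)
    thus ?thesis using \<theta>_pow_d[OF that] by (simp add: \<nu>0_def power_inverse)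
  qed
  have dL: "of_nat d * L \<in> K - {0}" using dK L by auto
  have \<nu>0c: "\<nu>0 ?c = 1" using \<nu>0d[OF dL] dL \<nu>0 by (simp add: char_power)
  have main: "affine_sum ?c = (-1) ^ CARD('n) * (G_prod / of_nat Q * F_val L)
    + of_nat (Q - 1) ^ CARD('n) / of_nat Q / of_nat (Q - 1)"
    unfolding affine_sum_hyper[OF L] triv_set by (simp add: \<nu>0c)
  \<comment> \<open>the term of \<open>\<nu>0\<close> has only trivial characters in the numerator\<close>
  have term0: "hyper_term L \<nu>0 = 1 / G_prod"
  proof -
    have t: "twist \<nu>0 i = trivial_char K" for i using triv_set by blast
    have "(\<lambda>x. \<nu>0 x ^ d) = trivial_char K"
    proof
      fix x show "\<nu>0 x ^ d = trivial_char K x"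
        using \<nu>0d[of x] d(1) char_zero_iff[OF \<nu>0, of x]
        by (cases "x \<in> K - {0}") (auto simp: trivial_char_def power_0_left)
    qed
    thus ?thesis unfolding hyper_term_eq[OF \<nu>0 L] G_prod_def[symmetric] using t Q_gt_1
      by (simp add: twist_def[symmetric] gauss_trivial \<nu>0c gauss_sum_circ_def card_K)
  qed
  have in_lower: "?\<rho> \<in># lower" using m by (auto simp: lower_def)
  have in_upper: "?\<rho> \<in># upper"
  proof -
    fix i0 :: 'n
    define j where "j = m * h i0 div d"
    have "m * h i0 < d * h i0" using m h(1)[of i0] by simp
    hence j: "j < h i0" unfolding j_def using d(1) by (simp add: div_less_iff_less_mult mult.commute)
    have wj: "w i0 + d * j = h i0 * m" by (simp add: w j_def mult.commute)
    have "char_pow (\<rho> i0) (w i0 + d * j) = ?\<rho>"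
      unfolding wj by (rule ext) (auto simp: char_pow_def power_mult \<rho>_power)
    hence "?\<rho> \<in># {#char_pow (\<rho> i0) (w i0 + d * j). j \<in># mset_set {..<h i0}#}" using j by force
    thus ?thesis unfolding upper_def by (subst set_mset_sum, simp, blast)
  qed
  let ?e = "if ?\<rho> = trivial_char K then of_nat Q else 1 :: qbar"
  have red: "?e * ((\<Prod>\<alpha>\<in>#upper - {#?\<rho>#}. poch K \<psi> \<alpha> \<nu>) / (\<Prod>\<beta>\<in>#lower - {#?\<rho>#}. poch_circ K \<psi> \<beta> \<nu>) * \<nu> (argument L)) =
      hyper_term L \<nu> * (if \<nu> = \<nu>0 then of_nat Q else 1)" if \<nu>: "\<nu> \<in> mult_chars K" for \<nu>
  proof -
    have g: "gauss_sum K \<psi> ?\<rho> \<noteq> 0" "gauss_sum K \<psi> (\<lambda>x. ?\<rho> x * \<nu> x) \<noteq> 0"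
      using gauss_nonzero mult_chars_mult[OF _ \<nu>] by auto
    have U: "(\<Prod>\<alpha>\<in>#upper. poch K \<psi> \<alpha> \<nu>) = poch K \<psi> ?\<rho> \<nu> * (\<Prod>\<alpha>\<in>#upper - {#?\<rho>#}. poch K \<psi> \<alpha> \<nu>)"
      by (subst insert_DiffM[OF in_upper, symmetric]) simp
    have D: "(\<Prod>\<beta>\<in>#lower. poch_circ K \<psi> \<beta> \<nu>) = poch_circ K \<psi> ?\<rho> \<nu> * (\<Prod>\<beta>\<in>#lower - {#?\<rho>#}. poch_circ K \<psi> \<beta> \<nu>)"
      by (subst insert_DiffM[OF in_lower, symmetric]) simp
    have key: "p * A / (r * B) * z * s = p / r * s * (A / B * z)" for p A r B z s :: qbar by simp
    have "hyper_term L \<nu> * (if \<nu> = \<nu>0 then of_nat Q else 1) =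
      poch K \<psi> ?\<rho> \<nu> / poch_circ K \<psi> ?\<rho> \<nu> * (if \<nu> = \<nu>0 then of_nat Q else 1) *
      ((\<Prod>\<alpha>\<in>#upper - {#?\<rho>#}. poch K \<psi> \<alpha> \<nu>) / (\<Prod>\<beta>\<in>#lower - {#?\<rho>#}. poch_circ K \<psi> \<beta> \<nu>) * \<nu> (argument L))"
      unfolding hyper_term_def U D by (rule key)
    also have "poch K \<psi> ?\<rho> \<nu> / poch_circ K \<psi> ?\<rho> \<nu> * (if \<nu> = \<nu>0 then of_nat Q else 1) = ?e"
      using g Q_gt_1 inv[OF \<nu>] by (simp add: poch_def poch_circ_def gauss_sum_circ_def card_K)
    finally show ?thesis by (rule sym)
  qed
  have q: "1 - of_nat Q \<noteq> (0::qbar)" using Q_gt_1 by (metis of_nat_1 of_nat_eq_iff right_minus_eq less_irrefl)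
  have "?e * F_red m L = 1 / (1 - of_nat Q) * (\<Sum>\<nu>\<in>mult_chars K. hyper_term L \<nu> * (if \<nu> = \<nu>0 then of_nat Q else 1))"
    unfolding F_red_def hypergeom_def card_K
    by (subst mult.left_commute, subst sum_distrib_left) (simp only: red cong: sum.cong)
  also have "(\<Sum>\<nu>\<in>mult_chars K. hyper_term L \<nu> * (if \<nu> = \<nu>0 then of_nat Q else 1)) =
      (\<Sum>\<nu>\<in>mult_chars K. hyper_term L \<nu>) + (of_nat Q - 1) * hyper_term L \<nu>0"
  proof -
    have "(\<Sum>\<nu>\<in>mult_chars K. hyper_term L \<nu> * (if \<nu> = \<nu>0 then of_nat Q else 1)) =
      (\<Sum>\<nu>\<in>mult_chars K. hyper_term L \<nu> + (if \<nu> = \<nu>0 then (of_nat Q - 1) * hyper_term L \<nu>0 else 0))"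
      by (intro sum.cong refl) (auto simp: algebra_simps)
    thus ?thesis using \<nu>0 by (simp add: sum.distrib sum.delta)
  qed
  also have "1 / (1 - of_nat Q) * \<dots> = F_val L - hyper_term L \<nu>0"
    using q by (simp add: F_val_def distrib_left) (simp add: field_simps)
  finally have F: "F_val L = ?e * F_red m L + 1 / G_prod" by (simp add: term0)
  have triv_iff: "?\<rho> = trivial_char K \<longleftrightarrow> m = 0"
    using residue_char_pow_trivial[OF \<theta> d, of m] m by (auto dest: dvd_imp_le)
  have F': "F_val L = (if m = 0 then of_nat Q else 1) * F_red m L + 1 / G_prod"
    using F unfolding triv_iff .
  have "G_prod / of_nat Q * F_val L = J_val ^ (if m = 0 then 0 else 1) * F_red m L + 1 / of_nat Q"
  proof (cases "m = 0")
    case True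
    have "\<eta> i = trivial_char K" for i
      using residue_char_pow_trivial[OF \<theta> d, of "w i"] True w by (simp add: \<eta>_def)
    hence "G_prod = 1" by (simp add: G_prod_def gauss_trivial)
    thus ?thesis unfolding F' using True Q_gt_1 by (simp add: distrib_left add_divide_distrib)
  next
    case False
    have "\<not> (\<forall>i. \<eta> i = trivial_char K)"
    proof
      assume "\<forall>i. \<eta> i = trivial_char K"
      hence "d dvd w i" for i unfolding \<eta>_def residue_char_pow_trivial[OF \<theta> d] by blast
      hence "d dvd m * h i" for i unfolding w dvd_eq_mod_eq_0 by simp
      hence "d dvd m" by (rule gcd_h)
      thus False using m False by (auto dest: dvd_imp_le)
    qed
    thus ?thesis unfolding F' using False G_prod_nonzero Q_gt_1 by (simp add: J_val_eq distrib_left)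
  qed
  thus ?thesis unfolding main by (simp add: distrib_left)
qed

end

section \<open>Extensions of a finite field inside its algebraic closure\<close>

lemma card_finite_field_power: "\<exists>e>0. CARD('a::finite_field) = CHAR('a) ^ e"
proof -
  let ?q = "CARD('a)" and ?p = "CHAR('a)"
  have q1: "?q > 1" using card_mono[of "UNIV :: 'a set" "{0, 1}"] by simp
  \<comment> \<open>a subgroup of prime order \<open>l \<noteq> p\<close> of the additive group would consist of zeros\<close>
  have only: "l = ?p" if l: "Factorial_Ring.prime l" "l dvd ?q" for l
  proof (rule ccontr)
    assume ne: "l \<noteq> ?p"
    let ?G = "\<lparr>carrier = UNIV :: 'a set, monoid.mult = (+), one = 0\<rparr>"
    interpret G: group ?G
    proof (rule groupI)
      fix x :: 'a assume "x \<in> carrier ?G"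
      show "\<exists>y\<in>carrier ?G. y \<otimes>\<^bsub>?G\<^esub> x = \<one>\<^bsub>?G\<^esub>" by (intro bexI[of _ "- x"]) auto
    qed (auto simp: add_ac)
    obtain m where m: "?q = l * m" using l(2) by (elim dvdE)
    obtain H where H: "subgroup H ?G" "card H = l"
      using sylow_thm[of l ?G 1 m] l(1) m G.group_axioms by (auto simp: Coset.order_def)
    have pow: "x [^]\<^bsub>?G\<^esub> (n::nat) = of_nat n * x" for x n
      by (induction n) (auto simp: nat_pow_def algebra_simps)
    have "x = 0" if x: "x \<in> H" for x
    proof -
      interpret GH: group "?G\<lparr>carrier := H\<rparr>" using H(1) by (rule G.subgroup_imp_group)
      have "x [^]\<^bsub>?G\<lparr>carrier := H\<rparr>\<^esub> Coset.order (?G\<lparr>carrier := H\<rparr>) = \<one>\<^bsub>?G\<lparr>carrier := H\<rparr>\<^esub>"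
        by (rule GH.pow_order_eq_1) (use x in simp)
      hence "of_nat l * x = 0" using pow[of x l] H(2) by (simp add: Coset.order_def nat_pow_def)
      moreover have "of_nat l \<noteq> (0::'a)"
        using ne l(1) by (auto simp: of_nat_eq_0_iff_char_dvd dest: primes_dvd_imp_eq[OF CHAR_prime])
      ultimately show ?thesis by simp
    qed
    hence "card H \<le> card {0::'a}" by (intro card_mono) auto
    thus False using H(2) prime_gt_1_nat[OF l(1)] by simp
  qed
  have "set_mset (prime_factorization ?q) \<subseteq> {?p}"
    using only by (auto simp: in_prime_factors_iff)
  hence "prime_factorization ?q = replicate_mset (size (prime_factorization ?q)) ?p"
    by (metis set_mset_subset_singletonD size_replicate_mset)
  hence "prod_mset (prime_factorization ?q) = ?p ^ size (prime_factorization ?q)"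
    by (metis prod_mset_replicate_mset)
  hence eq: "?q = ?p ^ size (prime_factorization ?q)"
    by (simp add: prod_mset_prime_factorization_nat)
  moreover have "size (prime_factorization ?q) > 0" using eq q1 by (metis neq0_conv power_0 less_irrefl)
  ultimately show ?thesis by blast
qed

lemma finite_subfield_ext_field:
  assumes "r > 0"
  shows "finite_subfield (CARD('a::finite_field) ^ r) (ext_field r :: 'a alg_closure set)"
proof
  show "\<exists>e>0. CARD('a) ^ r = CHAR('a alg_closure) ^ e"
  proof -
    obtain e where "e > 0" "CARD('a) = CHAR('a) ^ e" using card_finite_field_power by blast
    thus ?thesis using assms by (intro exI[of _ "e * r"]) (simp add: power_mult)
  qed
qed (auto simp: ext_field_def)

lemma to_ac_in_ext_field: "to_ac (x :: 'a::finite_field) \<in> ext_field r"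
proof -
  have "to_ac x ^ (CARD('a) ^ r) = to_ac (x ^ (CARD('a) ^ r))" by simp
  also have "x ^ (CARD('a) ^ r) = x" by (rule finite_field_power_card_power_eq_same) simp
  finally show ?thesis by (simp add: ext_field_def)
qed

lemma ext_field_1: "ext_field 1 = range (to_ac :: 'a::finite_field \<Rightarrow> 'a alg_closure)"
proof -
  interpret finite_subfield "CARD('a) ^ 1" "ext_field 1 :: 'a alg_closure set"
    by (rule finite_subfield_ext_field) simp
  have "range (to_ac :: 'a \<Rightarrow> 'a alg_closure) = ext_field 1"
  proof (rule card_seteq)
    show "card (ext_field 1 :: 'a alg_closure set) \<le> card (range (to_ac :: 'a \<Rightarrow> 'a alg_closure))"
      using card_K by (simp add: card_image inj_to_ac)
  qed (use to_ac_in_ext_field finite_K in auto)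
  thus ?thesis by simp
qed

lemma to_ac_of_ac_ext: "x \<in> ext_field 1 \<Longrightarrow> to_ac (of_ac x) = (x :: 'a::finite_field alg_closure)"
  using to_ac_of_ac ext_field_1 by blast

lemma CARD_gt_1: "CARD('a::finite_field) > 1"
  using finite_subfield.Q_gt_1[OF finite_subfield_ext_field[of 1, where ?'a = 'a]] by simp

lemma UNIV_char_closed: "x \<in> UNIV - {0} \<Longrightarrow> y \<in> UNIV - {0} \<Longrightarrow> x * y \<in> (UNIV :: 'a::field set)"
  by simp

lemma UNIV_char_simps:
  assumes "\<eta> \<in> mult_chars (UNIV :: 'a::field set)"
  shows "\<eta> 0 = 0" "\<eta> 1 = 1" "\<eta> (x * y) = \<eta> x * \<eta> y" "\<eta> x = 0 \<longleftrightarrow> x = 0"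
proof -
  show 1: "\<eta> x = 0 \<longleftrightarrow> x = 0" for x using assms by (auto simp: mult_chars_def)
  show 2: "\<eta> 0 = 0" using 1 by simp
  show 3: "\<eta> (x * y) = \<eta> x * \<eta> y" for x y
    using assms by (cases "x = 0"; cases "y = 0") (auto simp: 2 mult_chars_def)
  show "\<eta> 1 = 1" using 3[of 1 1] 1[of 1] by simp
qed

lemma UNIV_char_power: "\<eta> \<in> mult_chars (UNIV :: 'a::field set) \<Longrightarrow> \<eta> (x ^ n) = \<eta> x ^ n"
  by (induction n) (auto simp: UNIV_char_simps)

lemma UNIV_char_prod: "\<eta> \<in> mult_chars (UNIV :: 'a::field set) \<Longrightarrow> \<eta> (prod f A) = (\<Prod>i\<in>A. \<eta> (f i))"
  by (induction A rule: infinite_finite_induct) (auto simp: UNIV_char_simps)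

text \<open>
  A generator of the character group is injective: the characters of a finite field separate its
  points.
\<close>
lemma generator_char_faithful:
  fixes \<phi> :: "'a::finite_field \<Rightarrow> qbar"
  assumes \<phi>: "\<phi> \<in> mult_chars UNIV" and gen: "generate (char_group UNIV) {\<phi>} = mult_chars UNIV"
    and z: "\<phi> z = 1"
  shows "z = 1"
proof (rule ccontr)
  assume z1: "z \<noteq> 1"
  have z0: "z \<noteq> 0" using z UNIV_char_simps(1)[OF \<phi>] by auto
  interpret finite_subfield "CARD('a) ^ 1" "ext_field 1 :: 'a alg_closure set"
    by (rule finite_subfield_ext_field) simp
  interpret G: comm_group "char_group (UNIV :: 'a set)"
    by (rule comm_group_char_group) (rule UNIV_char_closed)
  have "\<exists>\<nu>\<in>mult_chars (ext_field 1). \<nu> (to_ac z) \<noteq> 1"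
    by (rule ex_separating_char) (use z0 z1 in \<open>auto simp: to_ac_in_ext_field\<close>)
  then obtain \<nu> where \<nu>: "\<nu> \<in> mult_chars (ext_field 1)" "\<nu> (to_ac z) \<noteq> 1" by blast
  define \<eta> where "\<eta> = (\<lambda>x. \<nu> (to_ac x))"
  have "\<eta> \<in> mult_chars UNIV"
    using \<nu>(1) char_mult[OF \<nu>(1)] char_zero_iff[OF \<nu>(1)]
    by (auto simp: mult_chars_def \<eta>_def to_ac_in_ext_field)
  moreover have "\<eta> z = 1" if "\<eta> \<in> generate (char_group UNIV) {\<phi>}" for \<eta> :: "'a \<Rightarrow> qbar"
    using that
  proof (induction rule: generate.induct)
    case one
    show ?case using z0 by (simp add: trivial_char_def)
  next
    case (inv \<eta>)
    hence e: "\<eta> = \<phi>" by simp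
    have "inv\<^bsub>char_group UNIV\<^esub> \<phi> \<otimes>\<^bsub>char_group UNIV\<^esub> \<phi> = \<one>\<^bsub>char_group UNIV\<^esub>"
      by (rule G.l_inv) (use \<phi> in simp)
    hence "(inv\<^bsub>char_group UNIV\<^esub> \<phi>) z * \<phi> z = trivial_char UNIV z"
      unfolding char_group_simps by metis
    thus ?case using z z0 e by (simp add: trivial_char_def)
  qed (use z in auto)
  ultimately show False using gen \<nu>(2) by (auto simp: \<eta>_def)
qed

text \<open>
The hypotheses on the hypersurface and on the generator \<open>\<phi>\<close> of the character group, without the choice
of a twist \<open>w\<close> and of additive characters.
\<close>
locale fermat_data =
  fixes d :: nat and h :: "'n::finite \<Rightarrow> nat" and lam :: "'a::finite_field" and \<phi> :: "'a \<Rightarrow> qbar"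
  assumes d_pos: "d > 0" and h_pos: "\<And>i. h i > 0" and sum_h: "(\<Sum>i\<in>UNIV. h i) = d"
    and Gcd_h: "Gcd (insert d (range h)) = 1" and dh_dvd: "\<And>i. d * h i dvd CARD('a) - 1"
    and \<phi>: "\<phi> \<in> mult_chars UNIV" and \<phi>_gen: "generate (char_group UNIV) {\<phi>} = mult_chars UNIV"
    and lam: "lam \<noteq> 0"
begin

lemma d_dvd: "d dvd CARD('a) - 1"
  using dh_dvd[of undefined] by (rule dvd_mult_left)

lemma gcd_h: "(\<And>i. d dvd m * h i) \<Longrightarrow> d dvd m"
proof -
  assume "\<And>i. d dvd m * h i"
  hence "d dvd Gcd ((*) m ` insert d (range h))" by (intro Gcd_greatest) auto
  also have "Gcd ((*) m ` insert d (range h)) = m" by (simp only: Gcd_mult Gcd_h) simp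
  finally show ?thesis .
qed

lemma \<phi>_eq_1_iff: "\<phi> z = 1 \<longleftrightarrow> z = 1"
  using generator_char_faithful[OF \<phi> \<phi>_gen] UNIV_char_simps(2)[OF \<phi>] by blast

lemma root_char_eq: "root_char \<phi> m y = (if y \<noteq> 0 then \<phi> y ^ ((CARD('a) - 1) div m) else 0)"
  unfolding root_char_def by (simp add: char_group_nat_pow[OF \<phi>])

lemma frob_norm_in_base:
  assumes "r > 0" "x \<in> ext_field r"
  shows "frob_norm CARD('a) r x \<in> (ext_field 1 :: 'a alg_closure set)"
proof -
  interpret finite_subfield "CARD('a) ^ 1" "ext_field 1 :: 'a alg_closure set"
    by (rule finite_subfield_ext_field) simp
  have "\<Prod>\<^sub># (frob_orbit CARD('a) r x) \<in> ext_field 1"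
    using prod_mset_stable_in_K[OF frob_stable_orbit, of x r] assms by (simp add: ext_field_def)
  thus ?thesis by (simp add: prod_frob_orbit)
qed

lemma lift_char_eq:
  "lift_char r (\<eta> :: 'a \<Rightarrow> qbar) x = (if x \<in> ext_field r then \<eta> (of_ac (frob_norm CARD('a) r x)) else 0)"
  by (simp add: lift_char_def ext_norm_def frob_norm_def)

lemma of_ac_mult: "x \<in> ext_field 1 \<Longrightarrow> y \<in> ext_field 1 \<Longrightarrow> of_ac (x * y) = of_ac x * (of_ac y :: 'a)"
  by (metis of_ac_to_ac to_ac_mult to_ac_of_ac_ext)

lemma of_ac_eq_0_iff: "x \<in> ext_field 1 \<Longrightarrow> (of_ac x :: 'a) = 0 \<longleftrightarrow> x = 0"
  by (metis of_ac_0 to_ac_0 to_ac_of_ac_ext)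

lemma lift_root_char:
  assumes "r > 0" "x \<in> ext_field r - {0}"
  shows "lift_char r (root_char \<phi> m) x = \<phi> (of_ac (frob_norm CARD('a) r x)) ^ ((CARD('a) - 1) div m)"
proof -
  have "of_ac (frob_norm CARD('a) r x) \<noteq> (0::'a)"
    using of_ac_eq_0_iff[OF frob_norm_in_base[OF assms(1), of x]] assms by (simp add: frob_norm_eq_0_iff)
  thus ?thesis using assms by (simp add: lift_char_eq root_char_eq)
qed

text \<open>
Since \<open>\<phi>\<close> is injective, the value of the lifted character is \<open>1\<close> exactly when a certain power of the norm
is \<open>1\<close>, and the norm is itself a power of its argument.
\<close>
lemma power_residue_lift:
  assumes r: "r > 0" and m: "m dvd CARD('a) - 1"
  shows "finite_subfield.power_residue_char (CARD('a) ^ r) (ext_field r) m (lift_char r (root_char \<phi> m))"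
proof -
  interpret finite_subfield "CARD('a) ^ r" "ext_field r :: 'a alg_closure set"
    by (rule finite_subfield_ext_field[OF r])
  let ?\<theta> = "lift_char r (root_char \<phi> m)"
  have "?\<theta> \<in> mult_chars (ext_field r)"
    unfolding mult_chars_def
  proof (intro CollectI conjI ballI allI impI)
    fix x y :: "'a alg_closure" assume x: "x \<in> ext_field r - {0}" and y: "y \<in> ext_field r - {0}"
    have xy: "x * y \<in> ext_field r - {0}" using x y by auto
    show "?\<theta> (x * y) = ?\<theta> x * ?\<theta> y"
      unfolding lift_root_char[OF r x] lift_root_char[OF r y] lift_root_char[OF r xy] frob_norm_mult
      using x y by (subst of_ac_mult) (auto intro!: frob_norm_in_base[OF r] simp: UNIV_char_simps[OF \<phi>] power_mult_distrib simp del: One_nat_def)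
  next
    fix x :: "'a alg_closure" assume x: "x \<in> ext_field r - {0}"
    have "of_ac (frob_norm CARD('a) r x) \<noteq> (0::'a)"
      using of_ac_eq_0_iff[OF frob_norm_in_base[OF r, of x]] x r by (simp add: frob_norm_eq_0_iff)
    thus "?\<theta> x \<noteq> 0" unfolding lift_root_char[OF r x] using UNIV_char_simps(4)[OF \<phi>] by simp
  next
    fix x :: "'a alg_closure" assume "x \<notin> ext_field r - {0}"
    thus "?\<theta> x = 0" using r by (auto simp: lift_char_eq root_char_eq frob_norm_def power_0_left prod_zero_iff)
  qed
  moreover have "?\<theta> x = 1 \<longleftrightarrow> x ^ ((CARD('a) ^ r - 1) div m) = 1" if x: "x \<in> ext_field r - {0}" for x
  proof -
    have N: "frob_norm CARD('a) r x \<in> ext_field 1" using frob_norm_in_base[OF r, of x] x by simp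
    have "?\<theta> x = \<phi> (of_ac (frob_norm CARD('a) r x) ^ ((CARD('a) - 1) div m))"
      unfolding lift_root_char[OF r x] UNIV_char_power[OF \<phi>] ..
    also have "\<dots> = 1 \<longleftrightarrow> of_ac (frob_norm CARD('a) r x) ^ ((CARD('a) - 1) div m) = (1::'a)" by (rule \<phi>_eq_1_iff)
    also have "\<dots> \<longleftrightarrow> frob_norm CARD('a) r x ^ ((CARD('a) - 1) div m) = 1"
      by (metis N to_ac_1 to_ac_eq_iff to_ac_of_ac_ext to_ac_power)
    also have "frob_norm CARD('a) r x ^ ((CARD('a) - 1) div m) = x ^ ((CARD('a) ^ r - 1) div m)"
      by (rule frob_norm_as_power(1)[OF CARD_gt_1 m])
    finally show ?thesis .
  qed
  ultimately show ?thesis by (simp add: power_residue_char_def)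
qed

abbreviation \<theta> where "\<theta> r \<equiv> lift_char r (root_char \<phi> d)"
abbreviation \<rho> where "\<rho> r i \<equiv> lift_char r (root_char \<phi> (d * h i))"

lemma hypergeom_data:
  fixes \<psi> :: "'a alg_closure \<Rightarrow> qbar" and w :: "'n \<Rightarrow> nat"
  assumes r: "r > 0" and \<psi>: "\<psi> \<in> nontrivial_add_chars (ext_field r)" and w: "d dvd (\<Sum>i\<in>UNIV. w i)"
  shows "hypergeom_data (CARD('a) ^ r) (ext_field r) \<psi> d h w (\<theta> r) (\<rho> r)"
proof -
  interpret finite_subfield "CARD('a) ^ r" "ext_field r :: 'a alg_closure set"
    by (rule finite_subfield_ext_field[OF r])
  have dvd: "m dvd CARD('a) ^ r - 1" if "m dvd CARD('a) - 1" for m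
    by (rule frob_norm_as_power(2)[OF CARD_gt_1 that])
  show ?thesis
  proof
    fix i and x :: "'a alg_closure" assume x: "x \<in> ext_field r - {0}"
    obtain k where k: "CARD('a) - 1 = d * h i * k" using dh_dvd[of i] by (elim dvdE)
    have "(CARD('a) - 1) div (d * h i) * h i = (CARD('a) - 1) div d" using k d_pos h_pos[of i] by simp
    thus "\<rho> r i x ^ h i = \<theta> r x"
      unfolding lift_root_char[OF r x] by (simp flip: power_mult)
  next
    show "power_residue_char d (\<theta> r)" by (rule power_residue_lift[OF r d_dvd])
    show "power_residue_char (d * h i) (\<rho> r i)" for i by (rule power_residue_lift[OF r dh_dvd])
    show "d dvd m" if "\<And>i. d dvd m * h i" for m by (rule gcd_h[OF that])
  qed (use d_pos h_pos sum_h \<psi> w dvd d_dvd dh_dvd in auto)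
qed

text \<open>
  A Jacobi sum of lifted characters is a power of the Jacobi sum over the small field, because it is a
  quotient of Gauss sums. The lifting relation concerns the additive character \<open>\<psi>1 \<circ> Tr\<close>; it
  applies to every \<open>\<psi>\<close>, since Jacobi sums involve no additive character.
\<close>
lemma J_val_lift:
  fixes \<psi> \<psi>1 :: "'a alg_closure \<Rightarrow> qbar" and w :: "'n \<Rightarrow> nat"
  assumes r: "r > 0" and \<psi>: "\<psi> \<in> nontrivial_add_chars (ext_field r)"
    and \<psi>1: "\<psi>1 \<in> nontrivial_add_chars (ext_field 1)"
    and w: "w \<in> W_set d" "\<exists>i. w i \<noteq> 0"
  shows "hypergeom_data.J_val (ext_field r) w (\<theta> r) = jacobi_w \<phi> d w ^ r"
proof -
  have ws: "d dvd (\<Sum>i\<in>UNIV. w i)" using w by (simp add: W_set_def)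
  interpret B: hypergeom_data "CARD('a) ^ 1" "ext_field 1 :: 'a alg_closure set" \<psi>1 d h w "\<theta> 1" "\<rho> 1"
    by (rule hypergeom_data[OF _ \<psi>1 ws]) simp
  define \<psi>' where "\<psi>' x = (if x \<in> ext_field r then \<psi>1 (frob_trace CARD('a) r x) else 0)" for x
  have tr_K: "frob_trace CARD('a) r x \<in> ext_field 1" if "x \<in> ext_field r" for x :: "'a alg_closure"
    using B.power_sum_stable_in_K[OF B.frob_stable_orbit, of x r 1] that power_sum_frob_orbit[of "CARD('a)" r x 1]
    by (simp add: ext_field_def)
  interpret A: finite_subfield "CARD('a) ^ r" "ext_field r :: 'a alg_closure set"
    by (rule finite_subfield_ext_field[OF r])
  have Er: "ext_field r = B.E r" by (simp add: ext_field_def)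
  have lift: "(\<Sum>x\<in>ext_field r. \<alpha> (frob_norm CARD('a) r x) * \<psi>' x) = - (gauss_sum (ext_field 1) \<psi>1 \<alpha> ^ r)"
    if \<alpha>: "\<alpha> \<in> mult_chars (ext_field 1)" for \<alpha>
  proof -
    have "(\<Sum>x\<in>ext_field r. \<alpha> (frob_norm CARD('a) r x) * \<psi>' x) = (\<Sum>x\<in>ext_field r. \<alpha> (frob_norm CARD('a) r x) * \<psi>1 (frob_trace CARD('a) r x))"
      by (intro sum.cong) (auto simp: \<psi>'_def)
    thus ?thesis using B.davenport_hasse_lifting[OF \<alpha> r] unfolding Er by simp
  qed
  have N0: "frob_norm CARD('a) r x \<in> ext_field 1 - {0}" if "x \<in> ext_field r - {0}" for x :: "'a alg_closure"
    using that frob_norm_in_base[OF r, of x] r by (simp add: frob_norm_eq_0_iff)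
  have lift': "gauss_sum (ext_field r) \<psi>' \<beta> = gauss_sum (ext_field 1) \<psi>1 \<alpha> ^ r"
    if \<alpha>: "\<alpha> \<in> mult_chars (ext_field 1)" and \<beta>: "\<And>x. x \<in> ext_field r - {0} \<Longrightarrow> \<beta> x = \<alpha> (frob_norm CARD('a) r x)" for \<alpha> \<beta>
  proof -
    have "(\<Sum>x\<in>ext_field r. \<alpha> (frob_norm CARD('a) r x) * \<psi>' x) = (\<Sum>x\<in>ext_field r - {0}. \<alpha> (frob_norm CARD('a) r x) * \<psi>' x)"
      using r \<alpha> frob_norm_eq_0_iff[OF r, of "CARD('a)" "0 :: 'a alg_closure"] by (intro sum.mono_neutral_right) auto
    also have "\<dots> = (\<Sum>x\<in>ext_field r - {0}. \<beta> x * \<psi>' x)" using \<beta> by (intro sum.cong) auto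
    finally have e: "(\<Sum>x\<in>ext_field r. \<alpha> (frob_norm CARD('a) r x) * \<psi>' x) = (\<Sum>x\<in>ext_field r - {0}. \<beta> x * \<psi>' x)" .
    show ?thesis unfolding gauss_sum_def[of "ext_field r"] e[symmetric] lift[OF \<alpha>] by (rule minus_minus)
  qed
  have "\<psi>' \<in> nontrivial_add_chars (ext_field r)"
    unfolding nontrivial_add_chars_def
  proof (intro CollectI conjI ballI)
    fix x y :: "'a alg_closure" assume x: "x \<in> ext_field r" and y: "y \<in> ext_field r"
    have "frob_trace CARD('a) r (x + y) = frob_trace CARD('a) r x + frob_trace CARD('a) r y"
    proof -
      have "(x + y) ^ (CARD('a) ^ i) = x ^ (CARD('a) ^ i) + y ^ (CARD('a) ^ i)" for i
        by (cases "i = 0") (use finite_subfield.frob_add[OF B.extension] in auto)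
      thus ?thesis by (simp add: frob_trace_def sum.distrib)
    qed
    thus "\<psi>' (x + y) = \<psi>' x * \<psi>' y"
      using x y tr_K by (simp add: \<psi>'_def A.K_add B.psi_add)
  next
    show "\<psi>' x \<noteq> 0" if "x \<in> ext_field r" for x using that tr_K B.psi_nonzero by (simp add: \<psi>'_def)
  next
    \<comment> \<open>otherwise the lifted Gauss sum of the trivial character would be \<open>1 - CARD('a) ^ r\<close> instead of \<open>1\<close>\<close>
    show "\<exists>x\<in>ext_field r. \<psi>' x \<noteq> 1"
    proof (rule ccontr)
      assume "\<not> ?thesis"
      hence one: "\<psi>' x = 1" if "x \<in> ext_field r" for x using that by blast
      have "gauss_sum (ext_field r) \<psi>' (trivial_char (ext_field r)) = gauss_sum (ext_field 1) \<psi>1 (trivial_char (ext_field 1)) ^ r"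
        by (rule lift'[OF B.trivial_char_K]) (use N0 in \<open>auto simp: trivial_char_def\<close>)
      moreover have "gauss_sum (ext_field r) \<psi>' (trivial_char (ext_field r)) = - (\<Sum>x\<in>(ext_field r :: 'a alg_closure set) - {0}. 1)"
      proof -
        have "(\<Sum>x\<in>ext_field r - {0}. trivial_char (ext_field r) x * \<psi>' x) = (\<Sum>x\<in>(ext_field r :: 'a alg_closure set) - {0}. 1)"
          by (rule sum.cong) (auto simp: one trivial_char_def)
        thus ?thesis unfolding gauss_sum_def by (rule arg_cong)
      qed
      ultimately have "- of_nat (CARD('a) ^ r - 1) = (1 :: qbar)" by (simp only: B.gauss_trivial power_one sum_constant A.card_K_units mult_1_right)
      hence "of_nat (CARD('a) ^ r - 1 + 1) = (0 :: qbar)" by (metis add.commute add.right_inverse neg_equal_iff_equal of_nat_1 of_nat_add)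
      thus False by (simp only: of_nat_eq_0_iff)
    qed
  qed
  then interpret C: hypergeom_data "CARD('a) ^ r" "ext_field r :: 'a alg_closure set" \<psi>' d h w "\<theta> r" "\<rho> r"
    by (rule hypergeom_data[OF r _ ws])
  have \<eta>_lift: "C.\<eta> i x = B.\<eta> i (frob_norm CARD('a) r x)" if x: "x \<in> ext_field r - {0}" for i x
  proof -
    have N: "frob_norm CARD('a) r x \<in> ext_field 1 - {0}" by (rule N0[OF x])
    have "\<theta> 1 (frob_norm CARD('a) r x) = \<theta> r x"
      using lift_root_char[OF r x] lift_root_char[OF _ N] by (simp add: frob_norm_def)
    thus ?thesis unfolding C.\<eta>_def B.\<eta>_def A.char_pow_def B.char_pow_def using x N by simp
  qed
  have G: "C.G_prod = B.G_prod ^ r"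
    unfolding C.G_prod_def B.G_prod_def prod_power_distrib using lift'[OF B.\<eta>_in \<eta>_lift] by simp
  obtain i0 where i0: "w i0 \<noteq> 0" "w i0 < d" using w by (auto simp: W_set_def)
  hence ndvd: "\<not> d dvd w i0" by (auto dest: dvd_imp_le)
  have "\<not> (\<forall>i. C.\<eta> i = trivial_char (ext_field r))" "\<not> (\<forall>i. B.\<eta> i = trivial_char (ext_field 1))"
    using ndvd A.residue_char_pow_trivial[OF C.\<theta> C.d] B.residue_char_pow_trivial[OF B.\<theta> B.d]
    unfolding C.\<eta>_def B.\<eta>_def by blast+
  note J = C.J_val_eq[OF this(1)] B.J_val_eq[OF this(2)]
  have "C.J_val = B.J_val ^ r" unfolding J G by (simp only: power_divide power_one_right of_nat_power)
  also have "B.J_val = jacobi_w \<phi> d w"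
  proof -
    let ?e = "\<lambda>i. root_char \<phi> d [^]\<^bsub>char_group UNIV\<^esub> w i"
    have rc: "root_char \<phi> d \<in> mult_chars UNIV"
      unfolding root_char_def char_group_nat_pow[OF \<phi>] by (rule mult_chars_power[OF UNIV_char_closed \<phi>])
    have ev: "B.\<eta> i (to_ac y) = ?e i y" for i y
    proof (cases "y = 0")
      case False
      hence "to_ac y \<in> ext_field 1 - {0}" by (simp add: to_ac_in_ext_field)
      thus ?thesis unfolding B.\<eta>_def B.char_pow_def char_group_nat_pow[OF rc]
        using False lift_root_char[of 1 "to_ac y" d] by (simp add: root_char_eq frob_norm_def)
    next
      case True
      thus ?thesis unfolding B.\<eta>_def B.char_pow_def char_group_nat_pow[OF rc] by simp
    qed
    have "jacobi_at (ext_field 1) B.\<eta> 1 = (\<Sum>x | (\<forall>i. x i \<noteq> 0) \<and> (\<Sum>i\<in>UNIV. x i) = 1. \<Prod>i\<in>UNIV. ?e i (x i))"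
      unfolding jacobi_at_def
    proof (rule sum.reindex_bij_witness[of _ "\<lambda>x i. to_ac (x i)" "\<lambda>x i. of_ac (x i)"], goal_cases)
      case (2 x)
      have "to_ac (\<Sum>i\<in>UNIV. of_ac (x i) :: 'a) = to_ac 1"
        using 2 by (simp add: to_ac_sum to_ac_of_ac_ext)
      thus ?case using 2 of_ac_eq_0_iff by (auto simp: to_ac_eq_iff)
    next
      case (4 x)
      thus ?case by (auto simp: to_ac_in_ext_field to_ac_sum[symmetric])
    next
      case (5 x)
      thus ?case by (simp add: ev[symmetric] to_ac_of_ac_ext)
    qed (auto simp: to_ac_of_ac_ext)
    thus ?thesis unfolding B.J_val_def jacobi_w_def jacobi_sum_def by (rule arg_cong)
  qed
  finally show ?thesis .
qed

end

section \<open>Counting twisted fixed points by character sums\<close>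

context fermat_data
begin

definition mu :: "'a set" where "mu = {\<zeta>. \<zeta> ^ d = 1}"

lemma mu_nonzero: "\<zeta> \<in> mu \<Longrightarrow> \<zeta> \<noteq> 0"
  using d_pos by (auto simp: mu_def power_0_left)

lemma of_nat_d_nonzero: "of_nat d \<noteq> (0 :: 'a alg_closure)"
proof -
  interpret finite_subfield "CARD('a) ^ 1" "ext_field 1 :: 'a alg_closure set"
    by (rule finite_subfield_ext_field) simp
  show ?thesis using of_nat_dvd_nonzero[of d] d_dvd by simp
qed

lemma root_of_unity_cases:
  assumes "x ^ d = (1 :: 'a alg_closure)"
  obtains \<zeta> where "\<zeta> \<in> mu" "x = to_ac \<zeta>"
proof -
  interpret finite_subfield "CARD('a) ^ 1" "ext_field 1 :: 'a alg_closure set"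
    by (rule finite_subfield_ext_field) simp
  obtain k where "CARD('a) - 1 = d * k" using d_dvd by (elim dvdE)
  hence "x ^ (CARD('a) ^ 1 - 1) = 1" using assms by (simp add: power_mult)
  hence "x \<in> ext_field 1" using K_units_eq by blast
  hence x: "to_ac (of_ac x :: 'a) = x" by (rule to_ac_of_ac_ext)
  have "to_ac ((of_ac x :: 'a) ^ d) = 1" unfolding to_ac_power x by (rule assms)
  hence "of_ac x \<in> mu" by (simp add: mu_def del: to_ac_power)
  thus thesis using that x by metis
qed

lemma finite_mu [simp]: "finite mu"
  by simp

lemma card_mu: "card mu = d"
proof -
  have "to_ac ` mu = {x :: 'a alg_closure. x ^ d = 1}"
  proof (intro equalityI subsetI)
    fix x :: "'a alg_closure" assume "x \<in> {x. x ^ d = 1}"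
    thus "x \<in> to_ac ` mu" by (auto elim: root_of_unity_cases)
  next
    fix x :: "'a alg_closure" assume "x \<in> to_ac ` mu"
    thus "x \<in> {x. x ^ d = 1}" by (auto simp: mu_def to_ac_power[symmetric] simp del: to_ac_power)
  qed
  moreover have "card (to_ac ` mu) = card mu" by (rule card_image) (meson inj_on_subset inj_to_ac subset_UNIV)
  ultimately show ?thesis using card_roots_of_power(1)[OF of_nat_d_nonzero, of 1] by simp
qed

lemma \<phi>_mu_power: "\<zeta> \<in> mu \<Longrightarrow> \<phi> \<zeta> ^ d = 1"
  using UNIV_char_power[OF \<phi>, of \<zeta> d] UNIV_char_simps(2)[OF \<phi>] by (simp add: mu_def)

lemma \<theta>_as_mu:
  assumes r: "r > 0" and u: "u \<in> ext_field r - {0}"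
  obtains z where "z \<in> mu" "to_ac z = u ^ ((CARD('a) ^ r - 1) div d)" "\<theta> r u = \<phi> z"
proof -
  interpret finite_subfield "CARD('a) ^ r" "ext_field r :: 'a alg_closure set"
    by (rule finite_subfield_ext_field[OF r])
  define z where "z = (of_ac (frob_norm CARD('a) r u) :: 'a) ^ ((CARD('a) - 1) div d)"
  have N: "frob_norm CARD('a) r u \<in> ext_field 1" using frob_norm_in_base[OF r, of u] u by simp
  have z: "to_ac z = u ^ ((CARD('a) ^ r - 1) div d)"
    using frob_norm_as_power(1)[OF CARD_gt_1 d_dvd, of r u] to_ac_of_ac_ext[OF N] by (simp add: z_def)
  have "to_ac z ^ d = u ^ (CARD('a) ^ r - 1)"
    using frob_norm_as_power(2)[OF CARD_gt_1 d_dvd, of r] by (simp add: z power_mult[symmetric])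
  also have "\<dots> = 1" using u K_units_eq by blast
  finally have "to_ac (z ^ d) = 1" by simp
  hence "z \<in> mu" by (simp add: mu_def del: to_ac_power)
  moreover have "\<theta> r u = \<phi> z" unfolding lift_root_char[OF r u] z_def UNIV_char_power[OF \<phi>] ..
  ultimately show thesis using z that by blast
qed

lemma sum_mu_char: "(\<Sum>\<zeta>\<in>mu. \<phi> \<zeta> ^ a) = (if d dvd a then of_nat d else 0)"
proof (cases "d dvd a")
  case True
  then obtain k where "a = d * k" by (elim dvdE)
  hence "(\<Sum>\<zeta>\<in>mu. \<phi> \<zeta> ^ a) = (\<Sum>\<zeta>\<in>mu. 1)" by (intro sum.cong) (auto simp: power_mult \<phi>_mu_power)
  thus ?thesis using True card_mu by simp
next
  case False
  interpret finite_subfield "CARD('a) ^ 1" "ext_field 1 :: 'a alg_closure set"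
    by (rule finite_subfield_ext_field) simp
  have \<theta>: "power_residue_char d (\<theta> 1)" by (rule power_residue_lift[OF _ d_dvd]) simp
  have "char_pow (\<theta> 1) a \<noteq> trivial_char (ext_field 1)"
    using residue_char_pow_trivial[OF \<theta> d_pos, of a] False d_dvd by simp
  then obtain x where x: "x \<in> ext_field 1 - {0}" "\<theta> 1 x ^ a \<noteq> 1"
    unfolding char_pow_trivial_iff[OF power_residue_char_in[OF \<theta>]] by blast
  then obtain z where z: "z \<in> mu" "\<phi> z ^ a \<noteq> 1" by (metis \<theta>_as_mu zero_less_one)
  have z0: "z \<noteq> 0" using z(1) by (rule mu_nonzero)
  have "(\<Sum>\<zeta>\<in>mu. \<phi> \<zeta> ^ a) = (\<Sum>\<zeta>\<in>mu. \<phi> (z * \<zeta>) ^ a)"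
    by (rule sum.reindex_bij_witness[of _ "\<lambda>\<zeta>. z * \<zeta>" "\<lambda>\<zeta>. \<zeta> / z"])
       (use z z0 in \<open>auto simp: mu_def power_mult_distrib power_divide\<close>)
  also have "\<dots> = \<phi> z ^ a * (\<Sum>\<zeta>\<in>mu. \<phi> \<zeta> ^ a)"
    by (simp add: UNIV_char_simps[OF \<phi>] power_mult_distrib sum_distrib_left)
  finally show ?thesis using z False by simp
qed

lemma sum_char_powers:
  assumes "\<zeta> \<in> mu"
  shows "(\<Sum>m<d. \<phi> \<zeta> ^ m) = (if \<zeta> = 1 then of_nat d else 0)"
proof (cases "\<zeta> = 1")
  case False
  have "(\<phi> \<zeta> - 1) * (\<Sum>m<d. \<phi> \<zeta> ^ m) = 0"
    using \<phi>_mu_power[OF assms] by (simp add: power_diff_1_eq[symmetric])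
  thus ?thesis using False \<phi>_eq_1_iff by simp
qed (simp add: UNIV_char_simps[OF \<phi>])

definition mu_tuples :: "('n \<Rightarrow> 'a) set" where "mu_tuples = {\<xi>. \<forall>i. \<xi> i \<in> mu}"

lemma prod_mu: "\<xi> \<in> mu_tuples \<Longrightarrow> (\<Prod>i\<in>UNIV. \<xi> i ^ k i) \<in> mu"
  by (auto simp: mu_def mu_tuples_def prod_power_distrib power_mult[symmetric] mult.commute)
     (simp add: power_mult)

lemma finite_mu_tuples: "finite mu_tuples"
  unfolding mu_tuples_def by (rule finite_funs) simp

lemma \<phi>_prod_power: "\<phi> (\<Prod>i\<in>UNIV. \<xi> i ^ k i) = (\<Prod>i\<in>UNIV. \<phi> (\<xi> i) ^ k i)"
  by (simp add: UNIV_char_prod[OF \<phi>] UNIV_char_power[OF \<phi>])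

lemma CARD_n: "CARD('n) = Suc (CARD('n) - 1)"
  by simp

lemma power_CARD_n: "(x :: qbar) ^ CARD('n) = x * x ^ (CARD('n) - 1)"
  using power_Suc[of x "CARD('n) - 1"] CARD_n by simp

text \<open>
The number of solutions is a sum over the characters of \<open>mu\<close>; since the \<open>h i\<close> and \<open>d\<close> have no common factor, only the
trivial one contributes.
\<close>
lemma card_mu_fiber:
  assumes \<zeta>: "\<zeta> \<in> mu"
  shows "card {\<xi> \<in> mu_tuples. (\<Prod>i\<in>UNIV. \<xi> i ^ h i) = \<zeta>} = d ^ (CARD('n) - 1)"
proof -
  let ?p = "\<lambda>\<xi> :: 'n \<Rightarrow> 'a. \<Prod>i\<in>UNIV. \<xi> i ^ h i"
  have \<zeta>0: "\<zeta> \<noteq> 0" using \<zeta> by (rule mu_nonzero)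
  have "of_nat d * of_nat (card {\<xi> \<in> mu_tuples. ?p \<xi> = \<zeta>}) = (\<Sum>\<xi>\<in>mu_tuples. if ?p \<xi> = \<zeta> then of_nat d else (0::qbar))"
    using finite_mu_tuples by (simp add: sum.inter_filter[symmetric] mult.commute)
  also have "\<dots> = (\<Sum>\<xi>\<in>mu_tuples. \<Sum>m<d. \<phi> (inverse \<zeta>) ^ m * (\<Prod>i\<in>UNIV. \<phi> (\<xi> i) ^ (m * h i)))"
  proof (rule sum.cong[OF refl])
    fix \<xi> assume \<xi>: "\<xi> \<in> mu_tuples"
    have "inverse \<zeta> * ?p \<xi> \<in> mu"
      using \<zeta> prod_mu[OF \<xi>, of h] by (auto simp: mu_def power_mult_distrib power_inverse)
    from sum_char_powers[OF this]
    have "(if ?p \<xi> = \<zeta> then of_nat d else (0::qbar)) = (\<Sum>m<d. \<phi> (inverse \<zeta> * ?p \<xi>) ^ m)"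
      using \<zeta>0 by (auto simp: field_simps)
    also have "\<dots> = (\<Sum>m<d. \<phi> (inverse \<zeta>) ^ m * (\<Prod>i\<in>UNIV. \<phi> (\<xi> i) ^ (m * h i)))"
      by (simp add: UNIV_char_simps[OF \<phi>] \<phi>_prod_power power_mult_distrib prod_power_distrib power_mult[symmetric] mult.commute)
    finally show "(if ?p \<xi> = \<zeta> then of_nat d else (0::qbar)) = \<dots>" .
  qed
  also have "\<dots> = (\<Sum>m<d. \<phi> (inverse \<zeta>) ^ m * (\<Prod>i\<in>(UNIV::'n set). \<Sum>z\<in>mu. \<phi> z ^ (m * h i)))"
    by (subst sum.swap) (simp add: prod_sum_funs mu_tuples_def sum_distrib_left)
  also have "\<dots> = (\<Sum>m<d. if m = 0 then of_nat d ^ CARD('n) else 0)"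
  proof (rule sum.cong[OF refl])
    fix m assume m: "m \<in> {..<d}"
    show "\<phi> (inverse \<zeta>) ^ m * (\<Prod>i\<in>(UNIV::'n set). \<Sum>z\<in>mu. \<phi> z ^ (m * h i)) = (if m = 0 then of_nat d ^ CARD('n) else 0)"
    proof (cases "m = 0")
      case True thus ?thesis by (simp add: card_mu)
    next
      case False
      hence "\<not> d dvd m" using m by (auto dest: dvd_imp_le)
      then obtain i where "\<not> d dvd m * h i" using gcd_h[of m] by blast
      hence "(\<Prod>i\<in>(UNIV::'n set). \<Sum>z\<in>mu. \<phi> z ^ (m * h i)) = 0"
        unfolding sum_mu_char by (intro prod_zero) auto
      thus ?thesis using False by simp
    qed
  qed
  also have "\<dots> = of_nat d * of_nat (d ^ (CARD('n) - 1))"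
    using d_pos by (subst CARD_n) (simp add: sum.delta del: Suc_pred)
  finally have "of_nat (card {\<xi> \<in> mu_tuples. ?p \<xi> = \<zeta>}) = (of_nat (d ^ (CARD('n) - 1)) :: qbar)"
    using d_pos by simp
  thus ?thesis by (simp only: of_nat_eq_iff)
qed

text \<open>
The affine representatives, normalized such that the Frobenius map acts on each coordinate as
multiplication by \<open>\<xi> i\<close>.
\<close>
definition twisted_points :: "nat \<Rightarrow> ('n \<Rightarrow> 'a) \<Rightarrow> ('n \<Rightarrow> 'a alg_closure) set" where
  "twisted_points r \<xi> = {x. x \<noteq> (\<lambda>i. 0) \<and> (\<forall>i. x i ^ (CARD('a) ^ r) = to_ac (\<xi> i) * x i) \<and>
     (\<Sum>i\<in>UNIV. x i ^ d) = of_nat d * to_ac lam * (\<Prod>i\<in>UNIV. x i ^ h i)}"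

definition G_elems :: "('n \<Rightarrow> 'a) set" where
  "G_elems = {\<xi> \<in> mu_tuples. (\<Prod>i\<in>UNIV. \<xi> i ^ h i) = 1}"

text \<open>
The value at \<open>0\<close> records that a vanishing coordinate leaves its twist \<open>\<xi> i\<close> free: the sum of
\<open>\<phi> (\<xi> i) ^ a\<close> over all \<open>\<xi> i\<close> vanishes unless \<open>d\<close> divides \<open>a\<close>.
\<close>
definition e_char :: "nat \<Rightarrow> nat \<Rightarrow> 'a alg_closure \<Rightarrow> qbar" where
  "e_char r a u = (if u = 0 then (if d dvd a then 1 else 0) else \<theta> r u ^ a)"

lemma twist_power_in_ext:
  assumes "\<zeta> \<in> mu" "x ^ (CARD('a) ^ r) = to_ac \<zeta> * x"
  shows "x ^ d \<in> ext_field r"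
proof -
  have "(x ^ d) ^ (CARD('a) ^ r) = (to_ac \<zeta> * x) ^ d" by (metis assms(2) mult.commute power_mult)
  also have "\<dots> = to_ac (\<zeta> ^ d) * x ^ d" by (simp add: power_mult_distrib)
  also have "\<zeta> ^ d = 1" using assms(1) by (simp add: mu_def)
  finally show ?thesis by (simp add: ext_field_def)
qed

lemma twist_unique:
  assumes r: "r > 0" and x: "x \<noteq> 0" "x ^ d \<in> ext_field r"
  obtains z where "z \<in> mu" "to_ac z = x ^ (CARD('a) ^ r - 1)" "\<phi> z = \<theta> r (x ^ d)"
    "\<And>\<zeta>. x ^ (CARD('a) ^ r) = to_ac \<zeta> * x \<longleftrightarrow> \<zeta> = z"
proof -
  have dv: "d dvd CARD('a) ^ r - 1" by (rule frob_norm_as_power(2)[OF CARD_gt_1 d_dvd])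
  have xd: "x ^ d \<in> ext_field r - {0}" using x by simp
  obtain z where z: "z \<in> mu" "to_ac z = (x ^ d) ^ ((CARD('a) ^ r - 1) div d)" "\<theta> r (x ^ d) = \<phi> z"
    using \<theta>_as_mu[OF r xd] by blast
  have zx: "to_ac z = x ^ (CARD('a) ^ r - 1)" using z(2) dv by (simp add: power_mult[symmetric])
  have "x ^ (CARD('a) ^ r) = x ^ (CARD('a) ^ r - 1) * x"
    using CARD_gt_1[where ?'a = 'a] by (metis power_minus_mult zero_less_power zero_less_card_finite)
  hence "x ^ (CARD('a) ^ r) = to_ac \<zeta> * x \<longleftrightarrow> \<zeta> = z" for \<zeta>
    using x(1) zx[symmetric] by (auto simp: to_ac_eq_iff)
  thus thesis using that z zx by metis
qed

lemma sum_compatible: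
  assumes r: "r > 0" and x: "x ^ d \<in> ext_field r"
  shows "(\<Sum>\<zeta>\<in>mu. if x ^ (CARD('a) ^ r) = to_ac \<zeta> * x then \<phi> \<zeta> ^ a else 0) =
    (if x = 0 then of_nat d else 1) * e_char r a (x ^ d)"
proof (cases "x = 0")
  case True
  thus ?thesis using d_pos by (simp add: sum_mu_char e_char_def power_0_left)
next
  case False
  obtain z where z: "z \<in> mu" "\<phi> z = \<theta> r (x ^ d)" "\<And>\<zeta>. x ^ (CARD('a) ^ r) = to_ac \<zeta> * x \<longleftrightarrow> \<zeta> = z"
    using twist_unique[OF r False x] by metis
  thus ?thesis using False by (simp add: sum.delta e_char_def)
qed

lemma sum_dth_roots:
  assumes "u \<in> ext_field r"
  shows "(\<Sum>x | x ^ d = u. (if x = 0 then of_nat d else 1) * e_char r a (x ^ d)) = of_nat d * e_char r a u"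
proof (cases "u = 0")
  case True
  hence "{x. x ^ d = u} = {0}" using d_pos by auto
  thus ?thesis using True d_pos by (simp add: power_0_left)
next
  case False
  have "(\<Sum>x | x ^ d = u. (if x = 0 then of_nat d else 1) * e_char r a (x ^ d)) = (\<Sum>x | x ^ d = u. e_char r a u)"
    using False d_pos by (intro sum.cong) (auto simp: power_0_left)
  also have "\<dots> = of_nat d * e_char r a u" using card_roots_of_power[OF of_nat_d_nonzero False] by simp
  finally show ?thesis .
qed

lemma finite_dth_roots: "finite {x :: 'a alg_closure. x ^ d = u}"
proof (cases "u = 0")
  case True
  hence "{x. x ^ d = u} \<subseteq> {0}" using d_pos by auto
  thus ?thesis by (rule finite_subset) simp
qed (rule card_roots_of_power(2)[OF of_nat_d_nonzero])

lemma finite_power_in_ext: "r > 0 \<Longrightarrow> finite {x :: 'a alg_closure. x ^ d \<in> ext_field r}"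
proof -
  assume r: "r > 0"
  interpret finite_subfield "CARD('a) ^ r" "ext_field r :: 'a alg_closure set"
    by (rule finite_subfield_ext_field[OF r])
  have "{x :: 'a alg_closure. x ^ d \<in> ext_field r} = (\<Union>u\<in>ext_field r. {x. x ^ d = u})" by auto
  thus ?thesis using finite_dth_roots by simp
qed

definition degenerate_sum :: "nat \<Rightarrow> ('n \<Rightarrow> nat) \<Rightarrow> qbar" where
  "degenerate_sum r a = (\<Sum>u | (\<forall>i. u i \<in> ext_field r) \<and> u \<noteq> (\<lambda>i. 0) \<and> (\<exists>i. u i = 0) \<and> (\<Sum>i\<in>UNIV. u i) = 0.
     \<Prod>i\<in>UNIV. e_char r (a i) (u i))"

text \<open>
The condition \<open>\<Prod>i. \<xi> i ^ h i = 1\<close> is detected by the characters of \<open>mu\<close>. It adds \<open>m * h\<close> to the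
exponents \<open>w\<close>; after that the coordinates separate.
\<close>
lemma degenerate_points:
  assumes r: "r > 0"
  shows "(\<Sum>\<xi>\<in>G_elems. \<phi> (\<Prod>i\<in>UNIV. \<xi> i ^ w i) * of_nat (card {x \<in> twisted_points r \<xi>. \<exists>i. x i = 0})) =
    of_nat d ^ (CARD('n) - 1) * (\<Sum>m<d. degenerate_sum r (\<lambda>i. w i + m * h i))"
proof -
  define Y :: "('n \<Rightarrow> 'a alg_closure) set" where "Y = {x. (\<forall>i. x i ^ d \<in> ext_field r) \<and> x \<noteq> (\<lambda>i. 0) \<and> (\<exists>i. x i = 0) \<and> (\<Sum>i\<in>UNIV. x i ^ d) = 0}"
  define U :: "('n \<Rightarrow> 'a alg_closure) set" where "U = {u. (\<forall>i. u i \<in> ext_field r) \<and> u \<noteq> (\<lambda>i. 0) \<and> (\<exists>i. u i = 0) \<and> (\<Sum>i\<in>UNIV. u i) = 0}"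
  define c where "c \<xi> x \<longleftrightarrow> (\<forall>i. x i ^ (CARD('a) ^ r) = to_ac (\<xi> i) * x i)" for \<xi> :: "'n \<Rightarrow> 'a" and x
  interpret finite_subfield "CARD('a) ^ r" "ext_field r :: 'a alg_closure set"
    by (rule finite_subfield_ext_field[OF r])
  have fY: "finite Y"
    by (rule finite_subset[OF _ finite_funs[OF finite_power_in_ext[OF r]]]) (auto simp: Y_def)
  have fU: "finite U" by (rule finite_subset[OF _ finite_funs[OF finite_K]]) (auto simp: U_def)
  have pts: "{x \<in> twisted_points r \<xi>. \<exists>i. x i = 0} = {x \<in> Y. c \<xi> x}" if "\<xi> \<in> mu_tuples" for \<xi>
  proof -
    have "(\<Prod>i\<in>UNIV. x i ^ h i) = 0" if "x i = 0" for x :: "'n \<Rightarrow> 'a alg_closure" and i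
      using that h_pos[of i] by (intro prod_zero) (auto intro!: bexI[of _ i] simp: power_0_left)
    hence P: "(\<exists>i. x i = 0) \<Longrightarrow> (\<Prod>i\<in>UNIV. x i ^ h i) = 0" for x :: "'n \<Rightarrow> 'a alg_closure" by blast
    show ?thesis
    proof (rule Collect_cong)
      fix x :: "'n \<Rightarrow> 'a alg_closure"
      have e: "\<forall>i. x i ^ d \<in> ext_field r" if "c \<xi> x"
        using that \<open>\<xi> \<in> mu_tuples\<close> twist_power_in_ext[of "\<xi> _" "x _" r] by (auto simp: c_def mu_tuples_def)
      show "(x \<in> twisted_points r \<xi> \<and> (\<exists>i. x i = 0)) = (x \<in> Y \<and> c \<xi> x)"
      proof (cases "(\<exists>i. x i = 0) \<and> c \<xi> x")
        case True
        hence p: "(\<Prod>i\<in>UNIV. x i ^ h i) = 0" using P by blast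
        show ?thesis unfolding twisted_points_def Y_def c_def[symmetric] mem_Collect_eq p mult_zero_right
          using e True by blast
      next
        case False
        thus ?thesis by (auto simp: twisted_points_def Y_def c_def)
      qed
    qed
  qed
  have "of_nat d * (\<Sum>\<xi>\<in>G_elems. \<phi> (\<Prod>i\<in>UNIV. \<xi> i ^ w i) * of_nat (card {x \<in> twisted_points r \<xi>. \<exists>i. x i = 0})) =
      (\<Sum>\<xi>\<in>mu_tuples. (if (\<Prod>i\<in>UNIV. \<xi> i ^ h i) = 1 then of_nat d else 0) * (\<phi> (\<Prod>i\<in>UNIV. \<xi> i ^ w i) * of_nat (card {x \<in> Y. c \<xi> x})))"
    unfolding sum_distrib_left G_elems_def
    by (subst sum.inter_filter[OF finite_mu_tuples]) (auto intro!: sum.cong simp: pts)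
  also have "\<dots> = (\<Sum>\<xi>\<in>mu_tuples. \<Sum>m<d. \<Sum>x\<in>Y. if c \<xi> x then (\<Prod>i\<in>UNIV. \<phi> (\<xi> i) ^ (w i + m * h i)) else 0)"
  proof (rule sum.cong[OF refl])
    fix \<xi> assume \<xi>: "\<xi> \<in> mu_tuples"
    have "(\<Sum>m<d. \<Sum>x\<in>Y. if c \<xi> x then (\<Prod>i\<in>UNIV. \<phi> (\<xi> i) ^ (w i + m * h i)) else 0) =
      (\<Sum>m<d. \<phi> (\<Prod>i\<in>UNIV. \<xi> i ^ h i) ^ m * (\<phi> (\<Prod>i\<in>UNIV. \<xi> i ^ w i) * of_nat (card {x \<in> Y. c \<xi> x})))"
    proof (rule sum.cong[OF refl])
      fix m
      have "(\<Prod>i\<in>UNIV. \<phi> (\<xi> i) ^ (w i + m * h i)) = \<phi> (\<Prod>i\<in>UNIV. \<xi> i ^ w i) * \<phi> (\<Prod>i\<in>UNIV. \<xi> i ^ h i) ^ m"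
        by (simp add: \<phi>_prod_power power_add prod.distrib prod_power_distrib power_mult[symmetric] mult.commute)
      thus "(\<Sum>x\<in>Y. if c \<xi> x then (\<Prod>i\<in>UNIV. \<phi> (\<xi> i) ^ (w i + m * h i)) else 0) =
        \<phi> (\<Prod>i\<in>UNIV. \<xi> i ^ h i) ^ m * (\<phi> (\<Prod>i\<in>UNIV. \<xi> i ^ w i) * of_nat (card {x \<in> Y. c \<xi> x}))"
        using fY by (simp add: sum.inter_filter[symmetric])
    qed
    also have "\<dots> = (\<Sum>m<d. \<phi> (\<Prod>i\<in>UNIV. \<xi> i ^ h i) ^ m) * (\<phi> (\<Prod>i\<in>UNIV. \<xi> i ^ w i) * of_nat (card {x \<in> Y. c \<xi> x}))"
      by (rule sum_distrib_right[symmetric])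
    finally show "(if (\<Prod>i\<in>UNIV. \<xi> i ^ h i) = 1 then of_nat d else 0) * (\<phi> (\<Prod>i\<in>UNIV. \<xi> i ^ w i) * of_nat (card {x \<in> Y. c \<xi> x})) =
      (\<Sum>m<d. \<Sum>x\<in>Y. if c \<xi> x then (\<Prod>i\<in>UNIV. \<phi> (\<xi> i) ^ (w i + m * h i)) else 0)"
      using sum_char_powers[OF prod_mu[OF \<xi>, of h]] by simp
  qed
  also have "\<dots> = (\<Sum>m<d. \<Sum>x\<in>Y. \<Sum>\<xi>\<in>mu_tuples. if c \<xi> x then (\<Prod>i\<in>UNIV. \<phi> (\<xi> i) ^ (w i + m * h i)) else 0)"
    by (subst sum.swap, intro sum.cong refl, rule sum.swap)
  also have "\<dots> = (\<Sum>m<d. of_nat d ^ CARD('n) * degenerate_sum r (\<lambda>i. w i + m * h i))"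
  proof (rule sum.cong[OF refl])
    fix m
    define a where "a i = w i + m * h i" for i
    have "(\<Sum>x\<in>Y. \<Sum>\<xi>\<in>mu_tuples. if c \<xi> x then (\<Prod>i\<in>UNIV. \<phi> (\<xi> i) ^ a i) else 0) =
      (\<Sum>x\<in>Y. \<Prod>i\<in>UNIV. (if x i = 0 then of_nat d else 1) * e_char r (a i) (x i ^ d))"
    proof (rule sum.cong[OF refl])
      fix x assume x: "x \<in> Y"
      have "(\<Sum>\<xi>\<in>mu_tuples. if c \<xi> x then (\<Prod>i\<in>UNIV. \<phi> (\<xi> i) ^ a i) else 0) =
        (\<Sum>\<xi>\<in>mu_tuples. \<Prod>i\<in>UNIV. if x i ^ (CARD('a) ^ r) = to_ac (\<xi> i) * x i then \<phi> (\<xi> i) ^ a i else 0)"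
        by (intro sum.cong refl) (auto simp: c_def prod_zero_iff)
      also have "\<dots> = (\<Prod>i\<in>UNIV. \<Sum>\<zeta>\<in>mu. if x i ^ (CARD('a) ^ r) = to_ac \<zeta> * x i then \<phi> \<zeta> ^ a i else 0)"
        unfolding mu_tuples_def by (rule prod_sum_funs[symmetric]) simp
      also have "\<dots> = (\<Prod>i\<in>UNIV. (if x i = 0 then of_nat d else 1) * e_char r (a i) (x i ^ d))"
        using x by (intro prod.cong refl sum_compatible[OF r]) (simp add: Y_def)
      finally show "(\<Sum>\<xi>\<in>mu_tuples. if c \<xi> x then (\<Prod>i\<in>UNIV. \<phi> (\<xi> i) ^ a i) else 0) = \<dots>" .
    qed
    also have "\<dots> = (\<Sum>u\<in>U. \<Sum>x | x \<in> Y \<and> (\<lambda>i. x i ^ d) = u. \<Prod>i\<in>UNIV. (if x i = 0 then of_nat d else 1) * e_char r (a i) (x i ^ d))"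
      using d_pos by (intro sum.group[symmetric] fY fU) (auto simp: Y_def U_def fun_eq_iff power_0_left)
    also have "\<dots> = (\<Sum>u\<in>U. \<Prod>i\<in>UNIV. \<Sum>y | y ^ d = u i. (if y = 0 then of_nat d else 1) * e_char r (a i) (y ^ d))"
    proof (rule sum.cong[OF refl])
      fix u assume u: "u \<in> U"
      have eq: "{x. x \<in> Y \<and> (\<lambda>i. x i ^ d) = u} = PiE UNIV (\<lambda>i. {y. y ^ d = u i})"
        using u d_pos by (auto simp: Y_def U_def fun_eq_iff PiE_UNIV_domain Pi_def power_0_left) (metis power_eq_0_iff)+
      show "(\<Sum>x | x \<in> Y \<and> (\<lambda>i. x i ^ d) = u. \<Prod>i\<in>UNIV. (if x i = 0 then of_nat d else 1) * e_char r (a i) (x i ^ d)) =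
        (\<Prod>i\<in>UNIV. \<Sum>y | y ^ d = u i. (if y = 0 then of_nat d else 1) * e_char r (a i) (y ^ d))"
        unfolding eq by (rule prod_sum_PiE[symmetric]) (simp_all add: finite_dth_roots)
    qed
    also have "\<dots> = (\<Sum>u\<in>U. \<Prod>i\<in>UNIV. of_nat d * e_char r (a i) (u i))"
      by (intro sum.cong prod.cong refl sum_dth_roots) (simp add: U_def)
    also have "\<dots> = of_nat d ^ CARD('n) * degenerate_sum r a"
      by (simp add: prod.distrib sum_distrib_left degenerate_sum_def U_def)
    finally show "(\<Sum>x\<in>Y. \<Sum>\<xi>\<in>mu_tuples. if c \<xi> x then (\<Prod>i\<in>UNIV. \<phi> (\<xi> i) ^ (w i + m * h i)) else 0) =
      of_nat d ^ CARD('n) * degenerate_sum r (\<lambda>i. w i + m * h i)" unfolding a_def .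
  qed
  also have "\<dots> = of_nat d * (of_nat d ^ (CARD('n) - 1) * (\<Sum>m<d. degenerate_sum r (\<lambda>i. w i + m * h i)))"
    unfolding power_CARD_n sum_distrib_left mult.assoc ..
  finally show ?thesis using d_pos by simp
qed

end

context fermat_data
begin

lemma e_char_eq_char_pow:
  assumes r: "r > 0" and u: "u \<in> ext_field r - {0}"
  shows "e_char r a u = finite_subfield.char_pow (ext_field r) (\<theta> r) a u"
proof -
  interpret finite_subfield "CARD('a) ^ r" "ext_field r :: 'a alg_closure set"
    by (rule finite_subfield_ext_field[OF r])
  show ?thesis using u by (simp add: e_char_def char_pow_def)
qed

text \<open>
  If the coordinate \<open>u i0\<close> is unrestricted then it can be used to solve the equation
  \<open>\<Sum>i. u i = 0\<close>, so the sum over all \<open>u\<close>, including those with vanishing coordinates,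
  factorizes.
\<close>
lemma degenerate_sum_eq:
  assumes r: "r > 0" and i0: "d dvd a i0"
  shows "degenerate_sum r a = (if \<forall>i. d dvd a i then of_nat (CARD('a) ^ r) ^ (CARD('n) - 1) - 1 else 0)
    - jacobi_at (ext_field r) (\<lambda>i. finite_subfield.char_pow (ext_field r) (\<theta> r) (a i)) 0"
proof -
  interpret finite_subfield "CARD('a) ^ r" "ext_field r :: 'a alg_closure set"
    by (rule finite_subfield_ext_field[OF r])
  let ?K = "ext_field r :: 'a alg_closure set"
  let ?Q = "of_nat (CARD('a) ^ r) :: qbar"
  let ?f = "\<lambda>u. \<Prod>i\<in>UNIV. e_char r (a i) (u i)"
  have \<theta>: "power_residue_char d (\<theta> r)" by (rule power_residue_lift[OF r d_dvd])
  have \<theta>1: "\<theta> r \<in> mult_chars ?K" by (rule power_residue_char_in[OF \<theta>])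
  have dv: "d dvd CARD('a) ^ r - 1" by (rule frob_norm_as_power(2)[OF CARD_gt_1 d_dvd])
  have triv: "char_pow (\<theta> r) b = trivial_char ?K \<longleftrightarrow> d dvd b" for b
    by (rule residue_char_pow_trivial[OF \<theta> d_pos dv])
  have e1: "e_char r b u = 1" if "d dvd b" "u \<in> ?K" for b u
  proof (cases "u = 0")
    case False
    hence "e_char r b u = char_pow (\<theta> r) b u" using that by (intro e_char_eq_char_pow[OF r]) simp
    also have "\<dots> = trivial_char ?K u" using triv[of b] that by simp
    finally show ?thesis using False that by (simp add: trivial_char_def)
  qed (use that in \<open>simp add: e_char_def\<close>)
  define Z where "Z c = {u :: 'n \<Rightarrow> 'a alg_closure. (\<forall>i. u i \<in> ?K) \<and> (\<Sum>i\<in>UNIV. u i) = c}" for c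
  have fin: "finite {u :: 'n \<Rightarrow> 'a alg_closure. \<forall>i. u i \<in> ?K}" by (rule finite_funs) simp
  have fZ: "finite (Z c)" for c by (rule finite_subset[OF _ fin]) (auto simp: Z_def)
  have shift: "(\<Sum>u\<in>Z c. ?f u) = (\<Sum>u\<in>Z 0. ?f u)" if c: "c \<in> ?K" for c
  proof (rule sum.reindex_bij_witness[of _ "\<lambda>u. u(i0 := u i0 + c)" "\<lambda>u. u(i0 := u i0 - c)"], goal_cases)
    case (2 u)
    have "(\<Sum>i\<in>UNIV. (u(i0 := u i0 - c)) i) = (\<Sum>i\<in>UNIV. u i - (if i = i0 then c else 0))"
      by (intro sum.cong) auto
    thus ?case using 2 c by (auto simp: Z_def sum_subtractf sum.delta K_diff simp del: fun_upd_apply) auto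
  next
    case (4 u)
    have "(\<Sum>i\<in>UNIV. (u(i0 := u i0 + c)) i) = (\<Sum>i\<in>UNIV. u i + (if i = i0 then c else 0))"
      by (intro sum.cong) auto
    thus ?case using 4 c by (auto simp: Z_def sum.distrib sum.delta simp del: fun_upd_apply) auto
  next
    case (5 u)
    have "u i0 \<in> ?K" "u i0 - c \<in> ?K" using 5 c by (auto simp: Z_def)
    thus ?case using e1[OF i0] by (intro prod.cong) auto
  qed auto
  have "(\<Prod>i\<in>(UNIV::'n set). \<Sum>y\<in>?K. e_char r (a i) y) = (\<Sum>u | \<forall>i. u i \<in> ?K. ?f u)"
    by (rule prod_sum_funs) simp
  also have "\<dots> = (\<Sum>c\<in>?K. \<Sum>u | u \<in> {u. \<forall>i. u i \<in> ?K} \<and> (\<Sum>i\<in>UNIV. u i) = c. ?f u)"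
    by (rule sum.group[symmetric]) (use fin in auto)
  also have "\<dots> = (\<Sum>c\<in>?K. \<Sum>u\<in>Z 0. ?f u)"
  proof (rule sum.cong[OF refl])
    fix c assume "c \<in> ?K"
    from shift[OF this]
    show "(\<Sum>u | u \<in> {u. \<forall>i. u i \<in> ?K} \<and> (\<Sum>i\<in>UNIV. u i) = c. ?f u) = (\<Sum>u\<in>Z 0. ?f u)"
      by (simp only: Z_def mem_Collect_eq)
  qed
  also have "\<dots> = ?Q * (\<Sum>u\<in>Z 0. ?f u)" using card_K by simp
  also have "(\<Prod>i\<in>(UNIV::'n set). \<Sum>y\<in>?K. e_char r (a i) y) = (\<Prod>i\<in>(UNIV::'n set). if d dvd a i then ?Q else 0)"
  proof (rule prod.cong[OF refl])
    fix i
    show "(\<Sum>y\<in>?K. e_char r (a i) y) = (if d dvd a i then ?Q else 0)"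
    proof (cases "d dvd a i")
      case True
      thus ?thesis using e1[OF True] card_K by simp
    next
      case False
      have "(\<Sum>y\<in>?K. e_char r (a i) y) = (\<Sum>y\<in>?K - {0}. e_char r (a i) y)"
        using False by (intro sum.mono_neutral_right) (auto simp: e_char_def)
      also have "\<dots> = (\<Sum>y\<in>?K - {0}. char_pow (\<theta> r) (a i) y)"
        by (intro sum.cong refl e_char_eq_char_pow[OF r])
      also have "\<dots> = 0" using False triv by (subst sum_mult_char) (auto simp: \<theta>1)
      finally show ?thesis using False by simp
    qed
  qed
  also have "\<dots> = (if \<forall>i. d dvd a i then ?Q ^ CARD('n) else 0)" by (auto simp: prod_zero_iff)
  finally have f: "(if \<forall>i. d dvd a i then ?Q ^ CARD('n) else 0) = ?Q * (\<Sum>u\<in>Z 0. ?f u)" .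
  have "?Q * (\<Sum>u\<in>Z 0. ?f u) = ?Q * (if \<forall>i. d dvd a i then ?Q ^ (CARD('n) - 1) else 0)"
    unfolding f[symmetric] power_CARD_n
    by (simp split: if_split)
  hence full: "(\<Sum>u\<in>Z 0. ?f u) = (if \<forall>i. d dvd a i then ?Q ^ (CARD('n) - 1) else 0)"
    by (simp only: mult_cancel_left) simp
  define D where "D = {u :: 'n \<Rightarrow> 'a alg_closure. (\<forall>i. u i \<in> ?K) \<and> u \<noteq> (\<lambda>i. 0) \<and> (\<exists>i. u i = 0) \<and> (\<Sum>i\<in>UNIV. u i) = 0}"
  define N where "N = {u :: 'n \<Rightarrow> 'a alg_closure. (\<forall>i. u i \<in> ?K - {0}) \<and> (\<Sum>i\<in>UNIV. u i) = 0}"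
  have Z: "Z 0 = insert (\<lambda>i. 0) (D \<union> N)" by (auto simp: Z_def D_def N_def)
  have "(\<lambda>i. 0) \<notin> D \<union> N" "D \<inter> N = {}" "finite D" "finite N"
    using fZ[of 0] unfolding Z by (auto simp: D_def N_def)
  hence "(\<Sum>u\<in>Z 0. ?f u) = ?f (\<lambda>i. 0) + (sum ?f D + sum ?f N)"
    unfolding Z by (subst sum.insert) (auto simp: sum.union_disjoint)
  moreover have "sum ?f D = degenerate_sum r a" by (simp add: degenerate_sum_def D_def)
  moreover have "sum ?f N = jacobi_at ?K (\<lambda>i. char_pow (\<theta> r) (a i)) 0"
    unfolding jacobi_at_def N_def by (intro sum.cong prod.cong refl e_char_eq_char_pow[OF r]) auto
  moreover have "?f (\<lambda>i. 0) = (if \<forall>i. d dvd a i then 1 else 0)" by (auto simp: e_char_def prod_zero_iff)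
  ultimately have "degenerate_sum r a = (if \<forall>i. d dvd a i then ?Q ^ (CARD('n) - 1) else 0)
      - (if \<forall>i. d dvd a i then 1 else 0) - jacobi_at ?K (\<lambda>i. char_pow (\<theta> r) (a i)) 0"
    unfolding full by (simp only: add_diff_cancel_left' add_diff_cancel_right')
  thus ?thesis by (simp split: if_split)
qed

lemma degenerate_sum_none: "(\<And>i. \<not> d dvd a i) \<Longrightarrow> degenerate_sum r a = 0"
  unfolding degenerate_sum_def by (intro sum.neutral ballI prod_zero) (auto simp: e_char_def)

text \<open>
Some choice of \<open>d\<close>-th roots exists over the algebraic closure; all others arise from it by tuples of roots of unity,
which \<open>card_mu_fiber\<close> counts.
\<close>
lemma card_root_fiber:
  fixes u :: "'n \<Rightarrow> 'a alg_closure"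
  assumes r: "r > 0" and u: "\<And>i. u i \<in> ext_field r - {0}" and v: "v \<noteq> 0" "v ^ d = (\<Prod>i\<in>UNIV. u i ^ h i)"
  shows "card {x. (\<forall>i. x i ^ d = u i) \<and> (\<Prod>i\<in>UNIV. x i ^ h i) = v} = d ^ (CARD('n) - 1)"
proof -
  have "\<exists>y. y ^ d = u i" for i using d_pos by (rule nth_root_exists)
  then obtain y where y: "\<And>i. y i ^ d = u i" by metis
  have y0: "y i \<noteq> 0" for i using y[of i] u[of i] d_pos by (auto simp: power_0_left)
  let ?p = "\<Prod>i\<in>UNIV. y i ^ h i"
  have p0: "?p \<noteq> 0" using y0 by simp
  have "?p ^ d = (\<Prod>i\<in>UNIV. (y i ^ d) ^ h i)"
    by (simp add: prod_power_distrib power_mult[symmetric] mult.commute)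
  hence "?p ^ d = v ^ d" unfolding y v(2) .
  hence "(v / ?p) ^ d = 1" using v(1) by (simp add: power_divide)
  then obtain \<zeta> where \<zeta>: "\<zeta> \<in> mu" "v / ?p = to_ac \<zeta>" by (rule root_of_unity_cases)
  have "bij_betw (\<lambda>\<xi> i. to_ac (\<xi> i) * y i) {\<xi> \<in> mu_tuples. (\<Prod>i\<in>UNIV. \<xi> i ^ h i) = \<zeta>}
    {x. (\<forall>i. x i ^ d = u i) \<and> (\<Prod>i\<in>UNIV. x i ^ h i) = v}"
  proof (rule bij_betwI')
    fix \<xi> \<xi>' :: "'n \<Rightarrow> 'a"
    show "((\<lambda>i. to_ac (\<xi> i) * y i) = (\<lambda>i. to_ac (\<xi>' i) * y i)) = (\<xi> = \<xi>')"
      using y0 by (auto simp: fun_eq_iff)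
  next
    fix \<xi> assume \<xi>: "\<xi> \<in> {\<xi> \<in> mu_tuples. (\<Prod>i\<in>UNIV. \<xi> i ^ h i) = \<zeta>}"
    have "(\<Prod>i\<in>UNIV. (to_ac (\<xi> i) * y i) ^ h i) = to_ac (\<Prod>i\<in>UNIV. \<xi> i ^ h i) * ?p"
      by (simp add: power_mult_distrib prod.distrib to_ac_prod)
    also have "\<dots> = v" using \<xi> \<zeta>(2) p0 by (simp add: field_simps)
    finally have "(\<Prod>i\<in>UNIV. (to_ac (\<xi> i) * y i) ^ h i) = v" .
    moreover have "to_ac (\<xi> i) ^ d = 1" for i
      using \<xi> by (simp add: mu_tuples_def mu_def to_ac_power[symmetric] del: to_ac_power)
    ultimately show "(\<lambda>i. to_ac (\<xi> i) * y i) \<in> {x. (\<forall>i. x i ^ d = u i) \<and> (\<Prod>i\<in>UNIV. x i ^ h i) = v}"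
      by (simp add: power_mult_distrib y)
  next
    fix x assume x: "x \<in> {x. (\<forall>i. x i ^ d = u i) \<and> (\<Prod>i\<in>UNIV. x i ^ h i) = v}"
    have "(x i / y i) ^ d = 1" for i using x y[of i] u[of i] by (simp add: power_divide)
    hence "\<exists>z\<in>mu. x i / y i = to_ac z" for i by (metis root_of_unity_cases)
    then obtain \<xi> where \<xi>: "\<And>i. \<xi> i \<in> mu" "\<And>i. x i / y i = to_ac (\<xi> i)" by metis
    have xy: "x = (\<lambda>i. to_ac (\<xi> i) * y i)" using \<xi>(2)[symmetric] y0 by (simp add: fun_eq_iff)
    have "to_ac (\<Prod>i\<in>UNIV. \<xi> i ^ h i) * ?p = v"
      using x unfolding xy by (simp add: power_mult_distrib prod.distrib to_ac_prod)
    hence "to_ac (\<Prod>i\<in>UNIV. \<xi> i ^ h i) = to_ac \<zeta>"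
      using p0 \<zeta>(2) by (metis nonzero_mult_div_cancel_right)
    thus "\<exists>\<xi>\<in>{\<xi> \<in> mu_tuples. (\<Prod>i\<in>UNIV. \<xi> i ^ h i) = \<zeta>}. x = (\<lambda>i. to_ac (\<xi> i) * y i)"
      using xy \<xi>(1) by (intro bexI[of _ \<xi>]) (auto simp: mu_tuples_def to_ac_eq_iff)
  qed
  from bij_betw_same_card[OF this] card_mu_fiber[OF \<zeta>(1)] show ?thesis by simp
qed

text \<open>
Here \<open>x\<close> determines \<open>\<xi>\<close>, and the equation of the hypersurface implies that \<open>\<xi>\<close> belongs to the group, because the
monomial in \<open>x\<close> takes a value in the small field.
\<close>
lemma nondegenerate_points:
  fixes \<psi> :: "'a alg_closure \<Rightarrow> qbar" and w :: "'n \<Rightarrow> nat"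
  assumes r: "r > 0" and \<psi>: "\<psi> \<in> nontrivial_add_chars (ext_field r)" and w: "d dvd (\<Sum>i\<in>UNIV. w i)"
  shows "(\<Sum>\<xi>\<in>G_elems. \<phi> (\<Prod>i\<in>UNIV. \<xi> i ^ w i) * of_nat (card {x \<in> twisted_points r \<xi>. \<forall>i. x i \<noteq> 0})) =
    of_nat d ^ (CARD('n) - 1) * (of_nat (CARD('a) ^ r - 1) *
      hypergeom_data.affine_sum (ext_field r) h w (\<theta> r) ((of_nat d * to_ac lam) ^ d))"
proof -
  interpret H: hypergeom_data "CARD('a) ^ r" "ext_field r :: 'a alg_closure set" \<psi> d h w "\<theta> r" "\<rho> r"
    by (rule hypergeom_data[OF r \<psi> w])
  let ?K = "ext_field r :: 'a alg_closure set"
  let ?dL = "of_nat d * to_ac lam :: 'a alg_closure"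
  have dL: "?dL \<in> ?K - {0}" using of_nat_d_nonzero lam H.K_of_nat to_ac_in_ext_field[of lam r] by auto
  define Y :: "('n \<Rightarrow> 'a alg_closure) set"
    where "Y = {x. (\<forall>i. x i \<noteq> 0) \<and> (\<forall>i. x i ^ d \<in> ?K) \<and> (\<Sum>i\<in>UNIV. x i ^ d) = ?dL * (\<Prod>i\<in>UNIV. x i ^ h i)}"
  define U :: "('n \<Rightarrow> 'a alg_closure) set" where "U = {u. \<forall>i. u i \<in> ?K - {0}}"
  define c where "c \<xi> x \<longleftrightarrow> (\<forall>i. x i ^ (CARD('a) ^ r) = to_ac (\<xi> i) * x i)" for \<xi> :: "'n \<Rightarrow> 'a" and x
  have fY: "finite Y" by (rule finite_subset[OF _ finite_funs[OF finite_power_in_ext[OF r]]]) (auto simp: Y_def)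
  have fU: "finite U" unfolding U_def by (rule finite_funs) simp
  have fG: "finite G_elems" using finite_mu_tuples by (simp add: G_elems_def)
  have "(\<Sum>\<xi>\<in>G_elems. \<phi> (\<Prod>i\<in>UNIV. \<xi> i ^ w i) * of_nat (card {x \<in> twisted_points r \<xi>. \<forall>i. x i \<noteq> 0})) =
      (\<Sum>\<xi>\<in>G_elems. \<Sum>x\<in>Y. if c \<xi> x then \<phi> (\<Prod>i\<in>UNIV. \<xi> i ^ w i) else 0)"
  proof (rule sum.cong[OF refl])
    fix \<xi> assume \<xi>: "\<xi> \<in> G_elems"
    have "{x \<in> twisted_points r \<xi>. \<forall>i. x i \<noteq> 0} = {x \<in> Y. c \<xi> x}"
    proof (rule Collect_cong)
      fix x :: "'n \<Rightarrow> 'a alg_closure"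
      have e: "\<forall>i. x i ^ d \<in> ?K" if "c \<xi> x"
        using that \<xi> twist_power_in_ext[of "\<xi> _" "x _" r] by (auto simp: c_def G_elems_def mu_tuples_def)
      have "x \<noteq> (\<lambda>i. 0)" if "\<forall>i. x i \<noteq> 0" using that by auto
      thus "(x \<in> twisted_points r \<xi> \<and> (\<forall>i. x i \<noteq> 0)) = (x \<in> Y \<and> c \<xi> x)"
        unfolding twisted_points_def Y_def c_def[symmetric] mem_Collect_eq using e by blast
    qed
    thus "\<phi> (\<Prod>i\<in>UNIV. \<xi> i ^ w i) * of_nat (card {x \<in> twisted_points r \<xi>. \<forall>i. x i \<noteq> 0}) =
      (\<Sum>x\<in>Y. if c \<xi> x then \<phi> (\<Prod>i\<in>UNIV. \<xi> i ^ w i) else 0)"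
      using fY by (simp add: sum.inter_filter[symmetric])
  qed
  also have "\<dots> = (\<Sum>x\<in>Y. \<Sum>\<xi>\<in>G_elems. if c \<xi> x then \<phi> (\<Prod>i\<in>UNIV. \<xi> i ^ w i) else 0)" by (rule sum.swap)
  also have "\<dots> = (\<Sum>x\<in>Y. \<Prod>i\<in>UNIV. H.\<eta> i (x i ^ d))"
  proof (rule sum.cong[OF refl])
    fix x assume x: "x \<in> Y"
    have "\<exists>z. z \<in> mu \<and> to_ac z = x i ^ (CARD('a) ^ r - 1) \<and> \<phi> z = \<theta> r (x i ^ d) \<and>
      (\<forall>\<zeta>. x i ^ (CARD('a) ^ r) = to_ac \<zeta> * x i \<longleftrightarrow> \<zeta> = z)" for i
    proof -
      have "x i \<noteq> 0" "x i ^ d \<in> ?K" using x by (auto simp: Y_def)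
      from twist_unique[OF r this] show ?thesis by metis
    qed
    then obtain z where z: "\<And>i. z i \<in> mu" "\<And>i. to_ac (z i) = x i ^ (CARD('a) ^ r - 1)"
      "\<And>i. \<phi> (z i) = \<theta> r (x i ^ d)" "\<And>i \<zeta>. x i ^ (CARD('a) ^ r) = to_ac \<zeta> * x i \<longleftrightarrow> \<zeta> = z i"
      by metis
    have cz: "c \<xi> x \<longleftrightarrow> \<xi> = z" for \<xi> unfolding c_def z(4) by (auto simp: fun_eq_iff)
    have "z \<in> G_elems"
    proof -
      let ?v = "\<Prod>i\<in>UNIV. x i ^ h i"
      have "?dL * ?v \<in> ?K" using x H.K_sum[of UNIV "\<lambda>i. x i ^ d"] by (auto simp: Y_def)
      hence "?v \<in> ?K - {0}" using dL x H.K_mult_iff[of ?dL ?v] by (auto simp: Y_def)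
      hence "?v ^ (CARD('a) ^ r - 1) = 1" using H.K_units_eq by blast
      moreover have "?v ^ (CARD('a) ^ r - 1) = (\<Prod>i\<in>UNIV. to_ac (z i) ^ h i)"
        unfolding z(2) by (simp add: prod_power_distrib power_mult[symmetric] mult.commute)
      ultimately have "to_ac (\<Prod>i\<in>UNIV. z i ^ h i) = 1" by (simp add: to_ac_prod)
      thus ?thesis using z(1) by (simp add: G_elems_def mu_tuples_def)
    qed
    hence "(\<Sum>\<xi>\<in>G_elems. if c \<xi> x then \<phi> (\<Prod>i\<in>UNIV. \<xi> i ^ w i) else 0) = (\<Prod>i\<in>UNIV. \<phi> (z i) ^ w i)"
      using fG by (simp add: cz sum.delta \<phi>_prod_power)
    also have "\<dots> = (\<Prod>i\<in>UNIV. H.\<eta> i (x i ^ d))"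
      using x by (intro prod.cong) (auto simp: z(3) H.\<eta>_def H.char_pow_def Y_def)
    finally show "(\<Sum>\<xi>\<in>G_elems. if c \<xi> x then \<phi> (\<Prod>i\<in>UNIV. \<xi> i ^ w i) else 0) = (\<Prod>i\<in>UNIV. H.\<eta> i (x i ^ d))" .
  qed
  also have "\<dots> = (\<Sum>u\<in>U. \<Sum>x | x \<in> Y \<and> (\<lambda>i. x i ^ d) = u. \<Prod>i\<in>UNIV. H.\<eta> i (x i ^ d))"
    by (intro sum.group[symmetric] fY fU) (auto simp: Y_def U_def)
  also have "\<dots> = (\<Sum>u\<in>U. if (\<Sum>i\<in>UNIV. u i) \<noteq> 0 \<and> (\<Sum>i\<in>UNIV. u i) ^ d = ?dL ^ d * (\<Prod>i\<in>UNIV. u i ^ h i)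
      then of_nat d ^ (CARD('n) - 1) * (\<Prod>i\<in>UNIV. H.\<eta> i (u i)) else 0)"
  proof (rule sum.cong[OF refl])
    fix u assume u: "u \<in> U"
    let ?s = "\<Sum>i\<in>UNIV. u i"
    have fib: "{x. x \<in> Y \<and> (\<lambda>i. x i ^ d) = u} = {x. (\<forall>i. x i ^ d = u i) \<and> (\<Prod>i\<in>UNIV. x i ^ h i) = ?s / ?dL}" (is "_ = ?F")
    proof (rule Collect_cong)
      fix x :: "'n \<Rightarrow> 'a alg_closure"
      show "(x \<in> Y \<and> (\<lambda>i. x i ^ d) = u) = ((\<forall>i. x i ^ d = u i) \<and> (\<Prod>i\<in>UNIV. x i ^ h i) = ?s / ?dL)"
      proof (cases "(\<lambda>i. x i ^ d) = u")
        case True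
        have "x i \<noteq> 0" for i using fun_cong[OF True, of i] u d_pos by (auto simp: U_def power_0_left)
        thus ?thesis using True u dL unfolding True[symmetric] by (auto simp: Y_def U_def field_simps)
      next
        case False
        thus ?thesis by (auto simp: fun_eq_iff)
      qed
    qed
    have "(\<Sum>x | x \<in> Y \<and> (\<lambda>i. x i ^ d) = u. \<Prod>i\<in>UNIV. H.\<eta> i (x i ^ d)) = (\<Sum>x | x \<in> Y \<and> (\<lambda>i. x i ^ d) = u. \<Prod>i\<in>UNIV. H.\<eta> i (u i))"
      by (intro sum.cong) auto
    also have "\<dots> = of_nat (card ?F) * (\<Prod>i\<in>UNIV. H.\<eta> i (u i))" unfolding fib by simp
    also have "card ?F = (if ?s \<noteq> 0 \<and> ?s ^ d = ?dL ^ d * (\<Prod>i\<in>UNIV. u i ^ h i) then d ^ (CARD('n) - 1) else 0)"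
    proof (cases "?s \<noteq> 0 \<and> ?s ^ d = ?dL ^ d * (\<Prod>i\<in>UNIV. u i ^ h i)")
      case True
      have "card ?F = d ^ (CARD('n) - 1)"
        by (rule card_root_fiber[OF r]) (use u True dL in \<open>auto simp: U_def power_divide\<close>)
      thus ?thesis using True by simp
    next
      case False
      have "?F = {}"
      proof (rule ccontr)
        assume "?F \<noteq> {}"
        then obtain x where x: "\<And>i. x i ^ d = u i" "(\<Prod>i\<in>UNIV. x i ^ h i) = ?s / ?dL" by blast
        have "x i \<noteq> 0" for i using x(1)[of i] u d_pos by (auto simp: U_def power_0_left)
        hence "?s / ?dL \<noteq> 0" unfolding x(2)[symmetric] by simp
        moreover have "(\<Prod>i\<in>UNIV. x i ^ h i) ^ d = (\<Prod>i\<in>UNIV. (x i ^ d) ^ h i)"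
          by (simp add: prod_power_distrib power_mult[symmetric] mult.commute)
        hence "(?s / ?dL) ^ d = (\<Prod>i\<in>UNIV. u i ^ h i)" unfolding x .
        ultimately show False using False dL by (auto simp: power_divide field_simps)
      qed
      thus ?thesis using False by (simp only: card.empty if_False)
    qed
    finally show "(\<Sum>x | x \<in> Y \<and> (\<lambda>i. x i ^ d) = u. \<Prod>i\<in>UNIV. H.\<eta> i (x i ^ d)) =
      (if ?s \<noteq> 0 \<and> ?s ^ d = ?dL ^ d * (\<Prod>i\<in>UNIV. u i ^ h i) then of_nat d ^ (CARD('n) - 1) * (\<Prod>i\<in>UNIV. H.\<eta> i (u i)) else 0)"
      by simp
  qed
  also have "\<dots> = of_nat d ^ (CARD('n) - 1) * (\<Sum>u | u \<in> U \<and> (\<Sum>i\<in>UNIV. u i) \<noteq> 0 \<and>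
      (\<Sum>i\<in>UNIV. u i) ^ d = ?dL ^ d * (\<Prod>i\<in>UNIV. u i ^ h i). \<Prod>i\<in>UNIV. H.\<eta> i (u i))"
    unfolding sum_distrib_left by (rule sum.inter_filter[OF fU, symmetric])
  also have "(\<Sum>u | u \<in> U \<and> (\<Sum>i\<in>UNIV. u i) \<noteq> 0 \<and>
      (\<Sum>i\<in>UNIV. u i) ^ d = ?dL ^ d * (\<Prod>i\<in>UNIV. u i ^ h i). \<Prod>i\<in>UNIV. H.\<eta> i (u i)) =
    (\<Sum>(t, u)\<in>(?K - {0}) \<times> {u. (\<forall>i. u i \<in> ?K - {0}) \<and> (\<Sum>i\<in>UNIV. u i) = 1 \<and> ?dL ^ d * (\<Prod>i\<in>UNIV. u i ^ h i) = 1}.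
      \<Prod>i\<in>UNIV. H.\<eta> i (u i))"
  \<comment> \<open>both sides are homogeneous of degree \<open>d\<close>, so a solution is a scalar times one with sum 1\<close>
  proof (rule sum.reindex_bij_witness[of _ "\<lambda>(t, u) i. t * u i" "\<lambda>u. (\<Sum>i\<in>UNIV. u i, \<lambda>i. u i / (\<Sum>i\<in>UNIV. u i))"], goal_cases)
    case (1 u)
    thus ?case by (auto simp: fun_eq_iff)
  next
    case (2 u)
    let ?s = "\<Sum>i\<in>UNIV. u i"
    have s: "?s \<in> ?K" "?s \<noteq> 0" using 2 by (auto simp: U_def)
    have "(\<Prod>i\<in>UNIV. (u i / ?s) ^ h i) = (\<Prod>i\<in>UNIV. u i ^ h i) / ?s ^ d"
      by (simp add: power_divide prod_dividef sum_h flip: power_sum)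
    thus ?case using 2 s lam of_nat_d_nonzero by (auto simp: U_def sum_divide_distrib[symmetric] H.K_divide)
  next
    case (3 p)
    thus ?case by (auto simp: sum_distrib_left[symmetric] split: prod.splits)
  next
    case (4 p)
    obtain t u where p: "p = (t, u)" by (cases p)
    have "(\<Prod>i\<in>UNIV. (t * u i) ^ h i) = t ^ d * (\<Prod>i\<in>UNIV. u i ^ h i)"
      by (simp add: power_mult_distrib prod.distrib sum_h flip: power_sum)
    moreover have "?dL ^ d * (t ^ d * Pr) = t ^ d * (?dL ^ d * Pr)" for Pr by simp
    ultimately show ?case using 4 by (auto simp: p U_def sum_distrib_left[symmetric])
  next
    case (5 u)
    let ?s = "\<Sum>i\<in>UNIV. u i"
    have s: "?s \<in> ?K - {0}" using 5 by (auto simp: U_def)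
    have "H.\<eta> i (u i / ?s) = H.\<eta> i (u i) / H.\<eta> i ?s" for i
      using 5 s by (intro H.char_divide) (auto simp: U_def)
    thus ?case using H.prod_\<eta>[OF s] by (simp add: prod_dividef)
  qed
  also have "\<dots> = of_nat (CARD('a) ^ r - 1) * H.affine_sum (?dL ^ d)"
    by (subst sum.cartesian_product[symmetric]) (simp only: sum_constant H.card_K_units H.affine_sum_def)
  finally show ?thesis .
qed

end

section \<open>The twisted point counts\<close>

definition line :: "('n::finite \<Rightarrow> 'a::finite_field alg_closure) \<Rightarrow> ('n \<Rightarrow> 'a alg_closure) set" where
  "line x = {\<lambda>i. c * x i | c. c \<noteq> 0}"

lemma proj_space_lines: "(proj_space :: ('n::finite \<Rightarrow> 'a::finite_field alg_closure) set set) = line ` (UNIV - {\<lambda>i. 0})"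
proof -
  have "{(x, y). x \<noteq> (\<lambda>i. 0) \<and> (\<exists>c. c \<noteq> 0 \<and> y = (\<lambda>i. c * x i))} `` {x} = line x" if "x \<noteq> (\<lambda>i. 0)"
    for x :: "'n \<Rightarrow> 'a alg_closure"
    using that by (auto simp: line_def)
  thus ?thesis by (auto simp: proj_space_def quotient_def)
qed

lemma line_self: "x \<in> line x"
  by (auto simp: line_def intro!: exI[of _ 1])

lemma line_eqI:
  assumes "c \<noteq> 0"
  shows "line (\<lambda>i. c * x i) = line x"
proof (intro equalityI subsetI)
  fix y assume "y \<in> line (\<lambda>i. c * x i)"
  then obtain b where "b \<noteq> 0" "y = (\<lambda>i. b * (c * x i))" by (auto simp: line_def)
  thus "y \<in> line x" using assms by (auto simp: line_def mult.assoc intro!: exI[of _ "b * c"])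
next
  fix y assume "y \<in> line x"
  then obtain b where "b \<noteq> 0" "y = (\<lambda>i. b * x i)" by (auto simp: line_def)
  thus "y \<in> line (\<lambda>i. c * x i)" using assms by (auto simp: line_def intro!: exI[of _ "b / c"])
qed

lemma line_eq_iff: "line x = line y \<longleftrightarrow> y \<in> line x"
proof
  assume "line x = line y" thus "y \<in> line x" using line_self by blast
next
  assume "y \<in> line x"
  then obtain c where "c \<noteq> 0" "y = (\<lambda>i. c * x i)" by (auto simp: line_def)
  thus "line x = line y" using line_eqI by metis
qed

lemma frob_iterate_image:
  "(frob ^^ r) P = (\<lambda>x i. x i ^ (CARD('a) ^ r)) ` (P :: ('n::finite \<Rightarrow> 'a::finite_field alg_closure) set)"
proof (induction r)
  case (Suc r)
  thus ?case by (simp add: frob_def image_image power_mult[symmetric] mult.commute)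
qed simp

context fermat_data
begin

abbreviation "Gt \<equiv> (G_tilde d h :: ('n \<Rightarrow> 'a) monoid)"

lemma Gt_simps [simp]: "carrier Gt = G_elems" "\<xi> \<otimes>\<^bsub>Gt\<^esub> \<zeta> = (\<lambda>i. \<xi> i * \<zeta> i)" "\<one>\<^bsub>Gt\<^esub> = (\<lambda>i. 1)"
  by (auto simp: G_tilde_def G_elems_def mu_tuples_def mu_def)

lemma comm_group_Gt: "comm_group Gt"
proof (rule comm_groupI)
  fix x assume x: "x \<in> carrier Gt"
  show "\<exists>y\<in>carrier Gt. y \<otimes>\<^bsub>Gt\<^esub> x = \<one>\<^bsub>Gt\<^esub>"
  proof (rule bexI[of _ "\<lambda>i. inverse (x i)"])
    show "(\<lambda>i. inverse (x i)) \<otimes>\<^bsub>Gt\<^esub> x = \<one>\<^bsub>Gt\<^esub>"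
      using x mu_nonzero by (auto simp: G_elems_def mu_tuples_def fun_eq_iff)
    show "(\<lambda>i. inverse (x i)) \<in> carrier Gt"
      using x by (simp add: G_elems_def mu_tuples_def mu_def power_inverse prod_inversef[unfolded comp_def])
  qed
qed (auto simp: G_elems_def mu_tuples_def mu_def power_mult_distrib prod.distrib mult_ac)

lemma inv_Gt:
  assumes "\<xi> \<in> G_elems"
  shows "inv\<^bsub>Gt\<^esub> \<xi> = (\<lambda>i. inverse (\<xi> i))"
proof -
  interpret comm_group Gt by (rule comm_group_Gt)
  show ?thesis
  proof (rule inv_equality)
    show "(\<lambda>i. inverse (\<xi> i)) \<otimes>\<^bsub>Gt\<^esub> \<xi> = \<one>\<^bsub>Gt\<^esub>"
      using assms mu_nonzero by (auto simp: G_elems_def mu_tuples_def fun_eq_iff)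
    show "(\<lambda>i. inverse (\<xi> i)) \<in> carrier Gt"
      using assms by (simp add: G_elems_def mu_tuples_def mu_def power_inverse prod_inversef[unfolded comp_def])
  qed (use assms in simp)
qed

lemma diag_eq: "diag d = (\<lambda>c i. c) ` mu"
  by (auto simp: diag_def mu_def)

lemma diag_normal: "diag d \<lhd> Gt"
proof -
  interpret comm_group Gt by (rule comm_group_Gt)
  show ?thesis
  proof (rule subgroup_imp_normal, rule subgroupI)
    show "diag d \<subseteq> carrier Gt"
      by (auto simp: diag_eq G_elems_def mu_tuples_def mu_def sum_h power_sum[symmetric])
    have "(\<lambda>i. 1) \<in> diag d" by (auto simp: diag_def intro!: exI[of _ 1])
    thus "diag d \<noteq> {}" by blast
  next
    fix a :: "'n \<Rightarrow> 'a" assume a: "a \<in> diag d"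
    hence "a \<in> G_elems" by (auto simp: diag_eq G_elems_def mu_tuples_def mu_def sum_h power_sum[symmetric])
    thus "inv\<^bsub>Gt\<^esub> a \<in> diag d" using a by (auto simp: inv_Gt diag_def power_inverse)
  next
    fix a b :: "'n \<Rightarrow> 'a" assume "a \<in> diag d" "b \<in> diag d"
    then obtain x y where "a = (\<lambda>i. x)" "x ^ d = 1" "b = (\<lambda>i. y)" "y ^ d = 1" by (auto simp: diag_def)
    thus "a \<otimes>\<^bsub>Gt\<^esub> b \<in> diag d"
      by (auto simp: diag_def power_mult_distrib intro!: exI[of _ "x * y"])
  qed
qed

definition coset :: "('n \<Rightarrow> 'a) \<Rightarrow> ('n \<Rightarrow> 'a) set" where
  "coset \<xi> = (\<lambda>c i. c * \<xi> i) ` mu"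

lemma r_coset_eq: "diag d #>\<^bsub>Gt\<^esub> \<xi> = coset \<xi>"
  by (auto simp: r_coset_def coset_def diag_eq)

lemma carrier_G_quot: "carrier (G_quot d h) = coset ` G_elems"
  by (auto simp: G_quot_def FactGroup_def RCOSETS_def r_coset_eq)

lemma coset_in_G: "\<xi> \<in> G_elems \<Longrightarrow> coset \<xi> \<subseteq> G_elems"
proof
  fix \<zeta> assume \<xi>: "\<xi> \<in> G_elems" "\<zeta> \<in> coset \<xi>"
  then obtain c where c: "c \<in> mu" "\<zeta> = (\<lambda>i. c * \<xi> i)" by (auto simp: coset_def)
  have "(\<Prod>i\<in>(UNIV::'n set). c ^ h i) = 1" using c(1) by (simp add: power_sum[symmetric] sum_h mu_def)
  thus "\<zeta> \<in> G_elems" using \<xi>(1) c by (simp add: G_elems_def mu_tuples_def mu_def power_mult_distrib prod.distrib)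
qed

lemma coset_self: "\<xi> \<in> coset \<xi>"
  by (auto simp: coset_def mu_def image_iff intro!: exI[of _ 1])

lemma coset_eq_iff: "coset \<xi> = coset \<zeta> \<longleftrightarrow> \<xi> \<in> coset \<zeta>"
proof
  assume "coset \<xi> = coset \<zeta>" thus "\<xi> \<in> coset \<zeta>" using coset_self by blast
next
  assume "\<xi> \<in> coset \<zeta>"
  then obtain c where c: "c \<in> mu" "\<xi> = (\<lambda>i. c * \<zeta> i)" by (auto simp: coset_def)
  have c0: "c \<noteq> 0" using c(1) by (rule mu_nonzero)
  show "coset \<xi> = coset \<zeta>"
  proof (intro equalityI subsetI)
    fix x assume "x \<in> coset \<xi>"
    then obtain b where "b \<in> mu" "x = (\<lambda>i. (b * c) * \<zeta> i)" by (auto simp: coset_def c mult.assoc)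
    thus "x \<in> coset \<zeta>" using c(1) by (auto simp: coset_def mu_def power_mult_distrib image_iff intro!: exI[of _ "b * c"])
  next
    fix x assume "x \<in> coset \<zeta>"
    then obtain b where "b \<in> mu" "x = (\<lambda>i. (b / c) * \<xi> i)" using c0 by (auto simp: coset_def c)
    thus "x \<in> coset \<xi>" using c(1) by (auto simp: coset_def mu_def power_divide image_iff intro!: exI[of _ "b / c"])
  qed
qed

lemma card_coset: "\<xi> \<in> G_elems \<Longrightarrow> card (coset \<xi>) = d"
proof -
  assume \<xi>: "\<xi> \<in> G_elems"
  have "\<xi> undefined \<noteq> 0" using \<xi> mu_nonzero by (auto simp: G_elems_def mu_tuples_def)
  hence "inj_on (\<lambda>c i. c * \<xi> i) mu" by (auto simp: inj_on_def fun_eq_iff)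
  thus ?thesis unfolding coset_def by (simp add: card_image card_mu)
qed

lemma sum_over_cosets:
  assumes "\<And>\<xi>. \<xi> \<in> G_elems \<Longrightarrow> F \<xi> = f (coset \<xi>)"
  shows "(\<Sum>\<xi>\<in>G_elems. F \<xi>) = of_nat d * (\<Sum>g\<in>carrier (G_quot d h). f g :: qbar)"
proof -
  have fG: "finite G_elems" using finite_mu_tuples by (simp add: G_elems_def)
  have "(\<Sum>\<xi>\<in>G_elems. F \<xi>) = (\<Sum>g\<in>coset ` G_elems. \<Sum>\<xi> | \<xi> \<in> G_elems \<and> coset \<xi> = g. F \<xi>)"
    by (rule sum.group[symmetric]) (use fG in auto)
  also have "\<dots> = (\<Sum>g\<in>coset ` G_elems. of_nat d * f g)"
  proof (rule sum.cong[OF refl])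
    fix g assume "g \<in> coset ` G_elems"
    then obtain \<xi>0 where \<xi>0: "\<xi>0 \<in> G_elems" "g = coset \<xi>0" by blast
    have "{\<xi>. \<xi> \<in> G_elems \<and> coset \<xi> = g} = coset \<xi>0"
      unfolding \<xi>0(2) coset_eq_iff using coset_in_G[OF \<xi>0(1)] by blast
    moreover have "(\<Sum>\<xi> | \<xi> \<in> G_elems \<and> coset \<xi> = g. F \<xi>) = (\<Sum>\<xi> | \<xi> \<in> G_elems \<and> coset \<xi> = g. f g)"
      using assms by (intro sum.cong) auto
    ultimately show "(\<Sum>\<xi> | \<xi> \<in> G_elems \<and> coset \<xi> = g. F \<xi>) = of_nat d * f g"
      using card_coset[OF \<xi>0(1)] by simp
  qed
  finally show ?thesis by (simp add: carrier_G_quot sum_distrib_left)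
qed

lemma chi_coset:
  assumes w: "d dvd (\<Sum>i\<in>UNIV. w i)" and \<xi>: "\<xi> \<in> G_elems"
  shows "chi \<phi> w (coset \<xi>) = \<phi> (\<Prod>i\<in>UNIV. \<xi> i ^ w i)"
proof -
  obtain k where k: "(\<Sum>i\<in>UNIV. w i) = d * k" using w by (elim dvdE)
  have "(\<Prod>i\<in>UNIV. (c * \<xi> i) ^ w i) = (\<Prod>i\<in>UNIV. \<xi> i ^ w i)" if "c \<in> mu" for c
  proof -
    have "(\<Prod>i\<in>(UNIV::'n set). c ^ w i) = 1" using that by (simp add: power_sum[symmetric] k power_mult mu_def)
    thus ?thesis by (simp add: power_mult_distrib prod.distrib)
  qed
  hence "(\<lambda>\<xi>. \<phi> (\<Prod>i\<in>UNIV. \<xi> i ^ w i)) ` coset \<xi> = {\<phi> (\<Prod>i\<in>UNIV. \<xi> i ^ w i)}"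
    using coset_self[of \<xi>] unfolding coset_def by (auto simp: image_image)
  thus ?thesis by (simp add: chi_def)
qed

text \<open>
The diagonal part of a coset is absorbed by the scaling of the line.
\<close>
lemma G_act_line:
  assumes \<xi>: "\<xi> \<in> G_elems" and r: "r > 0"
  shows "G_act (inv\<^bsub>G_quot d h\<^esub> (coset \<xi>)) ((frob ^^ r) (line x)) =
    line (\<lambda>i. inverse (to_ac (\<xi> i)) * x i ^ (CARD('a) ^ r))"
proof -
  interpret comm_group Gt by (rule comm_group_Gt)
  interpret normal "diag d" Gt by (rule diag_normal)
  have "inv\<^bsub>G_quot d h\<^esub> (coset \<xi>) = (\<Union>\<zeta>\<in>coset \<xi>. {inv\<^bsub>Gt\<^esub> \<zeta>})"
    unfolding G_quot_def using \<xi> carrier_G_quot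
    by (subst inv_FactGroup) (auto simp: G_quot_def SET_INV_def)
  also have "\<dots> = {\<lambda>i. inverse (c * \<xi> i) | c. c \<in> mu}"
    using coset_in_G[OF \<xi>] by (auto simp: coset_def inv_Gt subset_eq)
  finally have inv: "inv\<^bsub>G_quot d h\<^esub> (coset \<xi>) = {\<lambda>i. inverse (c * \<xi> i) | c. c \<in> mu}" .
  show ?thesis
  proof (intro equalityI subsetI)
    fix y assume "y \<in> G_act (inv\<^bsub>G_quot d h\<^esub> (coset \<xi>)) ((frob ^^ r) (line x))"
    then obtain c b where c: "c \<in> mu" and b: "b \<noteq> 0"
      and y: "y = (\<lambda>i. to_ac (inverse (c * \<xi> i)) * (b * x i) ^ (CARD('a) ^ r))"
      unfolding inv frob_iterate_image by (auto simp: G_act_def line_def)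
    have "y = (\<lambda>i. (inverse (to_ac c) * b ^ (CARD('a) ^ r)) * (inverse (to_ac (\<xi> i)) * x i ^ (CARD('a) ^ r)))"
      by (simp add: y power_mult_distrib mult_ac)
    moreover have "inverse (to_ac c) * b ^ (CARD('a) ^ r) \<noteq> 0" using b mu_nonzero[OF c] by simp
    ultimately show "y \<in> line (\<lambda>i. inverse (to_ac (\<xi> i)) * x i ^ (CARD('a) ^ r))"
      unfolding line_def by blast
  next
    fix y assume "y \<in> line (\<lambda>i. inverse (to_ac (\<xi> i)) * x i ^ (CARD('a) ^ r))"
    then obtain b where b: "b \<noteq> 0" and y: "y = (\<lambda>i. b * (inverse (to_ac (\<xi> i)) * x i ^ (CARD('a) ^ r)))"
      by (auto simp: line_def)
    obtain a where a: "a ^ (CARD('a) ^ r) = b" using nth_root_exists[of "CARD('a) ^ r" b] by auto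
    hence a0: "a \<noteq> 0" using b by (auto simp: power_0_left)
    have "y = (\<lambda>i. to_ac (inverse (1 * \<xi> i)) * (a * x i) ^ (CARD('a) ^ r))"
      by (simp add: y a power_mult_distrib mult_ac)
    moreover have "(\<lambda>i. inverse (1 * \<xi> i)) \<in> {\<lambda>i. inverse (c * \<xi> i) | c. c \<in> mu}" by (force simp: mu_def)
    moreover have "(\<lambda>i. (a * x i) ^ (CARD('a) ^ r)) \<in> (\<lambda>x i. x i ^ (CARD('a) ^ r)) ` line x"
      using a0 by (force simp: line_def)
    ultimately show "y \<in> G_act (inv\<^bsub>G_quot d h\<^esub> (coset \<xi>)) ((frob ^^ r) (line x))"
      unfolding inv frob_iterate_image G_act_def mem_Collect_eq
      by (intro exI[of _ "\<lambda>i. inverse (1 * \<xi> i)"] exI[of _ "\<lambda>i. (a * x i) ^ (CARD('a) ^ r)"] conjI)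
  qed
qed

text \<open>
  Each twisted fixed point is represented by a vector on which the twisted Frobenius acts as the
  identity, not merely as a scalar; such a vector is unique up to scalars from the finite field.
\<close>
lemma card_twisted_points:
  assumes \<xi>: "\<xi> \<in> G_elems" and r: "r > 0"
  shows "card (twisted_points r \<xi>) =
    (CARD('a) ^ r - 1) * card {P \<in> D_hyp d h lam. G_act (inv\<^bsub>G_quot d h\<^esub> (coset \<xi>)) ((frob ^^ r) P) = P}"
proof -
  let ?Q = "CARD('a) ^ r"
  interpret finite_subfield ?Q "ext_field r :: 'a alg_closure set" by (rule finite_subfield_ext_field[OF r])
  define FP where "FP = {P \<in> D_hyp d h lam. G_act (inv\<^bsub>G_quot d h\<^esub> (coset \<xi>)) ((frob ^^ r) P) = P}"
  define V where "V = twisted_points r \<xi>"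
  have \<xi>0: "\<xi> i \<noteq> 0" for i using \<xi> mu_nonzero by (auto simp: G_elems_def mu_tuples_def)
  have fV: "finite V"
  proof (rule finite_subset[OF _ finite_funs[OF finite_power_in_ext[OF r]]])
    have "x i ^ d \<in> ext_field r" if "x \<in> V" for x i
      by (rule twist_power_in_ext[of "\<xi> i"])
         (use that \<xi> in \<open>auto simp: V_def twisted_points_def G_elems_def mu_tuples_def\<close>)
    thus "V \<subseteq> {x. \<forall>i. x i \<in> {x. x ^ d \<in> ext_field r}}" by blast
  qed
  let ?eq = "\<lambda>x :: 'n \<Rightarrow> 'a alg_closure. (\<Sum>i\<in>UNIV. x i ^ d) = of_nat d * to_ac lam * (\<Prod>i\<in>UNIV. x i ^ h i)"
  have hom: "?eq (\<lambda>i. c * x i) \<longleftrightarrow> ?eq x" if "c \<noteq> 0" for c x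
  proof -
    have "(\<Prod>i\<in>UNIV. (c * x i) ^ h i) = c ^ d * (\<Prod>i\<in>UNIV. x i ^ h i)"
      by (simp add: power_mult_distrib prod.distrib sum_h flip: power_sum)
    moreover have "(\<Sum>i\<in>UNIV. (c * x i) ^ d) = c ^ d * (\<Sum>i\<in>UNIV. x i ^ d)"
      by (simp add: power_mult_distrib sum_distrib_left)
    ultimately show ?thesis using that by (simp add: mult.assoc)
  qed
  have fix_iff: "line x \<in> FP \<longleftrightarrow> ?eq x \<and> (\<exists>c. c \<noteq> 0 \<and> (\<forall>i. x i ^ ?Q = c * (to_ac (\<xi> i) * x i)))"
    if x: "x \<noteq> (\<lambda>i. 0)" for x
  proof -
    have "line x \<in> D_hyp d h lam \<longleftrightarrow> ?eq x"
    proof -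
      have "line x \<in> proj_space" using x by (auto simp: proj_space_lines)
      moreover have "(\<forall>y\<in>line x. ?eq y) \<longleftrightarrow> ?eq x"
        using hom line_self[of x] unfolding line_def by blast
      ultimately show ?thesis by (simp add: D_hyp_def)
    qed
    moreover have "G_act (inv\<^bsub>G_quot d h\<^esub> (coset \<xi>)) ((frob ^^ r) (line x)) = line x \<longleftrightarrow>
      (\<exists>c. c \<noteq> 0 \<and> (\<forall>i. x i ^ ?Q = c * (to_ac (\<xi> i) * x i)))"
    proof -
      have *: "inverse (to_ac (\<xi> i)) * z = c * y \<longleftrightarrow> z = c * (to_ac (\<xi> i) * y)" for i z c y
        using \<xi>0[of i] by (auto simp: field_simps)
      have "G_act (inv\<^bsub>G_quot d h\<^esub> (coset \<xi>)) ((frob ^^ r) (line x)) = line x \<longleftrightarrow>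
        (\<lambda>i. inverse (to_ac (\<xi> i)) * x i ^ ?Q) \<in> line x"
        unfolding G_act_line[OF \<xi> r] by (rule trans[OF eq_commute line_eq_iff])
      also have "\<dots> \<longleftrightarrow> (\<exists>c. c \<noteq> 0 \<and> (\<forall>i. inverse (to_ac (\<xi> i)) * x i ^ ?Q = c * x i))"
        unfolding line_def by (auto simp: fun_eq_iff)
      finally show ?thesis unfolding * .
    qed
    ultimately show ?thesis by (auto simp: FP_def)
  qed
  have VFP: "line x \<in> FP" if "x \<in> V" for x
    using that by (subst fix_iff) (auto simp: V_def twisted_points_def intro!: exI[of _ 1])
  have fiber: "card {x \<in> V. line x = P} = ?Q - 1" if P: "P \<in> FP" for P
  proof -
    obtain x where x: "x \<noteq> (\<lambda>i. 0)" "P = line x"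
      using P by (auto simp: FP_def D_hyp_def proj_space_lines)
    then obtain c where c: "?eq x" "c \<noteq> 0" "\<And>i. x i ^ ?Q = c * (to_ac (\<xi> i) * x i)" using fix_iff P by blast
    obtain b where b: "b ^ (?Q - 1) = inverse c" using nth_root_exists[of "?Q - 1" "inverse c"] Q_gt_1 by auto
    have b0: "b \<noteq> 0" using b c(2) Q_gt_1 by (auto simp: power_0_left)
    have bQ: "b ^ ?Q = b * inverse c" using b Q_gt_1 by (metis power_minus_mult mult.commute zero_less_one less_trans)
    define y where "y = (\<lambda>i. b * x i)"
    have Py: "P = line y" unfolding y_def x(2) using b0 by (simp add: line_eqI)
    have y0: "y \<noteq> (\<lambda>i. 0)" using x(1) b0 by (auto simp: y_def fun_eq_iff)
    then obtain i0 where i0: "y i0 \<noteq> 0" by (auto simp: fun_eq_iff)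
    have yQ: "y i ^ ?Q = to_ac (\<xi> i) * y i" for i
      using c(2) by (simp add: y_def power_mult_distrib bQ c(3) mult_ac)
    have yeq: "?eq y" unfolding y_def using hom[OF b0] c(1) by blast
    have in_V: "(\<lambda>i. a * y i) \<in> V \<longleftrightarrow> a \<in> ext_field r" if a: "a \<noteq> 0" for a
    proof -
      have "(\<lambda>i. a * y i) \<noteq> (\<lambda>i. 0)" using a i0 by (auto simp: fun_eq_iff)
      moreover have "(\<forall>i. (a * y i) ^ ?Q = to_ac (\<xi> i) * (a * y i)) \<longleftrightarrow> a ^ ?Q = a"
        using i0 \<xi>0[of i0] by (auto simp: power_mult_distrib yQ mult_ac)
      ultimately show ?thesis using hom[OF a, of y] yeq by (simp add: V_def twisted_points_def K_iff)
    qed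
    have "{x \<in> V. line x = P} = (\<lambda>a i. a * y i) ` (ext_field r - {0})"
    proof (intro equalityI subsetI)
      fix z assume z: "z \<in> {x \<in> V. line x = P}"
      hence "z \<in> line y" using Py line_eq_iff by (metis (mono_tags, lifting) mem_Collect_eq)
      then obtain a where a: "a \<noteq> 0" "z = (\<lambda>i. a * y i)" by (auto simp: line_def)
      thus "z \<in> (\<lambda>a i. a * y i) ` (ext_field r - {0})" using z in_V[OF a(1)] by auto
    next
      fix z assume "z \<in> (\<lambda>a i. a * y i) ` (ext_field r - {0})"
      then obtain a where a: "a \<noteq> 0" "a \<in> ext_field r" "z = (\<lambda>i. a * y i)" by auto
      thus "z \<in> {x \<in> V. line x = P}" using in_V[OF a(1)] line_eqI[OF a(1), of y] Py by simp
    qed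
    moreover have "inj_on (\<lambda>a i. a * y i) (ext_field r - {0})"
      using i0 by (auto simp: inj_on_def fun_eq_iff)
    ultimately show ?thesis using card_K_units by (simp only: card_image)
  qed
  have "line ` V = FP"
  proof (intro equalityI subsetI)
    fix P assume "P \<in> FP"
    hence "{x \<in> V. line x = P} \<noteq> {}" using fiber[of P] Q_gt_1 by (metis card.empty diff_is_0_eq not_less)
    thus "P \<in> line ` V" by blast
  qed (use VFP in blast)
  hence fFP: "finite FP" using fV by (metis finite_imageI)
  have "card V = (\<Sum>P\<in>FP. \<Sum>x | x \<in> V \<and> line x = P. 1)"
    unfolding card_eq_sum by (rule sum.group[symmetric]) (use fV fFP VFP in auto)
  also have "\<dots> = (\<Sum>P\<in>FP. ?Q - 1)" using fiber by (intro sum.cong) auto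
  finally show ?thesis by (simp add: V_def FP_def mult.commute)
qed

lemma N_D_eq:
  assumes r: "r > 0" and w: "d dvd (\<Sum>i\<in>UNIV. w i)"
  shows "of_nat d ^ (CARD('n) - 1) * (of_nat (CARD('a) ^ r - 1) * N_D d h lam (chi \<phi> w) r) =
    (\<Sum>\<xi>\<in>G_elems. \<phi> (\<Prod>i\<in>UNIV. \<xi> i ^ w i) * of_nat (card (twisted_points r \<xi>)))"
proof -
  let ?q = "of_nat (CARD('a) ^ r - 1) :: qbar"
  let ?n = "\<lambda>g. of_nat (card {P \<in> D_hyp d h lam. G_act (inv\<^bsub>G_quot d h\<^esub> g) ((frob ^^ r) P) = P}) :: qbar"
  let ?G = "carrier (G_quot d h :: ('n \<Rightarrow> 'a) set monoid)"
  have "of_nat (card G_elems) = (\<Sum>\<xi>\<in>G_elems. 1 :: qbar)" by simp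
  also have "\<dots> = of_nat d * (\<Sum>g\<in>?G. 1)" by (rule sum_over_cosets) simp
  finally have cG: "of_nat d * of_nat (card ?G) = (of_nat (d ^ (CARD('n) - 1)) :: qbar)"
    using card_mu_fiber[of 1] by (simp add: G_elems_def mu_def)
  hence nz: "of_nat (card ?G) \<noteq> (0 :: qbar)" using d_pos by (metis mult_zero_right of_nat_eq_0_iff power_not_zero less_irrefl)
  have "(\<Sum>\<xi>\<in>G_elems. \<phi> (\<Prod>i\<in>UNIV. \<xi> i ^ w i) * of_nat (card (twisted_points r \<xi>))) =
      of_nat d * (\<Sum>g\<in>?G. chi \<phi> w g * (?q * ?n g))"
    by (rule sum_over_cosets) (simp only: card_twisted_points[OF _ r] chi_coset[OF w] of_nat_mult)
  also have "\<dots> = of_nat d * (?q * (\<Sum>g\<in>?G. chi \<phi> w g * ?n g))"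
    by (simp add: sum_distrib_left mult_ac)
  also have "(\<Sum>g\<in>?G. chi \<phi> w g * ?n g) = of_nat (card ?G) * N_D d h lam (chi \<phi> w) r"
    using nz by (simp add: N_D_def)
  also have "of_nat d * (?q * (of_nat (card ?G) * N_D d h lam (chi \<phi> w) r)) =
    (of_nat d * of_nat (card ?G)) * (?q * N_D d h lam (chi \<phi> w) r)" by (simp add: mult_ac)
  finally show ?thesis unfolding cG by simp
qed

end

context fermat_data
begin

text \<open>
  Exponent vectors with some but not all entries zero give the factors of \<open>C_fac\<close>. Those without zero
  entries do not contribute, as the summand vanishes whenever a coordinate does.
\<close>
lemma degenerate_sum_Jacobi:
  fixes \<psi> \<psi>1 :: "'a alg_closure \<Rightarrow> qbar" and a :: "'n \<Rightarrow> nat"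
  assumes r: "r > 0" and \<psi>: "\<psi> \<in> nontrivial_add_chars (ext_field r)"
    and \<psi>1: "\<psi>1 \<in> nontrivial_add_chars (ext_field 1)" and a: "d dvd (\<Sum>i\<in>UNIV. a i)"
  defines "a' \<equiv> \<lambda>i. a i mod d" and "Q \<equiv> of_nat (CARD('a) ^ r) :: qbar"
  shows "degenerate_sum r a =
    (if \<forall>i. a' i = 0 then Q ^ (CARD('n) - 1) - 1 - (Q - 1) ^ CARD('n) / Q - (Q - 1) * (-1) ^ CARD('n) / Q
     else if \<exists>i. a' i = 0 then (Q - 1) * (- ((-1) ^ CARD('n)) * jacobi_w \<phi> d a' ^ r) else 0)"
proof -
  have dvd_iff: "d dvd a i \<longleftrightarrow> a' i = 0" for i by (auto simp: a'_def dvd_eq_mod_eq_0)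
  have a'W: "a' \<in> W_set d" using a d_pos by (simp add: W_set_def a'_def dvd_eq_mod_eq_0 mod_sum_eq)
  hence sa': "d dvd (\<Sum>i\<in>UNIV. a' i)" by (simp add: W_set_def)
  interpret H: hypergeom_data "CARD('a) ^ r" "ext_field r :: 'a alg_closure set" \<psi> d h a' "\<theta> r" "\<rho> r"
    by (rule hypergeom_data[OF r \<psi> sa'])
  have q1: "of_nat (CARD('a) ^ r - 1) = Q - 1" using H.Q_gt_1 by (simp add: Q_def of_nat_diff)
  have Q0: "Q \<noteq> 0" by (simp add: Q_def)
  have \<eta>: "(\<lambda>i. H.char_pow (\<theta> r) (a i)) = H.\<eta>"
  proof
    fix i
    have "a i mod d = a' i mod d" by (simp add: a'_def)
    thus "H.char_pow (\<theta> r) (a i) = H.\<eta> i"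
      unfolding H.\<eta>_def H.residue_char_pow_eq_iff[OF H.\<theta> H.d] .
  qed
  have triv: "H.\<eta> i = trivial_char (ext_field r) \<longleftrightarrow> a' i = 0" for i
    unfolding H.\<eta>_def H.residue_char_pow_trivial[OF H.\<theta> H.d] by (auto simp: a'_def dvd_eq_mod_eq_0)
  have J0: "jacobi_at (ext_field r) H.\<eta> 0 = (if \<forall>i. a' i = 0 then (Q - 1) ^ CARD('n) else 0)
      - (Q - 1) * jacobi_at (ext_field r) H.\<eta> 1"
    using H.jacobi_at_0[of H.\<eta>, OF H.\<eta>_in H.prod_\<eta>] unfolding triv q1 .
  show ?thesis
  proof (cases "\<exists>i. a' i = 0")
    case ex: True
    then obtain i0 where i0: "d dvd a i0" using dvd_iff by blast
    have D: "degenerate_sum r a = (if \<forall>i. a' i = 0 then Q ^ (CARD('n) - 1) - 1 else 0) - jacobi_at (ext_field r) H.\<eta> 0"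
      using degenerate_sum_eq[of r a i0, OF r i0] unfolding dvd_iff \<eta> Q_def .
    show ?thesis
    proof (cases "\<forall>i. a' i = 0")
      case True
      have "H.\<eta> i = trivial_char (ext_field r)" for i using True triv by blast
      hence J1: "jacobi_at (ext_field r) H.\<eta> 1 = (Q - 1) ^ CARD('n) / Q - (-1) ^ CARD('n) / Q"
        using H.jacobi_at_1[of H.\<eta>, OF H.\<eta>_in] unfolding H.prod_\<eta>_trivial q1 Q_def[symmetric]
        by (simp add: H.gauss_trivial gauss_sum_circ_def H.card_K Q_def[symmetric, simplified])
      have "x - 1 - (y - (Q - 1) * (y / Q - s / Q)) = x - 1 - y / Q - (Q - 1) * s / Q" for x y s
        using Q0 by (simp add: field_simps)
      thus ?thesis unfolding D J0 J1 using True by simp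
    next
      case False
      hence "H.J_val = jacobi_w \<phi> d a' ^ r" using J_val_lift[OF r \<psi> \<psi>1 a'W] by blast
      hence "(-1) ^ (CARD('n) - 1) * jacobi_at (ext_field r) H.\<eta> 1 = jacobi_w \<phi> d a' ^ r"
        by (simp add: H.J_val_def)
      moreover have "- ((-1) ^ CARD('n)) * ((-1) ^ (CARD('n) - 1) * x) = x" for x :: qbar
        by (subst power_CARD_n) (simp add: mult.assoc[symmetric] power_add[symmetric] flip: mult_2)
      ultimately have "jacobi_at (ext_field r) H.\<eta> 1 = - ((-1) ^ CARD('n)) * jacobi_w \<phi> d a' ^ r"
        by metis
      thus ?thesis unfolding D J0 if_not_P[OF False] if_P[OF ex] by simp
    qed
  next
    case False
    hence "degenerate_sum r a = 0" by (intro degenerate_sum_none) (simp add: dvd_iff)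
    moreover have "\<not> (\<forall>i. a' i = 0)" using False by blast
    ultimately show ?thesis using False by (simp only: if_False)
  qed
qed

definition shift_w :: "('n \<Rightarrow> nat) \<Rightarrow> nat \<Rightarrow> 'n \<Rightarrow> nat" where
  "shift_w w m = (\<lambda>i. (w i + m * h i) mod d)"

lemma shift_w_in: "w \<in> W_set d \<Longrightarrow> shift_w w m \<in> W_set d"
proof -
  assume w: "w \<in> W_set d"
  have "(\<Sum>i\<in>UNIV. w i + m * h i) = (\<Sum>i\<in>UNIV. w i) + m * d"
    by (simp add: sum.distrib sum_h flip: sum_distrib_left)
  thus ?thesis using w d_pos by (simp add: W_set_def shift_w_def dvd_eq_mod_eq_0 mod_sum_eq)
qed

lemma shift_w_inj: "inj_on (shift_w w) {..<d}"
proof (rule inj_onI)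
  have *: "m = m'" if "m' \<le> m" "m < d" "shift_w w m = shift_w w m'" for m m'
  proof -
    have "d dvd (m - m') * h i" for i
    proof -
      have "(w i + m * h i) mod d = (w i + m' * h i) mod d"
        using fun_cong[OF that(3), of i] by (simp add: shift_w_def)
      hence "d dvd (w i + m * h i) - (w i + m' * h i)"
        using that(1) by (subst mod_eq_dvd_iff_nat[symmetric]) (auto simp: mult_le_mono1)
      thus ?thesis by (simp add: diff_mult_distrib)
    qed
    hence "d dvd m - m'" by (rule gcd_h)
    thus ?thesis using that by (auto dest: dvd_imp_le)
  qed
  fix m m' assume "m \<in> {..<d}" "m' \<in> {..<d}" "shift_w w m = shift_w w m'"
  thus "m = m'" using *[of m m'] *[of m' m] by (metis lessThan_iff linear)
qed

text \<open>
If the characters agree on the group, then the sum of their quotient over the group is not \<open>0\<close>. Detecting the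
group inside the tuples of roots of unity, one of the exponent vectors \<open>w - v + m * h\<close> must then vanish modulo
\<open>d\<close>.
\<close>
lemma W_equiv_iff:
  assumes w: "w \<in> W_set d" and v: "v \<in> W_set d"
  shows "W_equiv \<phi> d h v w \<longleftrightarrow> (\<exists>m<d. v = shift_w w m)"
proof -
  have eq: "W_equiv \<phi> d h v w \<longleftrightarrow> (\<forall>\<xi>\<in>G_elems. \<phi> (\<Prod>i\<in>UNIV. \<xi> i ^ v i) = \<phi> (\<Prod>i\<in>UNIV. \<xi> i ^ w i))"
    using chi_coset[of w] chi_coset[of v] w v by (auto simp: W_equiv_def carrier_G_quot W_set_def)
  have pm: "x ^ (k mod d) = x ^ k" if "x ^ d = 1" for x :: 'a and k
    by (metis that mult_div_mod_eq mult_1 power_add power_mult power_one)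
  show ?thesis
  proof
    assume "\<exists>m<d. v = shift_w w m"
    then obtain m where m: "v = shift_w w m" by blast
    show "W_equiv \<phi> d h v w"
      unfolding eq
    proof
      fix \<xi> assume \<xi>: "\<xi> \<in> G_elems"
      have "(\<Prod>i\<in>UNIV. \<xi> i ^ v i) = (\<Prod>i\<in>UNIV. \<xi> i ^ (w i + m * h i))"
        unfolding m shift_w_def using \<xi> by (intro prod.cong pm) (auto simp: G_elems_def mu_tuples_def mu_def)
      also have "\<dots> = (\<Prod>i\<in>UNIV. \<xi> i ^ w i) * (\<Prod>i\<in>UNIV. \<xi> i ^ h i) ^ m"
        by (simp add: power_add prod.distrib prod_power_distrib power_mult[symmetric] mult.commute)
      also have "\<dots> = (\<Prod>i\<in>UNIV. \<xi> i ^ w i)" using \<xi> by (simp add: G_elems_def)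
      finally show "\<phi> (\<Prod>i\<in>UNIV. \<xi> i ^ v i) = \<phi> (\<Prod>i\<in>UNIV. \<xi> i ^ w i)" by simp
    qed
  next
    assume "W_equiv \<phi> d h v w"
    hence same: "\<phi> (\<Prod>i\<in>UNIV. \<xi> i ^ v i) = \<phi> (\<Prod>i\<in>UNIV. \<xi> i ^ w i)" if "\<xi> \<in> G_elems" for \<xi>
      using that eq by blast
    define k where "k i = w i + (d - 1) * v i" for i
    \<comment> \<open>the character with exponents \<open>k\<close>, the quotient of the two, is trivial on the group\<close>
    have one: "(\<Prod>i\<in>UNIV. \<phi> (\<xi> i) ^ k i) = 1" if \<xi>: "\<xi> \<in> G_elems" for \<xi>
    proof -
      have \<xi>m: "\<xi> \<in> mu_tuples" using \<xi> by (simp add: G_elems_def)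
      have "(\<Prod>i\<in>UNIV. \<phi> (\<xi> i) ^ k i) = \<phi> (\<Prod>i\<in>UNIV. \<xi> i ^ w i) * \<phi> (\<Prod>i\<in>UNIV. \<xi> i ^ v i) ^ (d - 1)"
        by (simp add: k_def \<phi>_prod_power power_add prod.distrib prod_power_distrib power_mult[symmetric] mult.commute)
      also have "\<dots> = \<phi> (\<Prod>i\<in>UNIV. \<xi> i ^ v i) ^ d"
        using same[OF \<xi>] d_pos by (simp flip: power_Suc)
      also have "\<dots> = 1" by (rule \<phi>_mu_power[OF prod_mu[OF \<xi>m]])
      finally show ?thesis .
    qed
    have "of_nat d * of_nat (card G_elems) = (\<Sum>\<xi>\<in>G_elems. of_nat d * (\<Prod>i\<in>UNIV. \<phi> (\<xi> i) ^ k i))"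
      by (simp add: one mult.commute)
    also have "\<dots> = (\<Sum>\<xi>\<in>mu_tuples. (if (\<Prod>i\<in>UNIV. \<xi> i ^ h i) = 1 then of_nat d else 0) * (\<Prod>i\<in>UNIV. \<phi> (\<xi> i) ^ k i))"
      unfolding G_elems_def by (subst sum.inter_filter[OF finite_mu_tuples]) (auto intro!: sum.cong)
    also have "\<dots> = (\<Sum>\<xi>\<in>mu_tuples. \<Sum>m<d. \<Prod>i\<in>UNIV. \<phi> (\<xi> i) ^ (k i + m * h i))"
    proof (rule sum.cong[OF refl])
      fix \<xi> assume \<xi>: "\<xi> \<in> mu_tuples"
      have "(\<Sum>m<d. \<Prod>i\<in>UNIV. \<phi> (\<xi> i) ^ (k i + m * h i)) = (\<Sum>m<d. \<phi> (\<Prod>i\<in>UNIV. \<xi> i ^ h i) ^ m) * (\<Prod>i\<in>UNIV. \<phi> (\<xi> i) ^ k i)"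
        by (simp add: sum_distrib_right sum_distrib_left \<phi>_prod_power power_add prod.distrib prod_power_distrib power_mult[symmetric] mult.commute)
      thus "(if (\<Prod>i\<in>UNIV. \<xi> i ^ h i) = 1 then of_nat d else 0) * (\<Prod>i\<in>UNIV. \<phi> (\<xi> i) ^ k i) =
        (\<Sum>m<d. \<Prod>i\<in>UNIV. \<phi> (\<xi> i) ^ (k i + m * h i))"
        using sum_char_powers[OF prod_mu[OF \<xi>, of h]] by simp
    qed
    also have "\<dots> = (\<Sum>m<d. \<Prod>i\<in>(UNIV::'n set). \<Sum>z\<in>mu. \<phi> z ^ (k i + m * h i))"
      by (subst sum.swap) (simp add: prod_sum_funs mu_tuples_def)
    finally have sum: "of_nat d * of_nat (card G_elems) = (\<Sum>m<d. \<Prod>i\<in>(UNIV::'n set). if d dvd k i + m * h i then of_nat d else 0 :: qbar)"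
      unfolding sum_mu_char .
    have "card G_elems \<noteq> 0" using card_mu_fiber[of 1] d_pos by (simp add: G_elems_def mu_def)
    hence "(\<Sum>m<d. \<Prod>i\<in>(UNIV::'n set). if d dvd k i + m * h i then of_nat d else 0 :: qbar) \<noteq> 0"
      unfolding sum[symmetric] using d_pos by simp
    then obtain m where m: "m < d" "(\<Prod>i\<in>(UNIV::'n set). if d dvd k i + m * h i then of_nat d else 0 :: qbar) \<noteq> 0"
      by (metis (no_types, lifting) lessThan_iff sum.neutral)
    hence dv: "d dvd k i + m * h i" for i by (auto simp: prod_zero_iff split: if_splits)
    have "v i = (w i + m * h i) mod d" for i
    proof -
      have "k i + m * h i + v i = (w i + m * h i) + d * v i"
        using d_pos by (cases d) (simp_all add: k_def algebra_simps)
      hence "v i mod d = (w i + m * h i) mod d"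
        using dv[of i] by (metis dvd_eq_mod_eq_0 mod_add_left_eq mod_mult_self2 add_0)
      thus ?thesis using v by (simp add: W_set_def)
    qed
    thus "\<exists>m<d. v = shift_w w m" using m(1) by (auto simp: shift_w_def)
  qed
qed

definition C_index :: "('n \<Rightarrow> nat) \<Rightarrow> ('n \<Rightarrow> nat) set" where
  "C_index w = {w' \<in> W_set d. W_equiv \<phi> d h w' w \<and> (\<exists>i. w' i = 0) \<and> (\<exists>i. w' i \<noteq> 0)}"

lemma C_index_eq:
  "w \<in> W_set d \<Longrightarrow> C_index w = shift_w w ` {m. m < d \<and> (\<exists>i. shift_w w m i = 0) \<and> (\<exists>i. shift_w w m i \<noteq> 0)}"
  using W_equiv_iff shift_w_in by (auto simp: C_index_def intro!: imageI)

lemma finite_C_index: "w \<in> W_set d \<Longrightarrow> finite (C_index w)"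
  by (simp add: C_index_eq)

text \<open>
  The exponent vectors \<open>w + m * h\<close> with \<open>m < d\<close> are different modulo \<open>d\<close>, so they run through the class of \<open>w\<close>
  once, and at most one of them is \<open>0\<close>.
\<close>
lemma N_D_formula:
  fixes \<psi> \<psi>1 :: "'a alg_closure \<Rightarrow> qbar" and w :: "'n \<Rightarrow> nat"
  assumes r: "r > 0" and \<psi>: "\<psi> \<in> nontrivial_add_chars (ext_field r)"
    and \<psi>1: "\<psi>1 \<in> nontrivial_add_chars (ext_field 1)" and w: "w \<in> W_set d"
  defines "Q \<equiv> of_nat (CARD('a) ^ r) :: qbar"
  shows "N_D d h lam (chi \<phi> w) r =
    hypergeom_data.affine_sum (ext_field r) h w (\<theta> r) ((of_nat d * to_ac lam) ^ d)
    + (if \<exists>m<d. \<forall>i. shift_w w m i = 0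
       then (Q ^ (CARD('n) - 1) - 1) / (Q - 1) - (Q - 1) ^ CARD('n) / Q / (Q - 1) - (-1) ^ CARD('n) / Q else 0)
    + (\<Sum>w'\<in>C_index w. - ((-1) ^ CARD('n)) * jacobi_w \<phi> d w' ^ r)"
    (is "?N = ?A + ?Z + ?C")
proof -
  interpret finite_subfield "CARD('a) ^ r" "ext_field r :: 'a alg_closure set"
    by (rule finite_subfield_ext_field[OF r])
  have ws: "d dvd (\<Sum>i\<in>UNIV. w i)" using w by (simp add: W_set_def)
  have q1: "of_nat (CARD('a) ^ r - 1) = Q - 1" using Q_gt_1 by (simp add: Q_def of_nat_diff)
  have "CARD('a) ^ r - 1 \<noteq> 0" using Q_gt_1 by simp
  hence "of_nat (CARD('a) ^ r - 1) \<noteq> (0 :: qbar)" unfolding of_nat_eq_0_iff .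
  hence Q1: "Q - 1 \<noteq> 0" unfolding q1 .
  have Q0: "Q \<noteq> 0" by (simp add: Q_def)
  define z where "z = Q ^ (CARD('n) - 1) - 1 - (Q - 1) ^ CARD('n) / Q - (Q - 1) * (-1) ^ CARD('n) / Q"
  define J where "J w' = - ((-1) ^ CARD('n)) * jacobi_w \<phi> d w' ^ r" for w' :: "'n \<Rightarrow> nat"
  have deg: "degenerate_sum r (\<lambda>i. w i + m * h i) = (if \<forall>i. shift_w w m i = 0 then z else 0) +
    (if (\<exists>i. shift_w w m i = 0) \<and> (\<exists>i. shift_w w m i \<noteq> 0) then (Q - 1) * J (shift_w w m) else 0)" for m
  proof -
    have "(\<Sum>i\<in>UNIV. w i + m * h i) = (\<Sum>i\<in>UNIV. w i) + m * d"
      by (simp add: sum.distrib sum_h flip: sum_distrib_left)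
    hence "d dvd (\<Sum>i\<in>UNIV. w i + m * h i)" using ws by simp
    note D = degenerate_sum_Jacobi[OF r \<psi> \<psi>1 this]
    have s: "(w i + m * h i) mod d = shift_w w m i" for i by (simp add: shift_w_def)
    show ?thesis
      using D unfolding s Q_def[symmetric] z_def[symmetric] J_def[symmetric]
      by (auto simp del: neq0_conv)
  qed
  have fT: "finite (twisted_points r \<xi>)" if "\<xi> \<in> G_elems" for \<xi>
  proof (rule finite_subset[OF _ finite_funs[OF finite_power_in_ext[OF r]]])
    have "x i ^ d \<in> ext_field r" if "x \<in> twisted_points r \<xi>" for x i
      by (rule twist_power_in_ext[of "\<xi> i"])
         (use that \<open>\<xi> \<in> G_elems\<close> in \<open>auto simp: twisted_points_def G_elems_def mu_tuples_def\<close>)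
    thus "twisted_points r \<xi> \<subseteq> {x. \<forall>i. x i \<in> {x. x ^ d \<in> ext_field r}}" by blast
  qed
  have split: "card (twisted_points r \<xi>) = card {x \<in> twisted_points r \<xi>. \<forall>i. x i \<noteq> 0} + card {x \<in> twisted_points r \<xi>. \<exists>i. x i = 0}"
    if "\<xi> \<in> G_elems" for \<xi>
  proof -
    have "twisted_points r \<xi> = {x \<in> twisted_points r \<xi>. \<forall>i. x i \<noteq> 0} \<union> {x \<in> twisted_points r \<xi>. \<exists>i. x i = 0}" by blast
    hence "card (twisted_points r \<xi>) = card ({x \<in> twisted_points r \<xi>. \<forall>i. x i \<noteq> 0} \<union> {x \<in> twisted_points r \<xi>. \<exists>i. x i = 0})" by simp
    also have "\<dots> = card {x \<in> twisted_points r \<xi>. \<forall>i. x i \<noteq> 0} + card {x \<in> twisted_points r \<xi>. \<exists>i. x i = 0}"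
      by (rule card_Un_disjoint) (use fT[OF that] in auto)
    finally show ?thesis .
  qed
  have "of_nat d ^ (CARD('n) - 1) * ((Q - 1) * ?N) =
    (\<Sum>\<xi>\<in>G_elems. \<phi> (\<Prod>i\<in>UNIV. \<xi> i ^ w i) * of_nat (card {x \<in> twisted_points r \<xi>. \<forall>i. x i \<noteq> 0})) +
    (\<Sum>\<xi>\<in>G_elems. \<phi> (\<Prod>i\<in>UNIV. \<xi> i ^ w i) * of_nat (card {x \<in> twisted_points r \<xi>. \<exists>i. x i = 0}))"
    unfolding N_D_eq[OF r ws, unfolded q1] sum.distrib[symmetric]
    by (intro sum.cong refl) (simp add: split distrib_left)
  also have "\<dots> = of_nat d ^ (CARD('n) - 1) * ((Q - 1) * ?A + (\<Sum>m<d. degenerate_sum r (\<lambda>i. w i + m * h i)))"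
    unfolding nondegenerate_points[OF r \<psi> ws, unfolded q1] degenerate_points[OF r] by (simp add: distrib_left)
  finally have "(Q - 1) * ?N = (Q - 1) * ?A + (\<Sum>m<d. degenerate_sum r (\<lambda>i. w i + m * h i))"
    using d_pos by simp
  also have "(\<Sum>m<d. degenerate_sum r (\<lambda>i. w i + m * h i)) =
      (\<Sum>m<d. if \<forall>i. shift_w w m i = 0 then z else 0) +
      (\<Sum>m<d. if (\<exists>i. shift_w w m i = 0) \<and> (\<exists>i. shift_w w m i \<noteq> 0) then (Q - 1) * J (shift_w w m) else 0)"
    unfolding deg by (rule sum.distrib)
  also have "(\<Sum>m<d. if (\<exists>i. shift_w w m i = 0) \<and> (\<exists>i. shift_w w m i \<noteq> 0) then (Q - 1) * J (shift_w w m) else 0) = (Q - 1) * ?C"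
  proof -
    have "?C = (\<Sum>m | m < d \<and> (\<exists>i. shift_w w m i = 0) \<and> (\<exists>i. shift_w w m i \<noteq> 0). J (shift_w w m))"
      unfolding C_index_eq[OF w] J_def[symmetric]
      by (subst sum.reindex) (auto intro: inj_on_subset[OF shift_w_inj])
    also have "\<dots> = (\<Sum>m<d. if (\<exists>i. shift_w w m i = 0) \<and> (\<exists>i. shift_w w m i \<noteq> 0) then J (shift_w w m) else 0)"
      by (subst sum.inter_filter[symmetric]) (auto intro: sum.cong)
    finally have C: "?C = \<dots>" .
    show ?thesis unfolding C sum_distrib_left by (intro sum.cong refl) (auto simp del: neq0_conv)
  qed
  also have "(\<Sum>m<d. if \<forall>i. shift_w w m i = 0 then z else 0) = (if \<exists>m<d. \<forall>i. shift_w w m i = 0 then z else 0)"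
  proof (cases "\<exists>m<d. \<forall>i. shift_w w m i = 0")
    case True
    then obtain m0 where m0: "m0 < d" "\<forall>i. shift_w w m0 i = 0" by blast
    have "(\<forall>i. shift_w w m i = 0) \<longleftrightarrow> m = m0" if "m < d" for m
      using inj_onD[OF shift_w_inj, of w m m0] that m0 by (auto simp: fun_eq_iff)
    hence "(\<Sum>m<d. if \<forall>i. shift_w w m i = 0 then z else 0) = (\<Sum>m<d. if m = m0 then z else 0)"
      by (intro sum.cong) auto
    also have "\<dots> = z" using m0(1) by simp
    finally show ?thesis unfolding if_P[OF True] .
  next
    case False
    hence "(\<Sum>m<d. if \<forall>i. shift_w w m i = 0 then z else 0) = (\<Sum>m<d. 0)"
      by (intro sum.cong) (auto simp del: not_all)
    thus ?thesis unfolding if_not_P[OF False] by simp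
  qed
  also have "(if \<exists>m<d. \<forall>i. shift_w w m i = 0 then z else 0) = (Q - 1) * ?Z"
  proof (cases "\<exists>m<d. \<forall>i. shift_w w m i = 0")
    case True
    have "(Q - 1) * ((x - 1) / (Q - 1) - y / Q / (Q - 1) - s / Q) = x - 1 - y / Q - (Q - 1) * s / Q" for x y s
    proof -
      have c: "(Q - 1) * (u / (Q - 1)) = u" for u using Q1 by simp
      have "(Q - 1) * (A / (Q - 1) - B / (Q - 1) - S) = A - B - (Q - 1) * S" for A B S
        by (simp only: right_diff_distrib' c)
      from this[of "x - 1" "y / Q" "s / Q"] show ?thesis by (simp only: times_divide_eq_right)
    qed
    thus ?thesis unfolding if_P[OF True] z_def by simp
  next
    case False
    show ?thesis unfolding if_not_P[OF False] by simp
  qed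
  finally have "(Q - 1) * ?N = (Q - 1) * (?A + ?Z + ?C)" by (simp only: distrib_left add.assoc)
  thus ?thesis by (rule mult_left_cancel[OF Q1, THEN iffD1])
qed

end

section \<open>Exponential generating series\<close>

definition log_series :: "(nat \<Rightarrow> qbar) \<Rightarrow> qbar fps" where
  "log_series a = Abs_fps (\<lambda>r. if r = 0 then 0 else a r)"

lemma exp_series_deriv: "fps_X * fps_deriv (exp_series a) = exp_series a * log_series a"
proof -
  let ?A = "Abs_fps (\<lambda>r. if r = 0 then 0 else a r / of_nat r) :: qbar fps"
  have "fps_deriv (exp_series a) = (fps_deriv (fps_exp 1) oo ?A) * fps_deriv ?A"
    unfolding exp_series_def by (rule fps_compose_deriv) simp
  hence "fps_deriv (exp_series a) = exp_series a * fps_deriv ?A" by (simp add: exp_series_def)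
  hence "fps_X * fps_deriv (exp_series a) = exp_series a * (fps_X * fps_deriv ?A)"
    by (simp only: mult.left_commute)
  also have "fps_X * fps_deriv ?A = log_series a"
  proof (rule fps_ext)
    fix k show "fps_nth (fps_X * fps_deriv ?A) k = fps_nth (log_series a) k"
      by (cases k) (auto simp: log_series_def simp del: of_nat_Suc)
  qed
  finally show ?thesis .
qed

lemma exp_series_0: "fps_nth (exp_series a) 0 = 1"
  by (simp add: exp_series_def fps_compose_nth)

text \<open>
A power series with constant term \<open>1\<close> is determined by its logarithmic derivative.
\<close>
lemma exp_series_eqI:
  assumes "fps_X * fps_deriv F = F * log_series a" "fps_nth F 0 = 1"
  shows "exp_series a = F"
  by (rule log_deriv_unique[OF exp_series_deriv assms(1)]) (use assms in \<open>simp_all add: log_series_def exp_series_0\<close>)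

lemma exp_series_cong: "(\<And>r. r > 0 \<Longrightarrow> a r = b r) \<Longrightarrow> exp_series a = exp_series b"
  unfolding exp_series_def by (intro arg_cong[of _ _ "fps_compose _"] fps_ext) simp

lemma exp_series_add: "exp_series (\<lambda>r. a r + b r) = exp_series a * exp_series b"
proof (rule exp_series_eqI)
  have "log_series (\<lambda>r. a r + b r) = log_series a + log_series b"
    by (rule fps_ext) (simp add: log_series_def)
  moreover have "fps_X * fps_deriv (exp_series a * exp_series b) =
    exp_series a * (fps_X * fps_deriv (exp_series b)) + (fps_X * fps_deriv (exp_series a)) * exp_series b"
    by (simp add: algebra_simps)
  ultimately show "fps_X * fps_deriv (exp_series a * exp_series b) = exp_series a * exp_series b * log_series (\<lambda>r. a r + b r)"
    by (simp add: exp_series_deriv algebra_simps)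
qed (simp add: exp_series_0)

lemma exp_series_zero: "exp_series (\<lambda>r. 0) = 1"
  by (rule exp_series_eqI) (auto simp: log_series_def fps_eq_iff)

lemma exp_series_sum: "finite S \<Longrightarrow> exp_series (\<lambda>r. \<Sum>i\<in>S. a i r) = (\<Prod>i\<in>S. exp_series (a i))"
  by (induction S rule: finite_induct) (auto simp: exp_series_zero exp_series_add)

lemma exp_series_minus_power: "exp_series (\<lambda>r. - (c ^ r)) = 1 - fps_const c * fps_X"
proof -
  have "log_series (\<lambda>r. - (c ^ r)) = - power_sum_fps {#c#}"
    by (rule fps_ext) (simp add: log_series_def power_sum_fps_def power_sum_def)
  hence "exp_series (\<lambda>r. - (c ^ r)) = elem_sym_fps {#c#}"
    by (intro exp_series_eqI) (simp_all add: newton_fps)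
  thus ?thesis by (simp add: elem_sym_fps_def)
qed

lemma exp_series_power: "exp_series (\<lambda>r. c ^ r) = inverse (1 - fps_const c * fps_X)"
proof -
  have "exp_series (\<lambda>r. c ^ r) * exp_series (\<lambda>r. - (c ^ r)) = 1"
    by (simp add: exp_series_add[symmetric] exp_series_zero)
  hence "(1 - fps_const c * fps_X) * exp_series (\<lambda>r. c ^ r) = 1"
    by (simp add: exp_series_minus_power mult.commute)
  thus ?thesis by (metis fps_inverse_unique)
qed

lemma exp_series_signed_power:
  "exp_series (\<lambda>r. - ((-1) ^ n) * c ^ r) = (1 - fps_const c * fps_X) powi ((-1) ^ n)"
  by (cases "even n") (simp_all add: exp_series_minus_power exp_series_power power_int_minus)

section \<open>The \<open>L\<close>-functions\<close>

context fermat_data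
begin

lemma C_fac_eq:
  assumes "w \<in> W_set d"
  shows "C_fac \<phi> d h w = exp_series (\<lambda>r. \<Sum>w'\<in>C_index w. - ((-1) ^ CARD('n)) * jacobi_w \<phi> d w' ^ r)"
  unfolding C_fac_def C_index_def[symmetric] exp_series_sum[OF finite_C_index[OF assms]] exp_series_signed_power ..

lemma F_w_eq:
  fixes \<psi> :: "nat \<Rightarrow> 'a alg_closure \<Rightarrow> qbar" and w :: "'n \<Rightarrow> nat"
  assumes r: "r > 0" and \<psi>: "\<psi> r \<in> nontrivial_add_chars (ext_field r)" and w: "d dvd (\<Sum>i\<in>UNIV. w i)"
  shows "F_w \<psi> \<phi> d h w r lam = hypergeom_data.F_val (CARD('a) ^ r) (ext_field r) (\<psi> r) d h w (\<theta> r) (\<rho> r) (to_ac lam)"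
    and "F_w_red \<psi> \<phi> d h w m r lam = hypergeom_data.F_red (ext_field r) (\<psi> r) d h w (\<theta> r) (\<rho> r) m (to_ac lam)"
proof -
  interpret H: hypergeom_data "CARD('a) ^ r" "ext_field r :: 'a alg_closure set" "\<psi> r" d h w "\<theta> r" "\<rho> r"
    by (rule hypergeom_data[OF r \<psi> w])
  have U: "upper_params \<phi> d h w r = H.upper"
    unfolding upper_params_def H.upper_def H.char_group_pow_eq[OF H.\<rho>_in] ..
  have D: "lower_params \<phi> d r = H.lower"
    unfolding lower_params_def H.lower_def H.char_group_pow_eq[OF H.\<theta>_in] ..
  have A: "F_arg d h lam = H.argument (to_ac lam)"
    by (simp add: F_arg_def H.argument_def to_ac_prod)
  show "F_w \<psi> \<phi> d h w r lam = H.F_val (to_ac lam)"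
    unfolding F_w_def U D A by (rule H.F_val_hypergeom)
  show "F_w_red \<psi> \<phi> d h w m r lam = H.F_red m (to_ac lam)"
    unfolding F_w_red_def U D A H.F_red_def Let_def H.char_group_pow_eq[OF H.\<theta>_in] ..
qed

lemma exists_zero_shift:
  assumes "w \<in> W_set d"
  shows "(\<exists>m<d. \<forall>i. shift_w w m i = 0) \<longleftrightarrow> W_equiv \<phi> d h w (\<lambda>i. 0)"
proof -
  have 0: "(\<lambda>i. 0) \<in> (W_set d :: ('n \<Rightarrow> nat) set)" using d_pos by (simp add: W_set_def)
  have "W_equiv \<phi> d h w (\<lambda>i. 0) \<longleftrightarrow> W_equiv \<phi> d h (\<lambda>i. 0) w" by (auto simp: W_equiv_def)
  thus ?thesis unfolding W_equiv_iff[OF assms 0] by (auto simp: fun_eq_iff)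
qed

lemma multiple_equiv_zero:
  assumes w: "w \<in> W_set d" and m: "m < d" "\<And>i. w i mod d = m * h i mod d"
  shows "W_equiv \<phi> d h w (\<lambda>i. 0)"
proof -
  have 0: "(\<lambda>i. 0) \<in> (W_set d :: ('n \<Rightarrow> nat) set)" using d_pos by (simp add: W_set_def)
  have "w = shift_w (\<lambda>i. 0) m" using m(2) w by (auto simp: shift_w_def W_set_def fun_eq_iff)
  thus ?thesis unfolding W_equiv_iff[OF 0 w] using m(1) by blast
qed

theorem L_D_generic:
  fixes \<psi> :: "nat \<Rightarrow> 'a alg_closure \<Rightarrow> qbar" and w :: "'n \<Rightarrow> nat"
  assumes \<psi>: "\<And>r. r \<ge> 1 \<Longrightarrow> \<psi> r \<in> nontrivial_add_chars (ext_field r)"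
    and w: "w \<in> W_set d" and nz: "\<not> W_equiv \<phi> d h w (\<lambda>i. 0)"
  shows "L_D d h lam (chi \<phi> w) =
    exp_series (\<lambda>r. (-1) ^ CARD('n) * jacobi_w \<phi> d w ^ r * F_w \<psi> \<phi> d h w r lam) * C_fac \<phi> d h w"
  unfolding L_D_def C_fac_eq[OF w] exp_series_add[symmetric]
proof (rule exp_series_cong)
  fix r :: nat assume r: "r > 0"
  have \<psi>r: "\<psi> r \<in> nontrivial_add_chars (ext_field r)" and \<psi>1: "\<psi> 1 \<in> nontrivial_add_chars (ext_field 1)"
    using \<psi> r by auto
  have ws: "d dvd (\<Sum>i\<in>UNIV. w i)" using w by (simp add: W_set_def)
  interpret H: hypergeom_data "CARD('a) ^ r" "ext_field r :: 'a alg_closure set" "\<psi> r" d h w "\<theta> r" "\<rho> r"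
    by (rule hypergeom_data[OF r \<psi>r ws])
  have L: "to_ac lam \<in> ext_field r - {0}" using lam to_ac_in_ext_field by simp
  have "\<exists>i. w i \<noteq> 0"
  proof (rule ccontr)
    assume "\<nexists>i. w i \<noteq> 0"
    hence "w = (\<lambda>i. 0)" by auto
    thus False using nz by (simp add: W_equiv_def)
  qed
  hence J: "H.J_val = jacobi_w \<phi> d w ^ r" by (rule J_val_lift[OF r \<psi>r \<psi>1 w])
  have "H.affine_sum ((of_nat d * to_ac lam) ^ d) = (-1) ^ CARD('n) * (H.J_val * H.F_val (to_ac lam))"
    by (rule H.affine_sum_generic[OF L]) (use multiple_equiv_zero[OF w] nz in blast)
  thus "N_D d h lam (chi \<phi> w) r = (-1) ^ CARD('n) * jacobi_w \<phi> d w ^ r * F_w \<psi> \<phi> d h w r lam +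
      (\<Sum>w'\<in>C_index w. - ((-1) ^ CARD('n)) * jacobi_w \<phi> d w' ^ r)"
    unfolding N_D_formula[OF r \<psi>r \<psi>1 w] F_w_eq(1)[where \<psi> = \<psi>, OF r \<psi>r ws] exists_zero_shift[OF w] if_not_P[OF nz] J
    by (simp only: add_0_right mult.assoc)
qed

text \<open>
The class of \<open>w\<close> contains \<open>0\<close>. With \<open>Q = q ^ r\<close>, the contribution of \<open>0\<close> is \<open>(Q ^ (n - 1) - 1) / (Q - 1)\<close>, which
yields the powers of \<open>q\<close>, and two more terms, which cancel against the two extra terms of
\<open>affine_sum_special\<close>.
\<close>
theorem L_D_special:
  fixes \<psi> :: "nat \<Rightarrow> 'a alg_closure \<Rightarrow> qbar" and w :: "'n \<Rightarrow> nat"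
  assumes n: "CARD('n) \<ge> 2" and \<psi>: "\<And>r. r \<ge> 1 \<Longrightarrow> \<psi> r \<in> nontrivial_add_chars (ext_field r)"
    and w: "w \<in> W_set d" and m: "m < d" and wm: "\<And>i. w i = (m * h i) mod d"
  shows "L_D d h lam (chi \<phi> w) =
    exp_series (\<lambda>r. (-1) ^ CARD('n) * jacobi_w \<phi> d w ^ (r * (1 - (if m = 0 then 1 else 0))) * F_w_red \<psi> \<phi> d h w m r lam)
    * (\<Prod>k = 0..CARD('n) - 2. 1 / (1 - fps_const (of_nat (CARD('a) ^ k)) * fps_X)) * C_fac \<phi> d h w"
proof -
  have P: "(\<Prod>k = 0..CARD('n) - 2. 1 / (1 - fps_const (of_nat (CARD('a) ^ k)) * fps_X)) =
    exp_series (\<lambda>r. \<Sum>k = 0..CARD('n) - 2. of_nat (CARD('a) ^ k) ^ r)"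
    by (subst exp_series_sum) (auto simp: exp_series_power fps_divide_unit intro!: prod.cong)
  have "\<And>i. w i mod d = m * h i mod d" using wm by simp
  hence eqz: "W_equiv \<phi> d h w (\<lambda>i. 0)" by (rule multiple_equiv_zero[OF w m])
  show ?thesis
    unfolding L_D_def P C_fac_eq[OF w] exp_series_add[symmetric]
  proof (rule exp_series_cong)
    fix r :: nat assume r: "r > 0"
    have \<psi>r: "\<psi> r \<in> nontrivial_add_chars (ext_field r)" and \<psi>1: "\<psi> 1 \<in> nontrivial_add_chars (ext_field 1)"
      using \<psi> r by auto
    have ws: "d dvd (\<Sum>i\<in>UNIV. w i)" using w by (simp add: W_set_def)
    interpret H: hypergeom_data "CARD('a) ^ r" "ext_field r :: 'a alg_closure set" "\<psi> r" d h w "\<theta> r" "\<rho> r"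
      by (rule hypergeom_data[OF r \<psi>r ws])
    define Q where "Q = (of_nat (CARD('a) ^ r) :: qbar)"
    have q1: "of_nat (CARD('a) ^ r - 1) = Q - 1" using H.Q_gt_1 by (simp add: Q_def of_nat_diff)
    have "CARD('a) ^ r - 1 \<noteq> 0" using H.Q_gt_1 by simp
    hence "of_nat (CARD('a) ^ r - 1) \<noteq> (0 :: qbar)" unfolding of_nat_eq_0_iff .
    hence Q1: "Q - 1 \<noteq> 0" unfolding q1 .
    have L: "to_ac lam \<in> ext_field r - {0}" using lam to_ac_in_ext_field by simp
    have J: "H.J_val ^ (if m = 0 then 0 else 1) = jacobi_w \<phi> d w ^ (r * (1 - (if m = 0 then 1 else 0)))"
    proof (cases "m = 0")
      case False
      have "\<exists>i. w i \<noteq> 0"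
      proof (rule ccontr)
        assume "\<nexists>i. w i \<noteq> 0"
        hence "d dvd m * h i" for i using wm[of i] by (simp add: dvd_eq_mod_eq_0)
        hence "d dvd m" by (rule gcd_h)
        thus False using m False by (auto dest: dvd_imp_le)
      qed
      hence "H.J_val = jacobi_w \<phi> d w ^ r" by (rule J_val_lift[OF r \<psi>r \<psi>1 w])
      thus ?thesis using False by simp
    qed simp
    have geo: "(Q ^ (CARD('n) - 1) - 1) / (Q - 1) = (\<Sum>k = 0..CARD('n) - 2. of_nat (CARD('a) ^ k) ^ r)"
    proof -
      have "(\<Sum>k = 0..CARD('n) - 2. of_nat (CARD('a) ^ k) ^ r) = (\<Sum>k<CARD('n) - 1. Q ^ k)"
        using n by (intro sum.cong) (auto simp: Q_def power_mult[symmetric] mult.commute)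
      also have "\<dots> = (Q ^ (CARD('n) - 1) - 1) / (Q - 1)" using Q1 by (simp add: geometric_sum)
      finally show ?thesis ..
    qed
    have A: "H.affine_sum ((of_nat d * to_ac lam) ^ d) =
      (-1) ^ CARD('n) * (H.J_val ^ (if m = 0 then 0 else 1) * H.F_red m (to_ac lam)) + (-1) ^ CARD('n) / Q
      + (Q - 1) ^ CARD('n) / Q / (Q - 1)"
      using H.affine_sum_special[OF L m wm] unfolding Q_def[symmetric] q1 .
    have cancel: "a + s + t + (g - t - s) + c = a + g + c" for a s t g c :: qbar by simp
    show "N_D d h lam (chi \<phi> w) r =
      (-1) ^ CARD('n) * jacobi_w \<phi> d w ^ (r * (1 - (if m = 0 then 1 else 0))) * F_w_red \<psi> \<phi> d h w m r lam
      + (\<Sum>k = 0..CARD('n) - 2. of_nat (CARD('a) ^ k) ^ r)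
      + (\<Sum>w'\<in>C_index w. - ((-1) ^ CARD('n)) * jacobi_w \<phi> d w' ^ r)"
      unfolding N_D_formula[OF r \<psi>r \<psi>1 w] Q_def[symmetric] F_w_eq(2)[where \<psi> = \<psi>, OF r \<psi>r ws]
        exists_zero_shift[OF w] if_P[OF eqz] A J[symmetric] geo[symmetric] cancel
      by (simp only: mult.assoc)
  qed
qed

end

theorem corollary3p6:
  fixes d :: nat and h w :: "'n::finite \<Rightarrow> nat" and lam :: "'a::finite_field"
    and \<phi> :: "'a \<Rightarrow> qbar" and \<psi> :: "nat \<Rightarrow> 'a alg_closure \<Rightarrow> qbar"
  assumes "d \<ge> 2" and "CARD('n) \<ge> 2"
    and "\<And>i. h i \<ge> 1" and "(\<Sum>i\<in>UNIV. h i) = d" and "Gcd (insert d (range h)) = 1"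
    and "\<And>i. d * h i dvd CARD('a) - 1"
    and "\<phi> \<in> carrier (char_group UNIV)"
    and "generate (char_group UNIV) {\<phi>} = carrier (char_group UNIV)"
    and "\<And>r. r \<ge> 1 \<Longrightarrow> \<psi> r \<in> nontrivial_add_chars (ext_field r)"
    and "lam \<noteq> 0" and "w \<in> W_set d"
  shows "(\<forall>m<d. (\<forall>i. w i = (m * h i) mod d) \<longrightarrow>
            L_D d h lam (chi \<phi> w) =
              exp_series (\<lambda>r. (-1) ^ CARD('n) * jacobi_w \<phi> d w ^ (r * (1 - (if m = 0 then 1 else 0)))
                                * F_w_red \<psi> \<phi> d h w m r lam)
              * (\<Prod>k = 0..CARD('n) - 2. 1 / (1 - fps_const (of_nat (CARD('a) ^ k)) * fps_X))
              * C_fac \<phi> d h w) \<and>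
         (\<not> W_equiv \<phi> d h w (\<lambda>i. 0) \<longrightarrow>
            L_D d h lam (chi \<phi> w) =
              exp_series (\<lambda>r. (-1) ^ CARD('n) * jacobi_w \<phi> d w ^ r * F_w \<psi> \<phi> d h w r lam)
              * C_fac \<phi> d h w)"
proof -
  interpret fermat_data d h lam \<phi>
  proof
    show "d > 0" using assms(1) by simp
    show "h i > 0" for i using assms(3)[of i] by simp
  qed (use assms in simp_all)
  show ?thesis
    using L_D_special[OF assms(2,9,11)] L_D_generic[OF assms(9,11)] by blast
qed

end
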